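(* Let $\lambda\in\mathbb{Q}\cap\,]0,1]$ and let $E$ be a $[\lambda]$-primitive fresco of rank $k$. Then $E$ is semi-simple if and only if it admits a Jordan-Hölder sequence, with successive rank 1 quotients $E_{\mu_1},\dots,E_{\mu_k}$, such that the sequence $j\mapsto\mu_j+j$, $j\in[1,k]$, is strictly decreasing.
   Context: $\tilde{\mathcal A}$ is the $\mathbb{C}$-algebra of formal series $\sum_{\nu\ge 0}P_\nu(a)b^\nu$, $P_\nu\in\mathbb{C}[x]$, with $ab-ba=b^2$, left and right multiplication by $a$ being continuous for the $b$-adic filtration. An (a,b)-module is a left $\tilde{\mathcal A}$-module free of finite rank over $\mathbb{C}[[b]]$; submodule means left $\tilde{\mathcal A}$-submodule. It has a simple pole if $aE\subset bE$; then its Bernstein polynomial is the minimal polynomial of $-b^{-1}a$ on $E/bE$. It is regular if it embeds in a simple pole (a,b)-module; its Bernstein polynomial is then that of its saturation $E^\sharp$ by $b^{-1}a$. It is geometric if regular with all roots of the Bernstein polynomial rational and strictly negative. A fresco is a geometric (a,b)-module generated by one element over $\tilde{\mathcal A}$. A regular (a,b)-module is $[\lambda]$-primitive if all roots of its Bernstein polynomial lie in $-\lambda+\mathbb{Z}$. A submodule $F\subset E$ is normal if $F\cap bE=bF$. For $\mu\in\mathbb{C}$, $E_\mu:=\tilde{\mathcal A}/\tilde{\mathcal A}(a-\mu b)$; every regular rank 1 (a,b)-module is isomorphic to exactly one $E_\mu$. A Jordan-Hölder sequence of a rank $k$ regular (a,b)-module $E$ is a sequence $0=F_0\subset F_1\subset\dots\subset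 F_k=E$ of normal submodules with $F_j/F_{j-1}$ of rank 1, so $F_j/F_{j-1}\simeq E_{\mu_j}$. A regular (a,b)-module is semi-simple if it is isomorphic to a submodule of a finite direct sum of regular rank 1 (a,b)-modules. *)

theory Defs
  imports
    "HOL-Algebra.Module"
    "HOL-Algebra.AbelCoset"
    "HOL-Computational_Algebra.Computational_Algebra"
begin

section \<open>Modules over a not necessarily commutative ring\<close>

text \<open>The locale \<^locale>\<open>module\<close> requires a commutative ring of scalars. The fields \<open>mult\<close>
  and \<open>one\<close> of the record of a module play no role.\<close>

locale left_module = R?: ring R + M?: abelian_group M
  for R :: "('a, 'm) ring_scheme" (structure)
    and M :: "('a, 'b, 'n) module_scheme" (structure) +
  assumes smult_closed [simp, intro]:
      "\<lbrakk>r \<in> carrier R; x \<in> carrier M\<rbrakk> \<Longrightarrow> r \<odot>\<^bsub>M\<^esub> x \<in> carrier M"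
    and smult_l_distr:
      "\<lbrakk>r \<in> carrier R; s \<in> carrier R; x \<in> carrier M\<rbrakk> \<Longrightarrow>
        (r \<oplus> s) \<odot>\<^bsub>M\<^esub> x = r \<odot>\<^bsub>M\<^esub> x \<oplus>\<^bsub>M\<^esub> s \<odot>\<^bsub>M\<^esub> x"
    and smult_r_distr:
      "\<lbrakk>r \<in> carrier R; x \<in> carrier M; y \<in> carrier M\<rbrakk> \<Longrightarrow>
        r \<odot>\<^bsub>M\<^esub> (x \<oplus>\<^bsub>M\<^esub> y) = r \<odot>\<^bsub>M\<^esub> x \<oplus>\<^bsub>M\<^esub> r \<odot>\<^bsub>M\<^esub> y"
    and smult_assoc1:
      "\<lbrakk>r \<in> carrier R; s \<in> carrier R; x \<in> carrier M\<rbrakk> \<Longrightarrow>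
        (r \<otimes> s) \<odot>\<^bsub>M\<^esub> x = r \<odot>\<^bsub>M\<^esub> (s \<odot>\<^bsub>M\<^esub> x)"
    and smult_one [simp]: "x \<in> carrier M \<Longrightarrow> \<one> \<odot>\<^bsub>M\<^esub> x = x"

definition module_hom ::
  "('a, 'm) ring_scheme \<Rightarrow> ('a, 'b, 'n) module_scheme \<Rightarrow> ('a, 'c, 'l) module_scheme \<Rightarrow> ('b \<Rightarrow> 'c) set"
  where "module_hom R M N =
    {h \<in> carrier M \<rightarrow> carrier N.
       (\<forall>x\<in>carrier M. \<forall>y\<in>carrier M. h (x \<oplus>\<^bsub>M\<^esub> y) = h x \<oplus>\<^bsub>N\<^esub> h y) \<and>
       (\<forall>r\<in>carrier R. \<forall>x\<in>carrier M. h (r \<odot>\<^bsub>M\<^esub> x) = r \<odot>\<^bsub>N\<^esub> h x)}"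

definition module_isomorphic ::
  "('a, 'm) ring_scheme \<Rightarrow> ('a, 'b, 'n) module_scheme \<Rightarrow> ('a, 'c, 'l) module_scheme \<Rightarrow> bool"
  where "module_isomorphic R M N \<longleftrightarrow>
    (\<exists>h \<in> module_hom R M N. bij_betw h (carrier M) (carrier N))"

text \<open>The map on cosets of \<open>H\<close> induced by \<open>f\<close>; if \<open>f\<close> is additive and maps \<open>H\<close> to \<open>H\<close>, the
  union is the single coset \<open>H + f x\<close>.\<close>

definition induced_map ::
  "('a, 'b, 'n) module_scheme \<Rightarrow> 'b set \<Rightarrow> ('b \<Rightarrow> 'b) \<Rightarrow> 'b set \<Rightarrow> 'b set"
  where "induced_map M H f X = (\<Union>x\<in>X. H +>\<^bsub>M\<^esub> f x)"

definition quot_module ::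
  "('a, 'b, 'n) module_scheme \<Rightarrow> 'b set \<Rightarrow> ('a, 'b set) module"
  where "quot_module M H =
    \<lparr>carrier = a_rcosets\<^bsub>M\<^esub> H, monoid.mult = undefined, one = undefined,
     zero = H, add = set_add M, module.smult = (\<lambda>r. induced_map M H (\<lambda>x. r \<odot>\<^bsub>M\<^esub> x))\<rparr>"

definition regular_left_module :: "('a, 'm) ring_scheme \<Rightarrow> ('a, 'a) module"
  where "regular_left_module R =
    \<lparr>carrier = carrier R, monoid.mult = monoid.mult R, one = one R,
     zero = zero R, add = add R, module.smult = monoid.mult R\<rparr>"

definition direct_sum_module ::
  "nat \<Rightarrow> (nat \<Rightarrow> ('a, 'b, 'n) module_scheme) \<Rightarrow> ('a, nat \<Rightarrow> 'b) module"
  where "direct_sum_module n M =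
    \<lparr>carrier = (\<Pi>\<^sub>E i\<in>{..<n}. carrier (M i)), monoid.mult = undefined, one = undefined,
     zero = (\<lambda>i\<in>{..<n}. \<zero>\<^bsub>M i\<^esub>),
     add = (\<lambda>x y. \<lambda>i\<in>{..<n}. x i \<oplus>\<^bsub>M i\<^esub> y i),
     module.smult = (\<lambda>r x. \<lambda>i\<in>{..<n}. r \<odot>\<^bsub>M i\<^esub> x i)\<rparr>"


section \<open>The algebra of formal series in \<open>a\<close> and \<open>b\<close>\<close>

text \<open>The series \<open>\<Sum>\<nu>. P\<^sub>\<nu>(a) b\<^sup>\<nu>\<close> is represented by the element of \<^typ>\<open>complex poly fps\<close> with
  coefficients \<open>P\<^sub>\<nu>\<close>; its ring structure is \<^emph>\<open>not\<close> the commutative one of that type.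
  The relation \<open>ab - ba = b\<^sup>2\<close> gives \<open>b Q(a) = Q(a) b - Q'(a) b\<^sup>2 + Q''(a) b\<^sup>3 - \<dots>\<close> and hence
  \<open>b\<^sup>m Q(a) = \<Sum>j. (-m gchoose j) Q\<^bsup>(j)\<^esup>(a) b\<^bsup>m+j\<^esup>\<close>; by continuity this determines the product.\<close>

type_synonym ab_series = "complex poly fps"

definition ab_mult :: "ab_series \<Rightarrow> ab_series \<Rightarrow> ab_series"
  where "ab_mult X Y = Abs_fps (\<lambda>N. \<Sum>m\<le>N. \<Sum>j\<le>N - m.
    Polynomial.smult ((- of_nat m) gchoose j)
      (fps_nth X m * (pderiv ^^ j) (fps_nth Y (N - m - j))))"

definition ab_algebra :: "ab_series ring"
  where "ab_algebra = \<lparr>carrier = UNIV, monoid.mult = ab_mult, one = 1, zero = 0, add = (+)\<rparr>"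

definition ab_a :: ab_series where "ab_a = fps_const [:0, 1:]"

definition ab_b :: ab_series where "ab_b = fps_X"

text \<open>The inclusions of \<open>\<complex>\<close> and of \<open>\<complex>[[b]]\<close> in the algebra.\<close>

definition ab_const :: "complex \<Rightarrow> ab_series" where "ab_const c = fps_const [:c:]"

definition ab_of_fps :: "complex fps \<Rightarrow> ab_series"
  where "ab_of_fps f = Abs_fps (\<lambda>n. [:fps_nth f n:])"


subsection \<open>The algebra is a ring\<close>

text \<open>\<open>bpow_coeff m Y N\<close> is the coefficient at \<open>b\<^sup>N\<close> of the product \<open>b\<^sup>m Y\<close>.\<close>

definition bpow_coeff :: "nat \<Rightarrow> (nat \<Rightarrow> complex poly) \<Rightarrow> nat \<Rightarrow> complex poly"
  where "bpow_coeff m Y N = (if m \<le> N then \<Sum>j\<le>N - m.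
    Polynomial.smult ((- of_nat m) gchoose j) ((pderiv ^^ j) (Y (N - m - j))) else 0)"

lemma bpow_coeff_0: "bpow_coeff 0 Y = Y"
proof
  fix N
  have "(0 :: complex) gchoose j = (if j = 0 then 1 else 0)" for j
    by (cases j) simp_all
  then have "bpow_coeff 0 Y N = (\<Sum>j\<le>N. if j = 0 then Y N else 0)"
    by (auto simp: bpow_coeff_def simp del: sum.delta sum.delta' intro!: sum.cong)
  then show "bpow_coeff 0 Y N = Y N" by simp
qed

lemma bpow_coeff_small: "N < m \<Longrightarrow> bpow_coeff m Y N = 0"
  by (simp add: bpow_coeff_def)

lemma bpow_coeff_Suc:
  "bpow_coeff (Suc m) Y (Suc N) + pderiv (bpow_coeff (Suc m) Y N) = bpow_coeff m Y N"
proof (cases "m \<le> N")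
  case False
  then show ?thesis by (simp add: bpow_coeff_def)
next
  case True
  define d where "d = N - m"
  let ?c = "\<lambda>i. (- of_nat (Suc m) :: complex) gchoose i"
  let ?t = "\<lambda>j. (pderiv ^^ j) (Y (d - j))"
  have 1: "bpow_coeff (Suc m) Y (Suc N) = (\<Sum>j\<le>d. Polynomial.smult (?c j) (?t j))"
    using True by (simp add: bpow_coeff_def d_def)
  have 2: "bpow_coeff m Y N = (\<Sum>j\<le>d. Polynomial.smult ((- of_nat m) gchoose j) (?t j))"
    using True by (simp add: bpow_coeff_def d_def)
  have pascal: "(- of_nat m :: complex) gchoose Suc j = ?c j + ?c (Suc j)" for j
    using gbinomial_Suc_Suc[of "- of_nat (Suc m) :: complex" j] by simp
  show ?thesis
  proof (cases d)
    case 0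
    then have "bpow_coeff (Suc m) Y N = 0" using d_def True by (simp add: bpow_coeff_def)
    then show ?thesis using 1 2 0 by simp
  next
    case (Suc e)
    then have "Suc m \<le> N" and e: "N - Suc m = e" using d_def by auto
    then have "pderiv (bpow_coeff (Suc m) Y N) =
        (\<Sum>j\<le>e. Polynomial.smult (?c j) (?t (Suc j)))"
      by (simp add: bpow_coeff_def higher_pderiv_sum[of 1, simplified] pderiv_smult Suc)
    moreover have "bpow_coeff (Suc m) Y (Suc N) =
        ?t 0 + (\<Sum>j\<le>e. Polynomial.smult (?c (Suc j)) (?t (Suc j)))"
      unfolding 1 Suc by (subst sum.atMost_Suc_shift) simp
    moreover have "bpow_coeff m Y N =
        ?t 0 + (\<Sum>j\<le>e. Polynomial.smult (?c j + ?c (Suc j)) (?t (Suc j)))"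
      unfolding 2 Suc by (subst sum.atMost_Suc_shift) (simp only: pascal, simp)
    ultimately show ?thesis
      by (simp add: smult_add_left sum.distrib algebra_simps)
  qed
qed

lemma bpow_coeff_unique:
  assumes "T 0 = 0" and "\<And>N. T (Suc N) + pderiv (T N) = W N"
  shows "T = bpow_coeff 1 W"
proof
  fix N
  show "T N = bpow_coeff 1 W N"
  proof (induction N)
    case 0
    then show ?case using assms(1) by (simp add: bpow_coeff_def)
  next
    case (Suc N)
    have "T (Suc N) + pderiv (T N) = bpow_coeff 1 W (Suc N) + pderiv (bpow_coeff 1 W N)"
      using assms(2)[of N] bpow_coeff_Suc[of 0 W N] by (simp add: bpow_coeff_0)
    then show ?case using Suc by simp
  qed
qed

lemma bpow_coeff_step: "bpow_coeff (Suc m) Y = bpow_coeff 1 (bpow_coeff m Y)"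
  by (rule bpow_coeff_unique) (simp_all add: bpow_coeff_small bpow_coeff_Suc)

lemma bpow_coeff_add:
  "bpow_coeff m (fps_nth (Y + Z)) N = bpow_coeff m (fps_nth Y) N + bpow_coeff m (fps_nth Z) N"
  by (simp add: bpow_coeff_def higher_pderiv_add smult_add_right sum.distrib)

lemma fps_nth_ab_mult:
  assumes "N \<le> K"
  shows "fps_nth (ab_mult X Y) N = (\<Sum>m\<le>K. fps_nth X m * bpow_coeff m (fps_nth Y) N)"
proof -
  have "fps_nth (ab_mult X Y) N = (\<Sum>m\<le>N. fps_nth X m * bpow_coeff m (fps_nth Y) N)"
    unfolding ab_mult_def by (simp add: bpow_coeff_def sum_distrib_left)
  also have "\<dots> = (\<Sum>m\<le>K. fps_nth X m * bpow_coeff m (fps_nth Y) N)"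
    using assms by (intro sum.mono_neutral_left) (auto simp: bpow_coeff_small)
  finally show ?thesis .
qed

lemma ab_mult_bpow1:
  "fps_nth (ab_mult (Abs_fps (bpow_coeff 1 (fps_nth Y))) Z) =
    bpow_coeff 1 (fps_nth (ab_mult Y Z))"
proof (rule bpow_coeff_unique)
  let ?L = "bpow_coeff 1 (fps_nth Y)"
  let ?G = "\<lambda>m. bpow_coeff m (fps_nth Z)"
  let ?T = "fps_nth (ab_mult (Abs_fps ?L) Z)"
  have L0: "?L 0 = 0" by (simp add: bpow_coeff_def)
  show "?T 0 = 0" by (simp add: fps_nth_ab_mult[of 0 0] L0 del: One_nat_def)
  fix N
  have L: "?L (Suc m) + pderiv (?L m) = fps_nth Y m" for m
    using bpow_coeff_Suc[of 0 "fps_nth Y" m] by (simp add: bpow_coeff_0)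
  have A: "?T (Suc N) = (\<Sum>m\<le>N. ?L (Suc m) * ?G (Suc m) (Suc N))"
    by (subst fps_nth_ab_mult[of _ "Suc N"], simp, subst sum.atMost_Suc_shift)
       (simp add: L0 del: One_nat_def)
  have B: "pderiv (?T N) = (\<Sum>m\<le>N. pderiv (?L m) * ?G m N)
      + (\<Sum>m\<le>Suc N. ?L m * pderiv (?G m N))"
  proof -
    have "pderiv (?T N) = (\<Sum>m\<le>Suc N. pderiv (?L m) * ?G m N)
      + (\<Sum>m\<le>Suc N. ?L m * pderiv (?G m N))"
      by (subst fps_nth_ab_mult[of _ "Suc N"], simp)
         (simp add: higher_pderiv_sum[of 1, simplified] pderiv_mult sum.distrib algebra_simps del: One_nat_def sum.atMost_Suc)
    then show ?thesis by (simp add: bpow_coeff_small del: One_nat_def)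
  qed
  have C: "(\<Sum>m\<le>Suc N. ?L m * pderiv (?G m N)) = (\<Sum>m\<le>N. ?L (Suc m) * pderiv (?G (Suc m) N))"
    by (subst sum.atMost_Suc_shift) (simp add: L0 del: One_nat_def)
  have "?T (Suc N) + pderiv (?T N) =
      (\<Sum>m\<le>N. ?L (Suc m) * (?G (Suc m) (Suc N) + pderiv (?G (Suc m) N)) + pderiv (?L m) * ?G m N)"
    unfolding A B C by (simp add: sum.distrib algebra_simps del: One_nat_def)
  also have "\<dots> = (\<Sum>m\<le>N. (?L (Suc m) + pderiv (?L m)) * ?G m N)"
    by (simp only: bpow_coeff_Suc distrib_right)
  also have "\<dots> = fps_nth (ab_mult Y Z) N"
    by (simp only: L fps_nth_ab_mult[OF order.refl])
  finally show "?T (Suc N) + pderiv (?T N) = fps_nth (ab_mult Y Z) N" .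
qed

lemma ab_mult_bpow:
  "fps_nth (ab_mult (Abs_fps (bpow_coeff m (fps_nth Y))) Z) =
    bpow_coeff m (fps_nth (ab_mult Y Z))"
proof (induction m)
  case 0
  then show ?case by (simp add: bpow_coeff_0 fps_nth_inverse)
next
  case (Suc m)
  have "fps_nth (Abs_fps (bpow_coeff m (fps_nth Y))) = bpow_coeff m (fps_nth Y)"
    by (rule ext) simp
  then show ?case
    using ab_mult_bpow1[of "Abs_fps (bpow_coeff m (fps_nth Y))" Z] Suc
    by (simp add: bpow_coeff_step[of m] del: One_nat_def)
qed

lemma ab_mult_assoc: "ab_mult (ab_mult X Y) Z = ab_mult X (ab_mult Y Z)"
proof (rule fps_ext)
  fix N
  let ?G = "\<lambda>m. bpow_coeff m (fps_nth Y)"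
  have "fps_nth (ab_mult (ab_mult X Y) Z) N =
      (\<Sum>l\<le>N. (\<Sum>m\<le>N. fps_nth X m * ?G m l) * bpow_coeff l (fps_nth Z) N)"
    by (subst fps_nth_ab_mult[OF order.refl], rule sum.cong) (auto simp: fps_nth_ab_mult[of _ N])
  also have "\<dots> = (\<Sum>l\<le>N. \<Sum>m\<le>N. fps_nth X m * (?G m l * bpow_coeff l (fps_nth Z) N))"
    by (simp add: sum_distrib_right mult.assoc)
  also have "\<dots> = (\<Sum>m\<le>N. \<Sum>l\<le>N. fps_nth X m * (?G m l * bpow_coeff l (fps_nth Z) N))"
    by (rule sum.swap)
  also have "\<dots> = (\<Sum>m\<le>N. fps_nth X m * fps_nth (ab_mult (Abs_fps (?G m)) Z) N)"
    by (simp add: sum_distrib_left fps_nth_ab_mult[OF order.refl])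
  also have "\<dots> = fps_nth (ab_mult X (ab_mult Y Z)) N"
    by (simp add: ab_mult_bpow fps_nth_ab_mult[of N N X])
  finally show "fps_nth (ab_mult (ab_mult X Y) Z) N = fps_nth (ab_mult X (ab_mult Y Z)) N" .
qed

lemma ab_mult_1_left: "ab_mult 1 Y = Y"
proof (rule fps_ext)
  fix N
  have "fps_nth (ab_mult 1 Y) N = (\<Sum>m\<le>N. if m = 0 then fps_nth Y N else 0)"
    by (subst fps_nth_ab_mult[OF order.refl], rule sum.cong) (auto simp: bpow_coeff_0)
  then show "fps_nth (ab_mult 1 Y) N = fps_nth Y N" by simp
qed

lemma bpow_coeff_one: "bpow_coeff m (fps_nth 1) N = (if m = N then 1 else 0)"
proof (cases "m \<le> N")
  case True
  have "(pderiv ^^ j) (fps_nth (1 :: ab_series) (N - m - j)) =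
      (if j = 0 \<and> m = N then 1 else 0)" if "j \<le> N - m" for j
    using that True by (cases j) (auto simp: higher_pderiv_0 funpow_Suc_right simp del: funpow.simps)
  then have "bpow_coeff m (fps_nth 1) N = (\<Sum>j\<le>N - m. if j = 0 then if m = N then 1 else 0 else 0)"
    unfolding bpow_coeff_def using True
    by (simp del: sum.delta sum.delta' cong: if_cong)
  then show ?thesis by simp
qed (simp add: bpow_coeff_def)

lemma ab_mult_1_right: "ab_mult X 1 = X"
  by (rule fps_ext) (simp add: fps_nth_ab_mult[OF order.refl] bpow_coeff_one if_distrib cong: if_cong)

lemma ab_mult_distrib_right: "ab_mult (X + Y) Z = ab_mult X Z + ab_mult Y Z"
  by (rule fps_ext)
     (simp add: fps_nth_ab_mult[OF order.refl] distrib_right sum.distrib)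

lemma ab_mult_distrib_left: "ab_mult X (Y + Z) = ab_mult X Y + ab_mult X Z"
  by (rule fps_ext)
     (simp add: fps_nth_ab_mult[OF order.refl] bpow_coeff_add distrib_left sum.distrib)

lemma ring_ab_algebra: "ring ab_algebra"
proof (rule ringI)
  show "abelian_group ab_algebra"
  proof (rule abelian_groupI)
    fix x assume "x \<in> carrier ab_algebra"
    show "\<exists>y\<in>carrier ab_algebra. y \<oplus>\<^bsub>ab_algebra\<^esub> x = \<zero>\<^bsub>ab_algebra\<^esub>"
      by (rule bexI[of _ "- x"]) (simp_all add: ab_algebra_def)
  qed (simp_all add: ab_algebra_def add.assoc add.commute)
  show "Group.monoid ab_algebra"
    by (rule Group.monoidI)
       (simp_all add: ab_algebra_def ab_mult_assoc ab_mult_1_left ab_mult_1_right)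
qed (simp_all add: ab_algebra_def ab_mult_distrib_left ab_mult_distrib_right)

lemma ab_commutation: "ab_mult ab_a ab_b - ab_mult ab_b ab_a = ab_mult ab_b ab_b"
proof (rule fps_ext)
  fix N
  have b: "fps_nth (ab_mult ab_b Y) N = bpow_coeff 1 (fps_nth Y) N" for Y N
  proof -
    have "fps_nth (ab_mult ab_b Y) N =
        (\<Sum>m\<le>Suc N. if m = 1 then bpow_coeff 1 (fps_nth Y) N else 0)"
      by (subst fps_nth_ab_mult[of _ "Suc N"], simp, rule sum.cong) (auto simp: ab_b_def)
    then show ?thesis by simp
  qed
  have "fps_nth (ab_mult ab_a ab_b) N =
      (\<Sum>m\<le>N. if m = 0 then [:0, 1:] * fps_nth ab_b N else 0)"
    by (subst fps_nth_ab_mult[OF order.refl], rule sum.cong) (auto simp: ab_a_def bpow_coeff_0)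
  then have ab: "fps_nth (ab_mult ab_a ab_b) N = (if N = 1 then [:0, 1:] else 0)"
    by (simp add: ab_b_def)
  have ba: "(\<lambda>N. if N = 1 then [:0, 1:] else if N = 2 then - 1 else 0) =
      bpow_coeff 1 (fps_nth ab_a)"
    by (rule bpow_coeff_unique) (auto simp: ab_a_def pderiv_pCons pderiv_minus one_pCons)
  have bb: "(\<lambda>N. if N = 2 then 1 else 0) = bpow_coeff 1 (fps_nth ab_b)"
    by (rule bpow_coeff_unique) (auto simp: ab_b_def)
  show "fps_nth (ab_mult ab_a ab_b - ab_mult ab_b ab_a) N = fps_nth (ab_mult ab_b ab_b) N"
    by (simp only: fps_sub_nth ab b fun_cong[OF ba, symmetric] fun_cong[OF bb, symmetric]) simp
qed


section \<open>(a,b)-modules\<close>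

text \<open>\<open>e 0, \<dots>, e (k - 1)\<close> is a basis over \<open>\<complex>[[b]]\<close>.\<close>

definition ab_basis :: "(ab_series, 'e) module \<Rightarrow> nat \<Rightarrow> (nat \<Rightarrow> 'e) \<Rightarrow> bool"
  where "ab_basis E k e \<longleftrightarrow> e \<in> {..<k} \<rightarrow> carrier E \<and>
    (\<forall>x\<in>carrier E. \<exists>!c. c \<in> {..<k} \<rightarrow>\<^sub>E UNIV \<and>
        x = (\<Oplus>\<^bsub>E\<^esub>i\<in>{..<k}. ab_of_fps (c i) \<odot>\<^bsub>E\<^esub> e i))"

definition ab_module_of_rank :: "nat \<Rightarrow> (ab_series, 'e) module \<Rightarrow> bool"
  where "ab_module_of_rank k E \<longleftrightarrow> left_module ab_algebra E \<and> (\<exists>e. ab_basis E k e)"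

definition ab_module :: "(ab_series, 'e) module \<Rightarrow> bool"
  where "ab_module E \<longleftrightarrow> (\<exists>k. ab_module_of_rank k E)"

definition b_image :: "(ab_series, 'e) module \<Rightarrow> 'e set \<Rightarrow> 'e set"
  where "b_image E S = (\<lambda>x. ab_b \<odot>\<^bsub>E\<^esub> x) ` S"

definition a_image :: "(ab_series, 'e) module \<Rightarrow> 'e set \<Rightarrow> 'e set"
  where "a_image E S = (\<lambda>x. ab_a \<odot>\<^bsub>E\<^esub> x) ` S"

definition simple_pole :: "(ab_series, 'e) module \<Rightarrow> bool"
  where "simple_pole E \<longleftrightarrow> ab_module E \<and> a_image E (carrier E) \<subseteq> b_image E (carrier E)"

text \<open>Every (a,b)-module is isomorphic to one whose elements are tuples over \<open>\<complex>[[b]]\<close>, that is,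
  elements of the type below. So existential quantifiers over modules may range over modules on
  this type without loss of generality.\<close>

type_synonym std_module = "(ab_series, nat \<Rightarrow> complex fps) module"

definition embeds_via ::
  "(ab_series, 'e) module \<Rightarrow> (ab_series, 'f) module \<Rightarrow> ('e \<Rightarrow> 'f) \<Rightarrow> bool"
  where "embeds_via E G f \<longleftrightarrow> f \<in> module_hom ab_algebra E G \<and> inj_on f (carrier E)"

definition regular :: "(ab_series, 'e) module \<Rightarrow> bool"
  where "regular E \<longleftrightarrow> ab_module E \<and> (\<exists>(G :: std_module) f. simple_pole G \<and> embeds_via E G f)"


section \<open>Bernstein polynomials\<close>

text \<open>\<open>p(T) x\<close>, for a \<open>\<complex>\<close>-linear endomorphism \<open>T\<close>.\<close>

definition poly_act ::
  "(ab_series, 'e) module \<Rightarrow> ('e \<Rightarrow> 'e) \<Rightarrow> complex poly \<Rightarrow> 'e \<Rightarrow> 'e"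
  where "poly_act V T p x =
    (\<Oplus>\<^bsub>V\<^esub>i\<in>{..degree p}. ab_const (coeff p i) \<odot>\<^bsub>V\<^esub> (T ^^ i) x)"

definition annihilates :: "(ab_series, 'e) module \<Rightarrow> ('e \<Rightarrow> 'e) \<Rightarrow> complex poly \<Rightarrow> bool"
  where "annihilates V T p \<longleftrightarrow> (\<forall>x\<in>carrier V. poly_act V T p x = \<zero>\<^bsub>V\<^esub>)"

definition is_min_poly :: "(ab_series, 'e) module \<Rightarrow> ('e \<Rightarrow> 'e) \<Rightarrow> complex poly \<Rightarrow> bool"
  where "is_min_poly V T p \<longleftrightarrow>
    lead_coeff p = 1 \<and> annihilates V T p \<and> (\<forall>q. annihilates V T q \<longrightarrow> p dvd q)"

text \<open>The operator \<open>- b\<^sup>-\<^sup>1 a\<close>; multiplication by \<open>b\<close> is injective on an (a,b)-module.\<close>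

definition neg_binv_a :: "(ab_series, 'e) module \<Rightarrow> 'e \<Rightarrow> 'e"
  where "neg_binv_a E x =
    \<ominus>\<^bsub>E\<^esub> (THE y. y \<in> carrier E \<and> ab_b \<odot>\<^bsub>E\<^esub> y = ab_a \<odot>\<^bsub>E\<^esub> x)"

definition is_simple_pole_bernstein_poly :: "(ab_series, 'e) module \<Rightarrow> complex poly \<Rightarrow> bool"
  where "is_simple_pole_bernstein_poly E p \<longleftrightarrow>
    is_min_poly (quot_module E (b_image E (carrier E)))
      (induced_map E (b_image E (carrier E)) (neg_binv_a E)) p"

text \<open>The saturation by \<open>b\<^sup>-\<^sup>1 a\<close> of a submodule \<open>H\<close> of a simple pole (a,b)-module \<open>G\<close>:
  the smallest submodule containing \<open>H\<close> and stable by \<open>b\<^sup>-\<^sup>1 a\<close>.\<close>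

definition saturation :: "(ab_series, 'e) module \<Rightarrow> 'e set \<Rightarrow> 'e set"
  where "saturation G H =
    \<Inter>{S. submodule S ab_algebra G \<and> H \<subseteq> S \<and> a_image G S \<subseteq> b_image G S}"

text \<open>\<open>p\<close> is the Bernstein polynomial of the regular (a,b)-module \<open>E\<close>. Up to isomorphism the
  saturation of \<open>E\<close> does not depend on the embedding of \<open>E\<close> in a simple pole (a,b)-module.\<close>

definition is_bernstein_poly :: "(ab_series, 'e) module \<Rightarrow> complex poly \<Rightarrow> bool"
  where "is_bernstein_poly E p \<longleftrightarrow>
    (\<exists>(G :: std_module) f. simple_pole G \<and> embeds_via E G f \<and>
       is_simple_pole_bernstein_poly (G\<lparr>carrier := saturation G (f ` carrier E)\<rparr>) p)"

definition geometric :: "(ab_series, 'e) module \<Rightarrow> bool"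
  where "geometric E \<longleftrightarrow> regular E \<and>
    (\<exists>p. is_bernstein_poly E p \<and> (\<forall>z. poly p z = 0 \<longrightarrow> (\<exists>q::rat. z = of_rat q \<and> q < 0)))"

definition fresco :: "(ab_series, 'e) module \<Rightarrow> bool"
  where "fresco E \<longleftrightarrow> geometric E \<and>
    (\<exists>e\<in>carrier E. carrier E = range (\<lambda>r. r \<odot>\<^bsub>E\<^esub> e))"

definition primitive :: "real \<Rightarrow> (ab_series, 'e) module \<Rightarrow> bool"
  where "primitive l E \<longleftrightarrow> regular E \<and>
    (\<exists>p. is_bernstein_poly E p \<and> (\<forall>z. poly p z = 0 \<longrightarrow> (\<exists>n::int. z = - of_real l + of_int n)))"


section \<open>Jordan-Hoelder sequences and semi-simplicity\<close>

definition normal_submodule :: "(ab_series, 'e) module \<Rightarrow> 'e set \<Rightarrow> bool"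
  where "normal_submodule E F \<longleftrightarrow>
    submodule F ab_algebra E \<and> F \<inter> b_image E (carrier E) = b_image E F"

text \<open>\<open>E\<^sub>\<mu>\<close>, the quotient of the algebra by the left ideal generated by \<open>a - \<mu> b\<close>.\<close>

definition E_mod :: "complex \<Rightarrow> (ab_series, ab_series set) module"
  where "E_mod \<mu> = quot_module (regular_left_module ab_algebra)
    (range (\<lambda>r. ab_mult r (ab_a - ab_mult (ab_const \<mu>) ab_b)))"

definition subquotient ::
  "(ab_series, 'e) module \<Rightarrow> 'e set \<Rightarrow> 'e set \<Rightarrow> (ab_series, 'e set) module"
  where "subquotient E F F' = quot_module (E\<lparr>carrier := F\<rparr>) F'"

definition jordan_hoelder :: "(ab_series, 'e) module \<Rightarrow> nat \<Rightarrow> (nat \<Rightarrow> 'e set) \<Rightarrow> bool"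
  where "jordan_hoelder E k F \<longleftrightarrow>
    F 0 = {\<zero>\<^bsub>E\<^esub>} \<and> F k = carrier E \<and> (\<forall>j\<le>k. normal_submodule E (F j)) \<and>
    (\<forall>j\<in>{1..k}. F (j - 1) \<subseteq> F j \<and> ab_module_of_rank 1 (subquotient E (F j) (F (j - 1))))"

definition semi_simple :: "(ab_series, 'e) module \<Rightarrow> bool"
  where "semi_simple E \<longleftrightarrow> regular E \<and>
    (\<exists>n (M :: nat \<Rightarrow> std_module) H.
       (\<forall>i<n. regular (M i) \<and> ab_module_of_rank 1 (M i)) \<and>
       submodule H ab_algebra (direct_sum_module n M) \<and>
       module_isomorphic ab_algebra E ((direct_sum_module n M)\<lparr>carrier := H\<rparr>))"

end

theory Submission
  imports Defs
begin

text \<open>A fresco with generator \<open>x\<close> is determined by the left ideal of annihilators of \<open>x\<close>. A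
  Jordan-Hoelder sequence with quotients \<open>E\<^bsub>\<mu>_1\<^esub>, \<dots>, E\<^bsub>\<mu>_k\<^esub>\<close> amounts to a factorization of this ideal as
  the one generated by \<open>(a - \<mu>\<^sub>1 b) S\<^sub>1 \<cdots> (a - \<mu>\<^sub>k b) S\<^sub>k\<close> with units \<open>S\<^sub>j \<in> \<complex>[[b]]\<close>, and semi-simplicity
  means that the ideal annihilates a vector \<open>(f\<^sub>i)\<close> of \<open>\<Oplus>\<^sub>i E\<^bsub>\<nu>_i\<^esub>\<close>, where \<open>E\<^sub>\<nu>\<close> is realized on \<open>\<complex>[[X]]\<close>.

  Starting from such a vector, split off a component for which \<open>\<nu>\<^sub>i + ord f\<^sub>i\<close> is minimal, equal to
  \<open>\<mu>\<close> say. The corresponding factor \<open>(a - \<mu> b) S\<close> kills this component and sends every other one to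
  a component with \<open>\<nu>\<^sub>i + ord > \<mu> + 1\<close>, since the coefficient at \<open>X\<^sup>n\<close> is multiplied by
  \<open>\<nu>\<^sub>i + n - \<mu>\<close> and moves to \<open>X\<^bsup>n+1\<^esup>\<close>. This gives the strict decrease of \<open>\<mu>\<^sub>j + j\<close>. Conversely, if
  \<open>\<mu>\<^sub>j + j\<close> is strictly decreasing, then each factor \<open>a - \<mu>\<^sub>j b\<close> can be inverted on the vector found
  for the previous ones, because \<open>\<nu>\<^sub>i + n - \<mu>\<^sub>j\<close> does not vanish. The exponents \<open>\<nu>\<^sub>i\<close> are real because
  \<open>-\<nu>\<^sub>i\<close> differs from a root of the Bernstein polynomial by an integer.\<close>

section \<open>Division by \<open>a - \<mu> b\<close>\<close>

text \<open>The top quotient is the one that can be read off first. If \<open>T\<close> is a unit,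
  the multiples of \<open>X^d T\<close> in \<open>E\<^sub>\<nu>\<close> form
  \<open>X^d E\<^sub>\<nu>\<close>, which is a copy of the module with exponent
  \<open>\<nu> + d\<close>. Hence the minimal value of \<open>\<nu>\<^sub>i + ord f\<^sub>i\<close>
  can serve as \<open>\<mu>\<^sub>k\<close>, and the rightmost factor of the product is split off
  before the others. The units \<open>S\<^sub>j\<close> record that the generator inherited at a
  step need not be the standard generator 1. A minimum makes sense for real exponents only, whereas
  semi-simplicity supplies complex ones. What constrains them, the Bernstein polynomial, lives on
  the saturation of \<open>E\<close> inside a simple pole module and not on \<open>E\<close>. So
  each nonzero component, a map from \<open>E\<close> to \<open>E\<^sub>\<nu>\<close>, has to be
  extended to this saturation first. A zero component says nothing about its exponent and is
  discarded. The number of factors obtained is not known in advance. It is identified with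
  \<open>k\<close> by counting ranks over \<open>\<complex>[[b]]\<close>.\<close>

lemma ab_mult_0_left [simp]: "ab_mult 0 X = 0"
  using ab_mult_distrib_right[of 0 0 X] by simp

lemma ab_mult_0_right [simp]: "ab_mult X 0 = 0"
  using ab_mult_distrib_left[of X 0 0] by simp

lemma ab_mult_diff_right: "ab_mult (X - Y) Z = ab_mult X Z - ab_mult Y Z"
  using ab_mult_distrib_right[of "X - Y" Y Z] by simp

lemma ab_mult_diff_left: "ab_mult X (Y - Z) = ab_mult X Y - ab_mult X Z"
  using ab_mult_distrib_left[of X "Y - Z" Z] by simp

section \<open>Products with power series in \<open>b\<close> and with \<open>a\<close>\<close>

lemma higher_pderiv_const: "(pderiv ^^ j) [:c:] = (if j = 0 then [:c:] else 0)"
  by (induction j) (auto simp: pderiv_pCons)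

lemma fps_nth_ab_of_fps [simp]: "fps_nth (ab_of_fps f) n = [:fps_nth f n:]"
  by (simp add: ab_of_fps_def)

lemma bpow_coeff_of_fps:
  "bpow_coeff m (fps_nth (ab_of_fps f)) N = (if m \<le> N then [:fps_nth f (N - m):] else 0)"
proof (cases "m \<le> N")
  case True
  have "bpow_coeff m (fps_nth (ab_of_fps f)) N =
      (\<Sum>j\<le>N - m. if j = 0 then [:fps_nth f (N - m):] else 0)"
    unfolding bpow_coeff_def if_P[OF True]
    by (rule sum.cong) (auto simp: higher_pderiv_const)
  then show ?thesis using True by simp
qed (simp add: bpow_coeff_def)

text \<open>Corrections to the commutative product arise only when a power of \<open>b\<close> is
  moved past a polynomial in \<open>a\<close>. A right factor with constant coefficients has
  vanishing derivatives, so none occur.\<close>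

lemma ab_mult_of_fps_right: "ab_mult X (ab_of_fps f) = X * ab_of_fps f"
proof (rule fps_ext)
  fix N
  have "fps_nth (ab_mult X (ab_of_fps f)) N = (\<Sum>m\<le>N. fps_nth X m * [:fps_nth f (N - m):])"
    unfolding fps_nth_ab_mult[OF order.refl]
    by (rule sum.cong) (simp_all add: bpow_coeff_of_fps)
  then show "fps_nth (ab_mult X (ab_of_fps f)) N = fps_nth (X * ab_of_fps f) N"
    by (simp add: fps_mult_nth atMost_atLeast0)
qed

lemma pCons_sum: "[:\<Sum>i\<in>A. f i:] = (\<Sum>i\<in>A. [:f i:])"
proof (induction A rule: infinite_finite_induct)
  case (insert x F)
  have "[:f x + sum f F:] = [:f x:] + [:sum f F:]" by simp
  then show ?case using insert by simp
qed simp_all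

lemma ab_of_fps_mult: "ab_of_fps (f * g) = ab_mult (ab_of_fps f) (ab_of_fps g)"
  unfolding ab_mult_of_fps_right
  by (rule fps_ext) (simp add: fps_mult_nth pCons_sum mult.commute)

lemma ab_of_fps_add: "ab_of_fps (f + g) = ab_of_fps f + ab_of_fps g"
  by (rule fps_ext) (simp add: ab_of_fps_def)

lemma ab_of_fps_diff: "ab_of_fps (f - g) = ab_of_fps f - ab_of_fps g"
  by (rule fps_ext) (simp add: ab_of_fps_def)

lemma ab_of_fps_0 [simp]: "ab_of_fps 0 = 0"
  by (rule fps_ext) (simp add: ab_of_fps_def)

lemma ab_of_fps_1 [simp]: "ab_of_fps 1 = 1"
  by (rule fps_ext) (simp add: ab_of_fps_def one_pCons)

lemma ab_b_eq: "ab_b = ab_of_fps fps_X"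
  by (rule fps_ext) (simp add: ab_of_fps_def ab_b_def fps_X_nth one_pCons)

lemma ab_const_eq: "ab_const c = ab_of_fps (fps_const c)"
  by (rule fps_ext) (simp add: ab_of_fps_def ab_const_def)

lemma ab_mult_a_left: "ab_mult ab_a X = ab_a * X"
proof (rule fps_ext)
  fix N
  have "fps_nth (ab_mult ab_a X) N =
      (\<Sum>m\<le>N. if m = 0 then [:0, 1:] * fps_nth X N else 0)"
    by (subst fps_nth_ab_mult[OF order.refl], rule sum.cong) (auto simp: ab_a_def bpow_coeff_0)
  then show "fps_nth (ab_mult ab_a X) N = fps_nth (ab_a * X) N"
    by (simp add: ab_a_def)
qed

text \<open>In the algebra this reads \<open>b^m a = a b^m - m b^(m+1)\<close>: the second
  derivative of the polynomial \<open>a\<close> is zero, so the expansion stops after two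
  terms.\<close>

lemma bpow_coeff_a:
  "bpow_coeff m (fps_nth ab_a) N =
     (if N = m then [:0, 1:] else if N = Suc m then - of_nat m else 0)"
proof (cases "m \<le> N")
  case True
  have hp: "(pderiv ^^ j) [:0, 1 :: complex:] =
      (if j = 0 then [:0, 1:] else if j = 1 then 1 else 0)" for j
    by (cases j; cases "j - 1") (auto simp: pderiv_pCons funpow_swap1 higher_pderiv_0)
  have nz: "(pderiv ^^ j) (0 :: complex poly) = 0" for j
    by (simp add: higher_pderiv_0)
  have "bpow_coeff m (fps_nth ab_a) N = (\<Sum>j\<le>N - m. if j = N - m then
      Polynomial.smult ((- of_nat m) gchoose (N - m)) ((pderiv ^^ (N - m)) [:0, 1:]) else 0)"
    unfolding bpow_coeff_def if_P[OF True]
    by (rule sum.cong) (auto simp: ab_a_def nz)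
  then have "bpow_coeff m (fps_nth ab_a) N =
      Polynomial.smult ((- of_nat m) gchoose (N - m)) ((pderiv ^^ (N - m)) [:0, 1:])"
    by simp
  then show ?thesis using True by (auto simp: hp of_nat_poly)
qed (simp add: bpow_coeff_def)

lemma fps_nth_ab_mult_a_right_0: "fps_nth (ab_mult X ab_a) 0 = pCons 0 (fps_nth X 0)"
  by (simp add: fps_nth_ab_mult[OF order.refl] bpow_coeff_a)

lemma fps_nth_ab_mult_a_right_Suc:
  "fps_nth (ab_mult X ab_a) (Suc N) =
     pCons 0 (fps_nth X (Suc N)) - Polynomial.smult (of_nat N) (fps_nth X N)"
proof -
  have "(\<Sum>m\<le>N. fps_nth X m * bpow_coeff m (fps_nth ab_a) (Suc N)) =
      (\<Sum>m\<le>N. if m = N then - Polynomial.smult (of_nat N) (fps_nth X N) else 0)"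
    by (rule sum.cong) (auto simp: bpow_coeff_a of_nat_poly)
  then show ?thesis
    by (simp add: fps_nth_ab_mult[OF order.refl] bpow_coeff_a)
qed

section \<open>Division on the right by \<open>a - \<mu> b\<close> with remainder in
  \<open>\<complex>[[b]]\<close>\<close>

definition ab_lin :: "complex \<Rightarrow> ab_series"
  where "ab_lin \<mu> = ab_a - ab_mult (ab_const \<mu>) ab_b"

lemma ab_const_mult_b: "ab_mult (ab_const \<mu>) ab_b = ab_of_fps (fps_const \<mu> * fps_X)"
  by (simp add: ab_const_eq ab_b_eq ab_of_fps_mult)

lemma fps_nth_ab_mult_b_right_Suc: "fps_nth (ab_mult X (ab_of_fps (fps_const \<mu> * fps_X))) (Suc N) =
    Polynomial.smult \<mu> (fps_nth X N)"
proof -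
  have "ab_of_fps (fps_const \<mu> * fps_X) = fps_const [:\<mu>:] * fps_X"
    by (rule fps_ext) (auto simp: ab_of_fps_def fps_X_nth)
  then have "ab_mult X (ab_of_fps (fps_const \<mu> * fps_X)) = fps_const [:\<mu>:] * (fps_X * X)"
    by (metis ab_mult_of_fps_right mult.assoc mult.commute)
  then show ?thesis by simp
qed

lemma fps_nth_ab_mult_lin_0: "fps_nth (ab_mult X (ab_lin \<mu>)) 0 = pCons 0 (fps_nth X 0)"
  by (simp add: ab_lin_def ab_mult_diff_left fps_nth_ab_mult_a_right_0 ab_const_mult_b
       ab_mult_of_fps_right)

lemma fps_nth_ab_mult_lin_Suc:
  "fps_nth (ab_mult X (ab_lin \<mu>)) (Suc N) =
     pCons 0 (fps_nth X (Suc N)) - Polynomial.smult (of_nat N + \<mu>) (fps_nth X N)"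
  by (simp add: ab_lin_def ab_mult_diff_left fps_nth_ab_mult_a_right_Suc ab_const_mult_b
       fps_nth_ab_mult_b_right_Suc smult_add_left)

text \<open>Comparing coefficients at \<open>b^(N+1)\<close> in
  \<open>r = q (a - \<mu> b) + f(b)\<close> gives
  \<open>x q_(N+1) - (N + \<mu>) q_N + f_(N+1) = r_(N+1)\<close>. So \<open>q_(N+1)\<close> and the
  constant \<open>f_(N+1)\<close> are quotient and remainder of a known polynomial on division by
  its variable \<open>x\<close>; \<open>poly_shift 1\<close> is this quotient.\<close>

primrec lin_quotient :: "complex \<Rightarrow> ab_series \<Rightarrow> nat \<Rightarrow> complex poly"
  where "lin_quotient \<mu> r 0 = poly_shift 1 (fps_nth r 0)"
  | "lin_quotient \<mu> r (Suc N) = poly_shift 1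
       (fps_nth r (Suc N) + Polynomial.smult (of_nat N + \<mu>) (lin_quotient \<mu> r N))"

lemma pCons_poly_shift: "pCons (coeff p 0) (poly_shift 1 p) = p"
  by (rule poly_eqI) (auto simp: coeff_pCons coeff_poly_shift split: nat.splits)

lemma lin_division: "\<exists>q f. r = ab_mult q (ab_lin \<mu>) + ab_of_fps f"
proof -
  define q where "q = Abs_fps (lin_quotient \<mu> r)"
  define f where "f = Abs_fps (\<lambda>N. case N of 0 \<Rightarrow> coeff (fps_nth r 0) 0 | Suc N \<Rightarrow>
    coeff (fps_nth r (Suc N) + Polynomial.smult (of_nat N + \<mu>) (lin_quotient \<mu> r N)) 0)"
  have "fps_nth r N = fps_nth (ab_mult q (ab_lin \<mu>) + ab_of_fps f) N" for N
  proof (cases N)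
    case 0
    then show ?thesis
      using pCons_poly_shift[of "fps_nth r 0"]
      by (simp add: fps_nth_ab_mult_lin_0 q_def f_def ab_of_fps_def)
  next
    case (Suc M)
    define w where
      "w = fps_nth r (Suc M) + Polynomial.smult (of_nat M + \<mu>) (lin_quotient \<mu> r M)"
    have "fps_nth (ab_mult q (ab_lin \<mu>) + ab_of_fps f) (Suc M) =
        pCons (coeff w 0) (poly_shift 1 w) -
        Polynomial.smult (of_nat M + \<mu>) (lin_quotient \<mu> r M)"
      by (simp add: fps_nth_ab_mult_lin_Suc q_def f_def ab_of_fps_def w_def)
    also have "\<dots> = fps_nth r (Suc M)"
      unfolding pCons_poly_shift by (simp add: w_def)
    finally show ?thesis using Suc by simp
  qed
  then show ?thesis using fps_ext by blast
qed

text \<open>Once the preceding coefficient of \<open>q\<close> is known to vanish, the next one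
  times the polynomial variable equals a constant, so both sides are 0. Together with
  \<open>lin_division\<close> this makes the algebra the direct sum of the left ideal of
  \<open>a - \<mu> b\<close> and of \<open>\<complex>[[b]]\<close>.\<close>

lemma lin_division_unique:
  assumes "ab_mult q (ab_lin \<mu>) = ab_of_fps f"
  shows "q = 0" and "f = 0"
proof -
  have "fps_nth q N = 0 \<and> fps_nth f N = 0" for N
  proof (induction N)
    case 0
    then show ?case
      using arg_cong[OF assms, of "\<lambda>X. fps_nth X 0"]
      by (simp add: fps_nth_ab_mult_lin_0 ab_of_fps_def)
  next
    case (Suc N)
    then show ?case
      using arg_cong[OF assms, of "\<lambda>X. fps_nth X (Suc N)"]
      by (simp add: fps_nth_ab_mult_lin_Suc ab_of_fps_def)
  qed
  then show "q = 0" and "f = 0" by (auto intro: fps_ext)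
qed

lemma ab_mult_lin_cancel:
  assumes "ab_mult q (ab_lin \<mu>) = ab_mult q' (ab_lin \<mu>)"
  shows "q = q'"
  using lin_division_unique(1)[of "q - q'" \<mu> 0] assms by (simp add: ab_mult_diff_right)

definition lin_rem :: "complex \<Rightarrow> ab_series \<Rightarrow> complex fps"
  where "lin_rem \<mu> r = (THE f. \<exists>q. r = ab_mult q (ab_lin \<mu>) + ab_of_fps f)"

lemma lin_rem_unique:
  assumes "r = ab_mult q (ab_lin \<mu>) + ab_of_fps f"
  shows "lin_rem \<mu> r = f"
  unfolding lin_rem_def
proof (rule the_equality)
  show "\<exists>q. r = ab_mult q (ab_lin \<mu>) + ab_of_fps f" using assms by blast
  fix g assume "\<exists>q. r = ab_mult q (ab_lin \<mu>) + ab_of_fps g"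
  then obtain q' where "r = ab_mult q' (ab_lin \<mu>) + ab_of_fps g" by blast
  with assms have "ab_mult (q' - q) (ab_lin \<mu>) = ab_of_fps (f - g)"
    by (simp add: ab_mult_diff_right ab_of_fps_diff algebra_simps)
  then show "g = f" using lin_division_unique(2) by fastforce
qed

lemma lin_rem_decomp: obtains q where "r = ab_mult q (ab_lin \<mu>) + ab_of_fps (lin_rem \<mu> r)"
  using lin_division[of r \<mu>] lin_rem_unique by metis

lemma lin_rem_eq_0_iff: "lin_rem \<mu> r = 0 \<longleftrightarrow> (\<exists>q. r = ab_mult q (ab_lin \<mu>))"
proof
  assume "lin_rem \<mu> r = 0"
  then show "\<exists>q. r = ab_mult q (ab_lin \<mu>)"
    by (metis lin_rem_decomp ab_of_fps_0 add.right_neutral)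
next
  assume "\<exists>q. r = ab_mult q (ab_lin \<mu>)"
  then show "lin_rem \<mu> r = 0" by (auto intro: lin_rem_unique)
qed

section \<open>The module \<open>E\<^sub>\<mu>\<close> on the space of power series\<close>

text \<open>The class of \<open>f(b)\<close> in \<open>E\<^sub>\<mu>\<close> is identified with \<open>f\<close>; then \<open>b\<close> acts by multiplication by
  the variable \<open>X\<close> and \<open>a\<close> acts by \<open>X\<^sup>2 d/dX + \<mu> X\<close>.\<close>

definition ab_act :: "complex \<Rightarrow> ab_series \<Rightarrow> complex fps \<Rightarrow> complex fps"
  where "ab_act \<mu> r f = lin_rem \<mu> (ab_mult r (ab_of_fps f))"

lemma ab_act_decomp:
  obtains q where "ab_mult r (ab_of_fps f) = ab_mult q (ab_lin \<mu>) + ab_of_fps (ab_act \<mu> r f)"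
  unfolding ab_act_def by (rule lin_rem_decomp)

lemma ab_act_unique:
  "ab_mult r (ab_of_fps f) = ab_mult q (ab_lin \<mu>) + ab_of_fps g \<Longrightarrow> ab_act \<mu> r f = g"
  unfolding ab_act_def by (rule lin_rem_unique)

lemma ab_act_add_right: "ab_act \<mu> r (f + g) = ab_act \<mu> r f + ab_act \<mu> r g"
proof -
  obtain q where q: "ab_mult r (ab_of_fps f) = ab_mult q (ab_lin \<mu>) + ab_of_fps (ab_act \<mu> r f)"
    by (rule ab_act_decomp)
  obtain q' where q': "ab_mult r (ab_of_fps g) = ab_mult q' (ab_lin \<mu>) + ab_of_fps (ab_act \<mu> r g)"
    by (rule ab_act_decomp)
  show ?thesis
    by (rule ab_act_unique[of _ _ "q + q'"])
       (simp add: ab_of_fps_add ab_mult_distrib_left ab_mult_distrib_right q q')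
qed

lemma ab_act_add_left: "ab_act \<mu> (r + s) f = ab_act \<mu> r f + ab_act \<mu> s f"
proof -
  obtain q where q: "ab_mult r (ab_of_fps f) = ab_mult q (ab_lin \<mu>) + ab_of_fps (ab_act \<mu> r f)"
    by (rule ab_act_decomp)
  obtain q' where q': "ab_mult s (ab_of_fps f) = ab_mult q' (ab_lin \<mu>) + ab_of_fps (ab_act \<mu> s f)"
    by (rule ab_act_decomp)
  show ?thesis
    by (rule ab_act_unique[of _ _ "q + q'"])
       (simp add: ab_of_fps_add ab_mult_distrib_left ab_mult_distrib_right q q')
qed

lemma ab_act_0_right [simp]: "ab_act \<mu> r 0 = 0"
  using ab_act_add_right[of \<mu> r 0 0] by simp

lemma ab_act_0_left [simp]: "ab_act \<mu> 0 f = 0"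
  using ab_act_add_left[of \<mu> 0 0 f] by simp

lemma ab_act_diff_left: "ab_act \<mu> (r - s) f = ab_act \<mu> r f - ab_act \<mu> s f"
  using ab_act_add_left[of \<mu> "r - s" s f] by simp

lemma ab_act_mult: "ab_act \<mu> (ab_mult r s) f = ab_act \<mu> r (ab_act \<mu> s f)"
proof -
  define g where "g = ab_act \<mu> s f"
  obtain q where q: "ab_mult s (ab_of_fps f) = ab_mult q (ab_lin \<mu>) + ab_of_fps g"
    unfolding g_def by (rule ab_act_decomp)
  obtain q' where q': "ab_mult r (ab_of_fps g) = ab_mult q' (ab_lin \<mu>) + ab_of_fps (ab_act \<mu> r g)"
    by (rule ab_act_decomp)
  show ?thesis unfolding g_def[symmetric]
    by (rule ab_act_unique[of _ _ "ab_mult r q + q'"])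
       (simp add: ab_mult_assoc q ab_mult_distrib_left ab_mult_distrib_right q')
qed

lemma ab_act_of_fps [simp]: "ab_act \<mu> (ab_of_fps g) f = g * f"
  by (rule ab_act_unique[of _ _ 0]) (simp add: ab_of_fps_mult)

lemma ab_act_1 [simp]: "ab_act \<mu> 1 f = f"
  using ab_act_of_fps[of \<mu> 1 f] by simp

lemma ab_act_b [simp]: "ab_act \<mu> ab_b f = fps_X * f"
  by (simp add: ab_b_eq)

lemma fps_nth_X2_deriv: "fps_nth (fps_X\<^sup>2 * fps_deriv f) (Suc N) = of_nat N * fps_nth f N"
  for f :: "complex fps"
  by (cases N) (simp_all add: power2_eq_square mult.assoc)

text \<open>The commutator with \<open>a\<close> is a derivation that sends \<open>b\<close> to
  \<open>b^2\<close>, hence \<open>f(b)\<close> to \<open>b^2 f'(b)\<close>.\<close>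

lemma ab_a_of_fps:
  "ab_mult ab_a (ab_of_fps f) = ab_mult (ab_of_fps f) ab_a + ab_of_fps (fps_X\<^sup>2 * fps_deriv f)"
proof (rule fps_ext)
  fix N
  show "fps_nth (ab_mult ab_a (ab_of_fps f)) N =
    fps_nth (ab_mult (ab_of_fps f) ab_a + ab_of_fps (fps_X\<^sup>2 * fps_deriv f)) N"
  proof (cases N)
    case 0
    then show ?thesis
      by (simp add: ab_mult_a_left fps_nth_ab_mult_a_right_0) (simp add: ab_a_def)
  next
    case (Suc M)
    then show ?thesis
      by (simp add: ab_mult_a_left fps_nth_ab_mult_a_right_Suc fps_nth_X2_deriv)
         (simp add: ab_a_def)
  qed
qed

lemma ab_act_a [simp]:
  "ab_act \<mu> ab_a f = fps_X\<^sup>2 * fps_deriv f + fps_const \<mu> * fps_X * f"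
proof (rule ab_act_unique[of _ _ "ab_of_fps f"])
  have "ab_mult (ab_of_fps f) (ab_lin \<mu>) =
      ab_mult (ab_of_fps f) ab_a - ab_of_fps (fps_const \<mu> * fps_X * f)"
    unfolding ab_lin_def ab_mult_diff_left ab_const_mult_b ab_of_fps_mult[symmetric]
    by (simp only: mult.commute)
  then show "ab_mult ab_a (ab_of_fps f) = ab_mult (ab_of_fps f) (ab_lin \<mu>) +
      ab_of_fps (fps_X\<^sup>2 * fps_deriv f + fps_const \<mu> * fps_X * f)"
    by (simp add: ab_a_of_fps ab_of_fps_add)
qed

lemma ab_act_lin: "ab_act \<nu> (ab_lin \<mu>) f = fps_X\<^sup>2 * fps_deriv f + fps_const (\<nu> - \<mu>) * fps_X * f"
proof -
  have "fps_const (\<nu> - \<mu>) * fps_X * f = fps_const \<nu> * fps_X * f - fps_const \<mu> * fps_X * f"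
    unfolding fps_const_sub[symmetric] by (simp only: left_diff_distrib)
  then show ?thesis by (simp add: ab_lin_def ab_act_diff_left ab_const_mult_b)
qed

lemma ab_act_1_eq_0_iff: "ab_act \<mu> r 1 = 0 \<longleftrightarrow> (\<exists>q. r = ab_mult q (ab_lin \<mu>))"
  by (simp add: ab_act_def ab_mult_1_right lin_rem_eq_0_iff)

section \<open>Shifting the exponent by powers of \<open>b\<close>\<close>

lemma ab_lin_b: "ab_mult (ab_lin (\<mu> + 1)) ab_b = ab_mult ab_b (ab_lin \<mu>)"
proof -
  have "fps_const (\<mu> + 1) * fps_X * fps_X = fps_X * (fps_const \<mu> * fps_X) + fps_X * fps_X"
    unfolding fps_const_add[symmetric] fps_const_1_eq_1 by (simp only: algebra_simps mult_1_right)
  then have "ab_mult (ab_of_fps (fps_const (\<mu> + 1) * fps_X)) ab_b =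
      ab_mult ab_b (ab_of_fps (fps_const \<mu> * fps_X)) + ab_mult ab_b ab_b"
    unfolding ab_b_eq ab_of_fps_mult[symmetric] ab_of_fps_add[symmetric] by (simp only:)
  then show ?thesis
    using ab_commutation
    unfolding ab_lin_def ab_mult_diff_left ab_mult_diff_right ab_const_mult_b
    by (simp only: algebra_simps)
qed

lemma ab_of_fps_commute: "ab_mult (ab_of_fps f) (ab_of_fps g) = ab_mult (ab_of_fps g) (ab_of_fps f)"
  by (metis ab_of_fps_mult mult.commute)

text \<open>The relation \<open>(a - (\<mu> + 1) b) b = b (a - \<mu> b)\<close> turns multiplication
  by \<open>X\<close> into an embedding of the module with exponent \<open>\<mu> + 1\<close> onto
  \<open>X\<close> times the one with exponent \<open>\<mu>\<close>. This is why valuations and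
  exponents are always added.\<close>

lemma ab_act_X: "ab_act \<mu> r (fps_X * f) = fps_X * ab_act (\<mu> + 1) r f"
proof -
  define g where "g = ab_act (\<mu> + 1) r f"
  obtain q where q: "ab_mult r (ab_of_fps f) = ab_mult q (ab_lin (\<mu> + 1)) + ab_of_fps g"
    unfolding g_def by (rule ab_act_decomp)
  have "ab_mult r (ab_of_fps (fps_X * f)) = ab_mult (ab_mult r (ab_of_fps f)) ab_b"
    by (simp only: ab_mult_assoc ab_b_eq ab_of_fps_mult ab_of_fps_commute[of f])
  also have "\<dots> = ab_mult q (ab_mult (ab_lin (\<mu> + 1)) ab_b) + ab_mult (ab_of_fps g) ab_b"
    unfolding q by (simp only: ab_mult_distrib_right ab_mult_assoc)
  also have "\<dots> = ab_mult (ab_mult q ab_b) (ab_lin \<mu>) + ab_of_fps (fps_X * g)"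
    unfolding ab_lin_b by (simp only: ab_mult_assoc ab_of_fps_mult ab_of_fps_commute[of g fps_X] ab_b_eq)
  finally show ?thesis unfolding g_def[symmetric] by (rule ab_act_unique)
qed

lemma ab_act_X_power: "ab_act \<mu> r (fps_X ^ n * f) = fps_X ^ n * ab_act (\<mu> + of_nat n) r f"
proof (induction n arbitrary: \<mu>)
  case (Suc n)
  have "ab_act \<mu> r (fps_X ^ Suc n * f) = fps_X * ab_act (\<mu> + 1) r (fps_X ^ n * f)"
    by (simp only: power_Suc mult.assoc ab_act_X)
  also have "\<dots> = fps_X ^ Suc n * ab_act (\<mu> + 1 + of_nat n) r f"
    by (simp only: Suc power_Suc mult.assoc)
  finally show ?case by (simp only: of_nat_Suc add.assoc)
qed simp

text \<open>A series without coefficient of order 0 becomes a right multiple of \<open>b\<close> by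
  lowering all exponents. This serves to move a denominator \<open>b^N\<close> across an arbitrary
  scalar.\<close>

lemma b_mult_swap: "\<exists>r'. ab_mult ab_b r = ab_mult r' ab_b"
proof -
  define s where "s = ab_mult ab_b r"
  have "fps_nth s 0 = 0"
    by (simp add: s_def ab_b_def fps_nth_ab_mult[OF order.refl])
  then have "s = Abs_fps (\<lambda>n. fps_nth s (Suc n)) * ab_b"
    by (intro fps_ext) (simp add: ab_b_def)
  then have "s = ab_mult (Abs_fps (\<lambda>n. fps_nth s (Suc n))) ab_b"
    by (simp only: ab_b_eq ab_mult_of_fps_right)
  then show ?thesis unfolding s_def by blast
qed

lemma b_power_mult_swap: "\<exists>r'. ab_mult (ab_of_fps (fps_X ^ n)) r = ab_mult r' (ab_of_fps (fps_X ^ n))"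
proof (induction n arbitrary: r)
  case 0
  then show ?case by (simp add: ab_mult_1_left ab_mult_1_right)
next
  case (Suc n)
  obtain s where s: "ab_mult (ab_of_fps (fps_X ^ n)) r = ab_mult s (ab_of_fps (fps_X ^ n))"
    using Suc by blast
  obtain t where t: "ab_mult ab_b s = ab_mult t ab_b" using b_mult_swap by blast
  have "ab_mult (ab_of_fps (fps_X ^ Suc n)) r =
      ab_mult ab_b (ab_mult (ab_of_fps (fps_X ^ n)) r)"
    by (simp only: power_Suc ab_of_fps_mult ab_mult_assoc ab_b_eq)
  also have "\<dots> = ab_mult t (ab_of_fps (fps_X ^ Suc n))"
    unfolding s ab_mult_assoc[symmetric] t
    by (simp only: power_Suc ab_of_fps_mult ab_mult_assoc ab_b_eq)
  finally show ?case by blast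
qed

section \<open>Annihilators in sums of the modules \<open>E\<^sub>\<mu>\<close>\<close>

definition coord_ann :: "(nat \<Rightarrow> complex) \<Rightarrow> (nat \<Rightarrow> complex fps) \<Rightarrow> nat set \<Rightarrow> ab_series set"
  where "coord_ann \<nu> f I = {r. \<forall>i\<in>I. ab_act (\<nu> i) r (f i) = 0}"

definition left_ideal :: "ab_series \<Rightarrow> ab_series set"
  where "left_ideal p = range (\<lambda>r. ab_mult r p)"

text \<open>New factors go to the right, so the last index belongs to the top quotient and its
  factor is the first to act on the generator.\<close>

primrec jh_prod :: "(nat \<Rightarrow> complex) \<Rightarrow> (nat \<Rightarrow> complex fps) \<Rightarrow> nat \<Rightarrow> ab_series"
  where "jh_prod \<mu> S 0 = 1"
  | "jh_prod \<mu> S (Suc j) =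
       ab_mult (jh_prod \<mu> S j) (ab_mult (ab_lin (\<mu> (Suc j))) (ab_of_fps (S (Suc j))))"

lemma jh_prod_cong:
  "(\<And>j. j \<in> {1..m} \<Longrightarrow> \<mu> j = \<mu>' j) \<Longrightarrow> (\<And>j. j \<in> {1..m} \<Longrightarrow> S j = S' j) \<Longrightarrow>
    jh_prod \<mu> S m = jh_prod \<mu>' S' m"
  by (induction m) auto

lemma left_ideal_1 [simp]: "left_ideal 1 = UNIV"
  by (auto simp: left_ideal_def ab_mult_1_right)

lemma left_ideal_mult_iff: "r \<in> left_ideal (ab_mult p s) \<longleftrightarrow> (\<exists>q\<in>left_ideal p. r = ab_mult q s)"
  by (auto simp: left_ideal_def ab_mult_assoc)

lemma ab_act_lin_nth_0 [simp]: "fps_nth (ab_act \<nu> (ab_lin \<mu>) f) 0 = 0"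
  by (simp add: ab_act_lin power2_eq_square)

lemma ab_act_lin_nth_Suc:
  "fps_nth (ab_act \<nu> (ab_lin \<mu>) f) (Suc l) = (of_nat l + \<nu> - \<mu>) * fps_nth f l"
  unfolding ab_act_lin fps_add_nth fps_nth_X2_deriv
  by (simp add: mult.assoc algebra_simps)

section \<open>Annihilators of units, and factorization of the annihilator of a vector\<close>

lemma fps_unit_inverse:
  fixes T :: "complex fps"
  assumes "fps_nth T 0 \<noteq> 0"
  shows "T * inverse T = 1" "inverse T * T = 1"
  using assms by (simp_all add: inverse_mult_eq_1 inverse_mult_eq_1')

lemma ab_of_fps_inverse:
  assumes "fps_nth T 0 \<noteq> 0"
  shows "ab_mult (ab_of_fps T) (ab_of_fps (inverse T)) = 1"
    and "ab_mult (ab_of_fps (inverse T)) (ab_of_fps T) = 1"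
  using fps_unit_inverse[OF assms] by (simp_all flip: ab_of_fps_mult)

lemma ab_mult_unit_eq_iff:
  assumes "fps_nth T 0 \<noteq> 0"
  shows "ab_mult r (ab_of_fps T) = s \<longleftrightarrow> r = ab_mult s (ab_of_fps (inverse T))"
    and "ab_mult r (ab_of_fps (inverse T)) = s \<longleftrightarrow> r = ab_mult s (ab_of_fps T)"
  using ab_of_fps_inverse[OF assms] by (auto simp: ab_mult_assoc ab_mult_1_right)

text \<open>\<open>T\<close> is the image of 1 under the scalar \<open>ab_of_fps T\<close>, so
  \<open>r\<close> kills \<open>T\<close> exactly if \<open>r T\<close> lies in the left ideal of
  \<open>a - \<mu> b\<close> that annihilates 1. The invertible \<open>T\<close> is then moved to
  the other side.\<close>

lemma ab_act_unit_eq_0_iff: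
  assumes "fps_nth T 0 \<noteq> 0"
  shows "ab_act \<mu> r T = 0 \<longleftrightarrow> (\<exists>q. r = ab_mult q (ab_mult (ab_lin \<mu>) (ab_of_fps (inverse T))))"
proof -
  have "ab_act \<mu> r T = ab_act \<mu> (ab_mult r (ab_of_fps T)) 1"
    by (simp add: ab_act_mult)
  then have "ab_act \<mu> r T = 0 \<longleftrightarrow> (\<exists>q. ab_mult r (ab_of_fps T) = ab_mult q (ab_lin \<mu>))"
    by (simp add: ab_act_1_eq_0_iff)
  also have "\<dots> \<longleftrightarrow> (\<exists>q. r = ab_mult q (ab_mult (ab_lin \<mu>) (ab_of_fps (inverse T))))"
    by (simp add: ab_mult_unit_eq_iff[OF assms] ab_mult_assoc)
  finally show ?thesis .
qed

text \<open>The bound \<open>c\<close> carries the induction on the number of components. The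
  recursive call is made with \<open>c = \<mu>0 + 1\<close>, and what it returns,
  \<open>\<mu>0 + 1 < \<mu> m\<close>, is precisely the inequality needed to append
  \<open>\<mu>0\<close> as entry \<open>m + 1\<close> of a sequence with \<open>\<mu> j + j\<close>
  strictly decreasing. Components may become 0 on the way, so \<open>m\<close> can be smaller than
  \<open>card I\<close>.\<close>

lemma coord_ann_factorization:
  fixes \<nu> :: "nat \<Rightarrow> real"
  assumes "finite I" and "\<And>i n. i \<in> I \<Longrightarrow> fps_nth (f i) n \<noteq> 0 \<Longrightarrow> c < \<nu> i + real n"
  shows "\<exists>m \<mu> S. coord_ann (\<lambda>i. complex_of_real (\<nu> i)) f I =
      left_ideal (jh_prod (\<lambda>j. complex_of_real (\<mu> j)) S m) \<and>
    (\<forall>j. fps_nth (S j) 0 \<noteq> 0) \<and> strict_antimono_on {1..m} (\<lambda>j. \<mu> j + real j) \<and>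
    (0 < m \<longrightarrow> c < \<mu> m)"
  using assms
proof (induction "card I" arbitrary: I f c)
  case 0
  then have "coord_ann (\<lambda>i. complex_of_real (\<nu> i)) f I = left_ideal 1"
    by (simp add: coord_ann_def)
  then show ?case
    by (intro exI[of _ 0] exI[of _ "\<lambda>_. 0"] exI[of _ "\<lambda>_. 1"]) (auto intro: monotone_onI)
next
  case (Suc k)
  note bound = \<open>\<And>i n. i \<in> I \<Longrightarrow> fps_nth (f i) n \<noteq> 0 \<Longrightarrow> c < \<nu> i + real n\<close>
  show ?case
  proof (cases "\<exists>i\<in>I. f i \<noteq> 0")
    case False
    then have "coord_ann (\<lambda>i. complex_of_real (\<nu> i)) f I = left_ideal 1"
      by (simp add: coord_ann_def)
    then show ?thesis
      by (intro exI[of _ 0] exI[of _ "\<lambda>_. 0"] exI[of _ "\<lambda>_. 1"]) (auto intro: monotone_onI)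
  next
    case True
    \<comment> \<open>By convention \<open>subdegree 0 = 0\<close>, which would falsify the minimum;
      hence the restriction to nonzero components.\<close>
    define J where "J = {i \<in> I. f i \<noteq> 0}"
    define w where "w i = \<nu> i + real (subdegree (f i))" for i
    have J: "finite J" "J \<noteq> {}" using True Suc.prems(1) by (auto simp: J_def)
    define i0 where "i0 = arg_min_on w J"
    have i0: "i0 \<in> J" unfolding i0_def by (rule arg_min_if_finite(1)[OF J])
    have min: "w i0 \<le> w i" if "i \<in> J" for i
      using arg_min_least[OF J that, of w] by (simp add: i0_def)
    define d where "d = subdegree (f i0)"
    define T where "T = fps_shift d (f i0)"
    define \<mu>0 where "\<mu>0 = w i0"
    have T0: "fps_nth T 0 \<noteq> 0" using i0 by (simp add: T_def J_def d_def)
    have fi0: "f i0 = fps_X ^ d * T"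
      unfolding d_def T_def by (subst mult.commute) (rule subdegree_decompose)
    have c: "c < \<mu>0" using bound[of i0 d] i0 by (simp add: J_def d_def \<mu>0_def w_def)
    \<comment> \<open>By the shift rule \<open>f i0 = X^d T\<close> has the same annihilator as the
      unit \<open>T\<close> at the exponent \<open>\<nu> i0 + d = \<mu>0\<close>, and
      \<open>p\<close> generates it.\<close>
    define p where "p = ab_mult (ab_lin (complex_of_real \<mu>0)) (ab_of_fps (inverse T))"
    define f' where "f' i = ab_act (complex_of_real (\<nu> i)) p (f i)" for i
    define I' where "I' = I - {i0}"
    have cardI': "k = card I'" and finI': "finite I'"
      using Suc.hyps(2) Suc.prems(1) i0 by (auto simp: I'_def J_def)
    have bound': "\<mu>0 + 1 < \<nu> i + real n" if iI': "i \<in> I'" and nz: "fps_nth (f' i) n \<noteq> 0" for i n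
    proof -
      define g where "g = inverse T * f i"
      have f': "f' i = ab_act (complex_of_real (\<nu> i)) (ab_lin (complex_of_real \<mu>0)) g"
        by (simp add: f'_def p_def ab_act_mult g_def)
      obtain l where n: "n = Suc l" using nz unfolding f' by (cases n) simp_all
      have "(of_nat l + complex_of_real (\<nu> i) - complex_of_real \<mu>0) * fps_nth g l \<noteq> 0"
        using nz unfolding f' n ab_act_lin_nth_Suc .
      moreover have "of_nat l + complex_of_real (\<nu> i) - complex_of_real \<mu>0 =
          complex_of_real (\<nu> i + real l - \<mu>0)" by simp
      ultimately have "complex_of_real (\<nu> i + real l - \<mu>0) * fps_nth g l \<noteq> 0"
        by (rule back_subst[of "\<lambda>x. x * fps_nth g l \<noteq> 0"])
      then have "complex_of_real (\<nu> i + real l - \<mu>0) \<noteq> 0 \<and> fps_nth g l \<noteq> 0"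
        by (simp del: of_real_add of_real_diff)
      then have ne: "\<nu> i + real l - \<mu>0 \<noteq> 0" "fps_nth g l \<noteq> 0"
        unfolding of_real_eq_0_iff by simp_all
      have "f i \<noteq> 0" using ne(2) unfolding g_def by (metis fps_zero_nth mult_zero_right)
      then have iJ: "i \<in> J" using iI' by (simp add: J_def I'_def)
      have "subdegree (f i) \<le> l"
      proof (rule ccontr)
        assume "\<not> subdegree (f i) \<le> l"
        then have "fps_nth (f i) (l - x) = 0" for x
          by (intro nth_less_subdegree_zero) linarith
        then have "fps_nth g l = 0"
          unfolding g_def fps_mult_nth by (simp only: mult_zero_right sum.neutral_const)
        with ne(2) show False by contradiction
      qed
      then have "\<mu>0 \<le> \<nu> i + real l" using min[OF iJ] unfolding \<mu>0_def w_def[of i] by linarith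
      then show ?thesis using ne(1) unfolding n by linarith
    qed
    from Suc.hyps(1)[OF cardI' finI' bound'] obtain m \<mu> S where
      IH: "coord_ann (\<lambda>i. complex_of_real (\<nu> i)) f' I' =
        left_ideal (jh_prod (\<lambda>j. complex_of_real (\<mu> j)) S m)"
      "\<forall>j. fps_nth (S j) 0 \<noteq> 0" "strict_antimono_on {1..m} (\<lambda>j. \<mu> j + real j)"
      "0 < m \<longrightarrow> \<mu>0 + 1 < \<mu> m" by blast
    define \<mu>' where "\<mu>' = \<mu>(Suc m := \<mu>0)"
    define S' where "S' = S(Suc m := inverse T)"
    have P: "jh_prod (\<lambda>j. complex_of_real (\<mu>' j)) S' (Suc m) =
        ab_mult (jh_prod (\<lambda>j. complex_of_real (\<mu> j)) S m) p"
    proof -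
      have "jh_prod (\<lambda>j. complex_of_real (\<mu>' j)) S' m = jh_prod (\<lambda>j. complex_of_real (\<mu> j)) S m"
        by (rule jh_prod_cong) (auto simp: \<mu>'_def S'_def)
      then show ?thesis by (simp add: p_def) (simp add: \<mu>'_def S'_def)
    qed
    have "r \<in> coord_ann (\<lambda>i. complex_of_real (\<nu> i)) f I \<longleftrightarrow>
        (\<exists>q\<in>coord_ann (\<lambda>i. complex_of_real (\<nu> i)) f' I'. r = ab_mult q p)" for r
    proof -
      have "complex_of_real (\<nu> i0) + of_nat d = complex_of_real \<mu>0"
        by (simp add: \<mu>0_def w_def d_def)
      then have 1: "ab_act (complex_of_real (\<nu> i0)) r (f i0) = 0 \<longleftrightarrow> (\<exists>q. r = ab_mult q p)"
        unfolding fi0 ab_act_X_power p_def by (simp add: ab_act_unit_eq_0_iff[OF T0])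
      have "i0 \<in> I" using i0 by (simp add: J_def)
      then have "r \<in> coord_ann (\<lambda>i. complex_of_real (\<nu> i)) f I \<longleftrightarrow>
          (\<exists>q. r = ab_mult q p) \<and> (\<forall>i\<in>I'. ab_act (complex_of_real (\<nu> i)) r (f i) = 0)"
        using 1 by (auto simp: coord_ann_def I'_def)
      also have "\<dots> \<longleftrightarrow> (\<exists>q. r = ab_mult q p \<and>
          (\<forall>i\<in>I'. ab_act (complex_of_real (\<nu> i)) q (f' i) = 0))"
        unfolding f'_def ab_act_mult[symmetric] by blast
      finally show ?thesis by (auto simp: coord_ann_def)
    qed
    then have ann: "coord_ann (\<lambda>i. complex_of_real (\<nu> i)) f I =
        left_ideal (jh_prod (\<lambda>j. complex_of_real (\<mu>' j)) S' (Suc m))"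
      unfolding P IH(1) by (auto simp: left_ideal_mult_iff)
    have unit: "\<forall>j. fps_nth (S' j) 0 \<noteq> 0"
      using IH(2) T0 by (simp add: S'_def)
    have anti: "strict_antimono_on {1..Suc m} (\<lambda>j. \<mu>' j + real j)"
    proof (rule monotone_onI)
      fix x y assume xy: "x \<in> {1..Suc m}" "y \<in> {1..Suc m}" "x < y"
      show "\<mu>' y + real y < \<mu>' x + real x"
      proof (cases "y = Suc m")
        case False
        then show ?thesis
          using xy monotone_onD[OF IH(3), of x y] by (simp add: \<mu>'_def)
      next
        case True
        \<comment> \<open>Here \<open>x \<le> m\<close>, so \<open>m\<close> is positive and the gap
          \<open>\<mu>0 + 1 < \<mu> m\<close> is available. Strict monotonicity covers only
          \<open>x < m\<close>.\<close>
        then have "\<mu> m + real m \<le> \<mu> x + real x"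
          using xy monotone_onD[OF IH(3), of x m] by (cases "x = m") auto
        then show ?thesis using True xy IH(4) by (simp add: \<mu>'_def)
      qed
    qed
    show ?thesis
      by (rule exI[of _ "Suc m"], rule exI[of _ \<mu>'], rule exI[of _ S'])
         (use ann unit anti c in \<open>simp add: \<mu>'_def\<close>)
  qed
qed

text \<open>Dividing by \<open>a - \<mu> b\<close> in \<open>E\<^bsub>\<nu>-1\<^esub>\<close> means solving \<open>X z' + (\<nu> - 1 - \<mu>) z = y\<close>, whose
  recursion for the coefficients never meets a zero divisor if \<open>\<mu> + 1 < \<nu>\<close>.\<close>

lemma jh_prod_coord_ann:
  fixes \<mu> :: "nat \<Rightarrow> real"
  assumes "\<And>j. j \<in> {1..m} \<Longrightarrow> fps_nth (S j) 0 \<noteq> 0"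
    and "strict_antimono_on {1..m} (\<lambda>j. \<mu> j + real j)"
  shows "\<exists>\<nu> f. coord_ann (\<lambda>i. complex_of_real (\<nu> i)) f {..<m} =
      left_ideal (jh_prod (\<lambda>j. complex_of_real (\<mu> j)) S m) \<and> (\<forall>i<m. \<mu> m \<le> \<nu> i)"
  using assms
proof (induction m)
  case 0
  then show ?case by (simp add: coord_ann_def)
next
  case (Suc m)
  have "strict_antimono_on {1..m} (\<lambda>j. \<mu> j + real j)"
    using Suc.prems(2) by (rule monotone_on_subset) auto
  with Suc obtain \<nu> f where
    IH: "coord_ann (\<lambda>i. complex_of_real (\<nu> i)) f {..<m} =
      left_ideal (jh_prod (\<lambda>j. complex_of_real (\<mu> j)) S m)" "\<forall>i<m. \<mu> m \<le> \<nu> i"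
    by auto
  define \<mu>0 where "\<mu>0 = \<mu> (Suc m)"
  define T where "T = S (Suc m)"
  have T0: "fps_nth T 0 \<noteq> 0" using Suc.prems(1) by (simp add: T_def)
  have gap: "\<mu>0 + 1 < \<nu> i" if "i < m" for i
  proof -
    \<comment> \<open>The assumption \<open>i < m\<close> makes \<open>m\<close> positive, so both
      indices lie in the range of the monotonicity hypothesis.\<close>
    have "\<mu> (Suc m) + real (Suc m) < \<mu> m + real m"
      using that by (intro monotone_onD[OF Suc.prems(2)]) auto
    moreover have "\<mu> m \<le> \<nu> i" using IH(2) that by blast
    ultimately show ?thesis by (simp add: \<mu>0_def)
  qed
  \<comment> \<open>At exponent \<open>\<nu> i - 1\<close> the series \<open>X * f i\<close> has the
    same annihilator as \<open>f i\<close> at \<open>\<nu> i\<close>, so this is where a preimage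
    under \<open>a - \<mu>0 b\<close> is sought. The new component is the generator 1 at exponent
    \<open>\<mu>0\<close>, annihilated exactly by the multiples of
    \<open>a - \<mu>0 b\<close>.\<close>
  define \<nu>' where "\<nu>' i = (if i = m then \<mu>0 else \<nu> i - 1)" for i
  define z where "z i = (if i = m then 1 else
    Abs_fps (\<lambda>n. fps_nth (f i) n / complex_of_real (real n + \<nu> i - 1 - \<mu>0)))" for i
  have lin_z: "ab_act (complex_of_real (\<nu>' i)) (ab_lin (complex_of_real \<mu>0)) (z i) = fps_X * f i"
    if "i < m" for i
  proof (rule fps_ext)
    fix n
    show "fps_nth (ab_act (complex_of_real (\<nu>' i)) (ab_lin (complex_of_real \<mu>0)) (z i)) n =
      fps_nth (fps_X * f i) n"
    proof (cases n)
      case 0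
      then show ?thesis by simp
    next
      case (Suc l)
      have "fps_nth (ab_act (complex_of_real (\<nu>' i)) (ab_lin (complex_of_real \<mu>0)) (z i)) n =
          (of_nat l + complex_of_real (\<nu>' i) - complex_of_real \<mu>0) * fps_nth (z i) l"
        unfolding Suc ab_act_lin_nth_Suc ..
      also have "of_nat l + complex_of_real (\<nu>' i) - complex_of_real \<mu>0 =
          complex_of_real (real l + \<nu> i - 1 - \<mu>0)"
        using that by (simp add: \<nu>'_def)
      also have "\<dots> * fps_nth (z i) l = fps_nth (f i) l"
      proof -
        have "complex_of_real (real l + \<nu> i - 1 - \<mu>0) \<noteq> 0"
          using gap[OF that] unfolding of_real_eq_0_iff by linarith
        then show ?thesis using that by (simp add: z_def)
      qed
      finally show ?thesis using Suc by simp
    qed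
  qed
  \<comment> \<open>The factor \<open>inverse T\<close> is undone by the unit \<open>T\<close>,
    which acts first, so that \<open>a - \<mu>0 b\<close> meets \<open>z i\<close> itself.\<close>
  define f' where "f' i = inverse T * z i" for i
  have "r \<in> coord_ann (\<lambda>i. complex_of_real (\<nu>' i)) f' {..<Suc m} \<longleftrightarrow>
      (\<exists>q\<in>coord_ann (\<lambda>i. complex_of_real (\<nu> i)) f {..<m}.
        r = ab_mult q (ab_mult (ab_lin (complex_of_real \<mu>0)) (ab_of_fps T)))" for r
  proof -
    define s where "s = ab_mult r (ab_of_fps (inverse T))"
    have s: "s = ab_mult q l \<longleftrightarrow> r = ab_mult q (ab_mult l (ab_of_fps T))" for q l
      by (simp add: s_def ab_mult_unit_eq_iff[OF T0] ab_mult_assoc)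
    have act: "ab_act (complex_of_real (\<nu>' i)) r (f' i) = ab_act (complex_of_real (\<nu>' i)) s (z i)" for i
      by (simp add: s_def f'_def ab_act_mult)
    have "r \<in> coord_ann (\<lambda>i. complex_of_real (\<nu>' i)) f' {..<Suc m} \<longleftrightarrow>
        (\<exists>q. s = ab_mult q (ab_lin (complex_of_real \<mu>0))) \<and>
        (\<forall>i<m. ab_act (complex_of_real (\<nu>' i)) s (z i) = 0)"
    proof -
      have "ab_act (complex_of_real (\<nu>' m)) s (z m) = 0 \<longleftrightarrow>
          (\<exists>q. s = ab_mult q (ab_lin (complex_of_real \<mu>0)))"
        by (simp add: \<nu>'_def z_def ab_act_1_eq_0_iff)
      then show ?thesis
        unfolding coord_ann_def mem_Collect_eq act lessThan_Suc by auto
    qed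
    also have "\<dots> \<longleftrightarrow> (\<exists>q. s = ab_mult q (ab_lin (complex_of_real \<mu>0)) \<and>
        (\<forall>i<m. ab_act (complex_of_real (\<nu> i)) q (f i) = 0))"
    proof -
      have "ab_act (complex_of_real (\<nu>' i)) (ab_mult q (ab_lin (complex_of_real \<mu>0))) (z i) =
          fps_X * ab_act (complex_of_real (\<nu> i)) q (f i)" if "i < m" for i q
        using that unfolding ab_act_mult lin_z[OF that] ab_act_X by (simp add: \<nu>'_def)
      then show ?thesis by (metis fps_X_neq_zero mult_eq_0_iff)
    qed
    finally show ?thesis unfolding s coord_ann_def by blast
  qed
  then have "coord_ann (\<lambda>i. complex_of_real (\<nu>' i)) f' {..<Suc m} =
      left_ideal (jh_prod (\<lambda>j. complex_of_real (\<mu> j)) S (Suc m))"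
    unfolding IH(1) by (auto simp: left_ideal_mult_iff \<mu>0_def T_def)
  moreover have "\<forall>i<Suc m. \<mu> (Suc m) \<le> \<nu>' i"
  proof -
    have "\<mu>0 \<le> \<nu> i - 1" if "i < m" for i using gap[OF that] by linarith
    then show ?thesis by (auto simp: \<nu>'_def less_Suc_eq simp flip: \<mu>0_def)
  qed
  ultimately show ?case by blast
qed

section \<open>Submodules, quotients and rank one layers\<close>

context left_module
begin

lemma smult_l_null [simp]:
  assumes x: "x \<in> carrier M"
  shows "\<zero> \<odot>\<^bsub>M\<^esub> x = \<zero>\<^bsub>M\<^esub>"
proof -
  have "\<zero> \<odot>\<^bsub>M\<^esub> x \<oplus>\<^bsub>M\<^esub> \<zero> \<odot>\<^bsub>M\<^esub> x = \<zero> \<odot>\<^bsub>M\<^esub> x"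
    using x by (simp flip: smult_l_distr)
  then show ?thesis using x by (simp add: M.add.l_cancel_one')
qed

lemma smult_r_null [simp]:
  assumes r: "r \<in> carrier R"
  shows "r \<odot>\<^bsub>M\<^esub> \<zero>\<^bsub>M\<^esub> = \<zero>\<^bsub>M\<^esub>"
proof -
  have "r \<odot>\<^bsub>M\<^esub> \<zero>\<^bsub>M\<^esub> \<oplus>\<^bsub>M\<^esub> r \<odot>\<^bsub>M\<^esub> \<zero>\<^bsub>M\<^esub> = r \<odot>\<^bsub>M\<^esub> \<zero>\<^bsub>M\<^esub>"
    using r by (simp flip: smult_r_distr)
  then show ?thesis using r by (simp add: M.add.l_cancel_one')
qed

lemma smult_minus_one:
  assumes x: "x \<in> carrier M"
  shows "(\<ominus> \<one>) \<odot>\<^bsub>M\<^esub> x = \<ominus>\<^bsub>M\<^esub> x"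
proof (rule M.minus_equality[symmetric])
  have "(\<ominus> \<one>) \<odot>\<^bsub>M\<^esub> x \<oplus>\<^bsub>M\<^esub> \<one> \<odot>\<^bsub>M\<^esub> x = ((\<ominus> \<one>) \<oplus> \<one>) \<odot>\<^bsub>M\<^esub> x"
    using x by (simp only: smult_l_distr R.a_inv_closed R.one_closed)
  then show "(\<ominus> \<one>) \<odot>\<^bsub>M\<^esub> x \<oplus>\<^bsub>M\<^esub> x = \<zero>\<^bsub>M\<^esub>"
    using x by (simp add: R.l_neg)
qed (use x in auto)

lemma submoduleI:
  assumes "H \<subseteq> carrier M" "\<zero>\<^bsub>M\<^esub> \<in> H"
    and "\<And>x y. x \<in> H \<Longrightarrow> y \<in> H \<Longrightarrow> x \<oplus>\<^bsub>M\<^esub> y \<in> H"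
    and smult: "\<And>r x. r \<in> carrier R \<Longrightarrow> x \<in> H \<Longrightarrow> r \<odot>\<^bsub>M\<^esub> x \<in> H"
  shows "submodule H R M"
proof (intro submodule.intro submodule_axioms.intro subgroup.intro)
  fix x assume "x \<in> H"
  then have "(\<ominus> \<one>) \<odot>\<^bsub>M\<^esub> x \<in> H" by (intro smult) auto
  then have "\<ominus>\<^bsub>M\<^esub> x \<in> H" using \<open>x \<in> H\<close> assms(1) by (subst (asm) smult_minus_one) auto
  then show "inv\<^bsub>add_monoid M\<^esub> x \<in> H" by (simp add: a_inv_def)
qed (use assms in auto)

lemma submoduleD:
  assumes "submodule H R M"
  shows "H \<subseteq> carrier M" "\<zero>\<^bsub>M\<^esub> \<in> H"
    and "\<And>x y. x \<in> H \<Longrightarrow> y \<in> H \<Longrightarrow> x \<oplus>\<^bsub>M\<^esub> y \<in> H"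
    and "\<And>r x. r \<in> carrier R \<Longrightarrow> x \<in> H \<Longrightarrow> r \<odot>\<^bsub>M\<^esub> x \<in> H"
    and "\<And>x. x \<in> H \<Longrightarrow> \<ominus>\<^bsub>M\<^esub> x \<in> H"
proof -
  interpret submodule H R M by fact
  show "H \<subseteq> carrier M" "\<zero>\<^bsub>M\<^esub> \<in> H" using subset one_closed by auto
  show "\<And>x y. x \<in> H \<Longrightarrow> y \<in> H \<Longrightarrow> x \<oplus>\<^bsub>M\<^esub> y \<in> H" using m_closed by auto
  show "\<And>r x. r \<in> carrier R \<Longrightarrow> x \<in> H \<Longrightarrow> r \<odot>\<^bsub>M\<^esub> x \<in> H" by auto
  show "\<And>x. x \<in> H \<Longrightarrow> \<ominus>\<^bsub>M\<^esub> x \<in> H" using m_inv_closed by (auto simp: a_inv_def)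
qed

lemma left_module_submodule:
  assumes H: "submodule H R M"
  shows "left_module R (M\<lparr>carrier := H\<rparr>)"
proof (rule left_module.intro)
  note D = submoduleD[OF H]
  have mem: "x \<in> carrier M" if "x \<in> H" for x using D(1) that by blast
  show "ring R" by (rule R.ring_axioms)
  show "abelian_group (M\<lparr>carrier := H\<rparr>)"
  proof (rule abelian_groupI)
    fix x assume "x \<in> carrier (M\<lparr>carrier := H\<rparr>)"
    then show "\<exists>y\<in>carrier (M\<lparr>carrier := H\<rparr>). y \<oplus>\<^bsub>M\<lparr>carrier := H\<rparr>\<^esub> x = \<zero>\<^bsub>M\<lparr>carrier := H\<rparr>\<^esub>"
      using D(5) mem by (intro bexI[of _ "\<ominus>\<^bsub>M\<^esub> x"]) (simp_all add: M.l_neg)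
  qed (simp_all add: D mem M.a_ac)
  show "left_module_axioms R (M\<lparr>carrier := H\<rparr>)"
    by (rule left_module_axioms.intro)
       (simp_all add: D mem smult_l_distr smult_r_distr smult_assoc1)
qed

lemma submodule_of_submodule:
  assumes H: "submodule H R M" and K: "submodule K R M" "K \<subseteq> H"
  shows "submodule K R (M\<lparr>carrier := H\<rparr>)"
proof -
  interpret N: left_module R "M\<lparr>carrier := H\<rparr>" by (rule left_module_submodule[OF H])
  show ?thesis
    by (rule N.submoduleI) (use submoduleD[OF K(1)] K(2) in auto)
qed

lemma abelian_subgroup_submodule: "submodule H R M \<Longrightarrow> abelian_subgroup H M"
  by (intro abelian_subgroupI3 additive_subgroup.intro submodule.axioms(1) M.abelian_group_axioms)

text \<open>All representatives of the coset yield the same coset, so the union in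
  \<open>induced_map\<close> is a constant union.\<close>

lemma induced_smult_coset:
  assumes H: "submodule H R M" and "x \<in> carrier M" "r \<in> carrier R"
  shows "induced_map M H (\<lambda>x. r \<odot>\<^bsub>M\<^esub> x) (H +>\<^bsub>M\<^esub> x) = H +>\<^bsub>M\<^esub> (r \<odot>\<^bsub>M\<^esub> x)"
proof -
  interpret abelian_subgroup H M by (rule abelian_subgroup_submodule[OF H])
  note D = submoduleD[OF H]
  have "H +>\<^bsub>M\<^esub> (r \<odot>\<^bsub>M\<^esub> y) = H +>\<^bsub>M\<^esub> (r \<odot>\<^bsub>M\<^esub> x)" if y: "y \<in> H +>\<^bsub>M\<^esub> x" for y
  proof -
    obtain h where h: "h \<in> H" "y = h \<oplus>\<^bsub>M\<^esub> x" using y by (auto simp: a_r_coset_def')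
    then have "r \<odot>\<^bsub>M\<^esub> y = r \<odot>\<^bsub>M\<^esub> h \<oplus>\<^bsub>M\<^esub> r \<odot>\<^bsub>M\<^esub> x"
      using assms(2,3) h(1) D(1) by (simp add: smult_r_distr[OF assms(3)] subset_iff)
    then have "r \<odot>\<^bsub>M\<^esub> y \<in> H +>\<^bsub>M\<^esub> (r \<odot>\<^bsub>M\<^esub> x)"
      using D(4)[OF assms(3) h(1)] unfolding a_r_coset_def' by blast
    then show ?thesis using assms(2,3) by (intro a_repr_independence'[symmetric]) simp_all
  qed
  moreover have "x \<in> H +>\<^bsub>M\<^esub> x" using assms by (intro a_rcos_self)
  ultimately show ?thesis unfolding induced_map_def by (intro SUP_eq_const) blast+
qed

lemma left_module_quot:
  assumes H: "submodule H R M"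
  shows "left_module R (quot_module M H)"
proof -
  interpret S: abelian_subgroup H M by (rule abelian_subgroup_submodule[OF H])
  note ind = induced_smult_coset[OF H]
  have coset: "X \<in> a_rcosets\<^bsub>M\<^esub> H \<longleftrightarrow> (\<exists>x\<in>carrier M. X = H +>\<^bsub>M\<^esub> x)" for X
    by (auto simp: A_RCOSETS_def RCOSETS_def a_r_coset_def)
  have "abelian_group (quot_module M H)"
  proof (rule abelian_groupI)
    fix X Y assume X: "X \<in> carrier (quot_module M H)" and Y: "Y \<in> carrier (quot_module M H)"
    show "X \<oplus>\<^bsub>quot_module M H\<^esub> Y \<in> carrier (quot_module M H)"
      using X Y S.a_setmult_closed by (simp add: quot_module_def)
    obtain x y where "x \<in> carrier M" "X = H +>\<^bsub>M\<^esub> x" "y \<in> carrier M" "Y = H +>\<^bsub>M\<^esub> y"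
      using X Y by (auto simp: quot_module_def coset)
    then show "X \<oplus>\<^bsub>quot_module M H\<^esub> Y = Y \<oplus>\<^bsub>quot_module M H\<^esub> X"
      by (simp add: quot_module_def S.a_rcos_sum M.a_comm)
    show "\<exists>Z\<in>carrier (quot_module M H). Z \<oplus>\<^bsub>quot_module M H\<^esub> X = \<zero>\<^bsub>quot_module M H\<^esub>"
      using X S.a_setinv_closed S.a_rcosets_inv_mult_group_eq by (auto simp: quot_module_def)
  qed (simp_all add: quot_module_def S.a_rcosets_assoc S.a_subgroup_in_rcosets S.rcosets_add_eq)
  moreover have "left_module_axioms R (quot_module M H)"
    by (rule left_module_axioms.intro)
       (auto simp: quot_module_def coset ind S.a_rcos_sum smult_l_distr smult_r_distr smult_assoc1)
  ultimately show ?thesis by (intro left_module.intro R.ring_axioms)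
qed

end

section \<open>Coordinates on modules isomorphic to \<open>E\<^sub>\<mu>\<close>\<close>

lemma ab_algebra_simps [simp]:
  "carrier ab_algebra = UNIV" "monoid.mult ab_algebra = ab_mult" "one ab_algebra = 1"
  "zero ab_algebra = 0" "add ab_algebra = (+)"
  by (simp_all add: ab_algebra_def)

text \<open>\<open>M\<close> is identified with \<open>E\<^sub>\<mu>\<close> by means of \<open>\<pi>\<close>.\<close>

definition E_coord :: "complex \<Rightarrow> (ab_series, 'e) module \<Rightarrow> ('e \<Rightarrow> complex fps) \<Rightarrow> bool"
  where "E_coord \<mu> M \<pi> \<longleftrightarrow> left_module ab_algebra M \<and> bij_betw \<pi> (carrier M) UNIV \<and>
    (\<forall>x\<in>carrier M. \<forall>y\<in>carrier M. \<pi> (x \<oplus>\<^bsub>M\<^esub> y) = \<pi> x + \<pi> y) \<and>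
    (\<forall>r. \<forall>x\<in>carrier M. \<pi> (r \<odot>\<^bsub>M\<^esub> x) = ab_act \<mu> r (\<pi> x))"

text \<open>\<open>\<pi>\<close> identifies the quotient \<open>F/F'\<close> with \<open>E\<^sub>\<mu>\<close>.\<close>

definition layer ::
  "(ab_series, 'e) module \<Rightarrow> 'e set \<Rightarrow> 'e set \<Rightarrow> complex \<Rightarrow> ('e \<Rightarrow> complex fps) \<Rightarrow> bool"
  where "layer E F F' \<mu> \<pi> \<longleftrightarrow> \<pi> ` F = UNIV \<and> F' = {x \<in> F. \<pi> x = 0} \<and>
    (\<forall>x\<in>F. \<forall>y\<in>F. \<pi> (x \<oplus>\<^bsub>E\<^esub> y) = \<pi> x + \<pi> y) \<and>
    (\<forall>r. \<forall>x\<in>F. \<pi> (r \<odot>\<^bsub>E\<^esub> x) = ab_act \<mu> r (\<pi> x))"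

lemma E_coord_isomorphic:
  assumes "E_coord \<mu> M \<pi>" "E_coord \<mu> N \<rho>"
  shows "module_isomorphic ab_algebra M N"
proof -
  interpret M: left_module ab_algebra M using assms(1) by (simp add: E_coord_def)
  interpret N: left_module ab_algebra N using assms(2) by (simp add: E_coord_def)
  define h where "h x = inv_into (carrier N) \<rho> (\<pi> x)" for x
  have inj: "inj_on \<rho> (carrier N)" and surj: "\<rho> ` carrier N = UNIV"
    using assms(2) by (simp_all add: E_coord_def bij_betw_def)
  have h: "h x \<in> carrier N" "\<rho> (h x) = \<pi> x" for x
    using surj by (auto simp: h_def f_inv_into_f intro!: inv_into_into)
  have eqI: "u = v" if "u \<in> carrier N" "v \<in> carrier N" "\<rho> u = \<rho> v" for u v
    using inj_onD[OF inj] that by blast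
  have "bij_betw (inv_into (carrier N) \<rho>) UNIV (carrier N)"
    using assms(2) by (intro bij_betw_inv_into) (simp add: E_coord_def)
  then have "bij_betw h (carrier M) (carrier N)"
    using bij_betw_trans[of \<pi> "carrier M" UNIV "inv_into (carrier N) \<rho>" "carrier N"] assms(1)
    by (simp add: E_coord_def h_def[abs_def] comp_def)
  moreover have "h \<in> module_hom ab_algebra M N"
  proof -
    have "h (x \<oplus>\<^bsub>M\<^esub> y) = h x \<oplus>\<^bsub>N\<^esub> h y" if "x \<in> carrier M" "y \<in> carrier M" for x y
      by (rule eqI) (use assms h that in \<open>auto simp: E_coord_def\<close>)
    moreover have "h (r \<odot>\<^bsub>M\<^esub> x) = r \<odot>\<^bsub>N\<^esub> h x" if "x \<in> carrier M" for r x
      by (rule eqI) (use assms h that in \<open>auto simp: E_coord_def\<close>)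
    ultimately show ?thesis using h by (auto simp: module_hom_def)
  qed
  ultimately show ?thesis by (auto simp: module_isomorphic_def)
qed

lemma E_coord_transfer:
  assumes "left_module ab_algebra M" "E_coord \<mu> N \<rho>" "h \<in> module_hom ab_algebra M N"
    and "bij_betw h (carrier M) (carrier N)"
  shows "E_coord \<mu> M (\<lambda>x. \<rho> (h x))"
proof -
  have "bij_betw (\<rho> \<circ> h) (carrier M) UNIV"
    using assms(2,4) bij_betw_trans by (auto simp: E_coord_def)
  moreover have "h x \<in> carrier N" if "x \<in> carrier M" for x
    using assms(3) that by (auto simp: module_hom_def)
  ultimately show ?thesis
    using assms by (auto simp: E_coord_def module_hom_def comp_def)
qed

text \<open>The preimage of 1 is a basis, because \<open>\<complex>[[b]]\<close> acts on the
  coordinates by plain multiplication.\<close>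

lemma E_coord_rank_1:
  assumes "E_coord \<mu> M \<pi>"
  shows "ab_module_of_rank 1 M"
proof -
  interpret M: left_module ab_algebra M using assms by (simp add: E_coord_def)
  have bij: "bij_betw \<pi> (carrier M) UNIV" using assms by (simp add: E_coord_def)
  obtain e where e: "e \<in> carrier M" "\<pi> e = 1"
    using bij unfolding bij_betw_def by (metis UNIV_I imageE)
  have pi: "\<pi> (ab_of_fps f \<odot>\<^bsub>M\<^esub> e) = f" for f
    using assms e by (simp add: E_coord_def)
  have sm: "ab_of_fps f \<odot>\<^bsub>M\<^esub> e \<in> carrier M" for f using e by simp
  have sum: "(\<Oplus>\<^bsub>M\<^esub>i\<in>{..<1::nat}. ab_of_fps (c i) \<odot>\<^bsub>M\<^esub> e) = ab_of_fps (c 0) \<odot>\<^bsub>M\<^esub> e" for c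
    using sm by (simp add: lessThan_Suc)
  have "\<exists>!c. c \<in> {..<1} \<rightarrow>\<^sub>E UNIV \<and> x = (\<Oplus>\<^bsub>M\<^esub>i\<in>{..<1::nat}. ab_of_fps (c i) \<odot>\<^bsub>M\<^esub> e)"
    if x: "x \<in> carrier M" for x
  proof (rule ex1I[of _ "\<lambda>i\<in>{..<1}. \<pi> x"])
    have "x = ab_of_fps (\<pi> x) \<odot>\<^bsub>M\<^esub> e"
      by (rule inj_onD[OF bij_betw_imp_inj_on[OF bij]]) (use pi x sm in auto)
    then show "(\<lambda>i\<in>{..<1}. \<pi> x) \<in> {..<1} \<rightarrow>\<^sub>E UNIV \<and>
      x = (\<Oplus>\<^bsub>M\<^esub>i\<in>{..<1::nat}. ab_of_fps ((\<lambda>i\<in>{..<1}. \<pi> x) i) \<odot>\<^bsub>M\<^esub> e)"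
      unfolding sum by auto
  next
    fix c assume c: "c \<in> {..<1::nat} \<rightarrow>\<^sub>E UNIV \<and> x = (\<Oplus>\<^bsub>M\<^esub>i\<in>{..<1}. ab_of_fps (c i) \<odot>\<^bsub>M\<^esub> e)"
    then have "\<pi> x = c 0" unfolding sum using pi by auto
    then show "c = (\<lambda>i\<in>{..<1}. \<pi> x)"
      using c by (auto simp: PiE_def extensional_def fun_eq_iff)
  qed
  then have "ab_basis M 1 (\<lambda>_. e)"
    unfolding ab_basis_def using e by auto
  then show ?thesis
    unfolding ab_module_of_rank_def using M.left_module_axioms by blast
qed

text \<open>With the scalars fixed every series is an admissible scalar, so the membership
  conditions on scalars disappear.\<close>

locale ab_left_module = left_module ab_algebra E
  for E :: "(ab_series, 'e) module" (structure)
begin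

lemma smult_in [simp, intro]: "x \<in> carrier E \<Longrightarrow> r \<odot> x \<in> carrier E"
  by simp

lemma add_smult: "x \<in> carrier E \<Longrightarrow> (r + s) \<odot> x = r \<odot> x \<oplus> s \<odot> x"
  using smult_l_distr[of r s x] by simp

lemma mult_smult: "x \<in> carrier E \<Longrightarrow> ab_mult r s \<odot> x = r \<odot> (s \<odot> x)"
  using smult_assoc1[of r s x] by simp

lemma smult_add: "x \<in> carrier E \<Longrightarrow> y \<in> carrier E \<Longrightarrow> r \<odot> (x \<oplus> y) = r \<odot> x \<oplus> r \<odot> y"
  using smult_r_distr[of r x y] by simp

lemma one_smult [simp]: "x \<in> carrier E \<Longrightarrow> 1 \<odot> x = x"
  using smult_one[of x] by simp

lemma zero_smult [simp]: "x \<in> carrier E \<Longrightarrow> 0 \<odot> x = \<zero>"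
  using smult_l_null[of x] by simp

lemma submodule_intro:
  "H \<subseteq> carrier E \<Longrightarrow> \<zero> \<in> H \<Longrightarrow> (\<And>x y. x \<in> H \<Longrightarrow> y \<in> H \<Longrightarrow> x \<oplus> y \<in> H) \<Longrightarrow>
    (\<And>r x. x \<in> H \<Longrightarrow> r \<odot> x \<in> H) \<Longrightarrow> submodule H ab_algebra E"
  by (rule submoduleI) auto

definition cyclic :: "'e \<Rightarrow> 'e set" where "cyclic x = range (\<lambda>r. r \<odot> x)"

definition ann :: "'e \<Rightarrow> ab_series set" where "ann x = {r. r \<odot> x = \<zero>}"

lemma submodule_cyclic:
  assumes "x \<in> carrier E"
  shows "submodule (cyclic x) ab_algebra E"
proof (rule submodule_intro)
  show "\<zero> \<in> cyclic x" unfolding cyclic_def using assms zero_smult by (metis rangeI)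
  show "u \<oplus> v \<in> cyclic x" if "u \<in> cyclic x" "v \<in> cyclic x" for u v
    using that assms unfolding cyclic_def by (auto simp flip: add_smult)
  show "r \<odot> u \<in> cyclic x" if "u \<in> cyclic x" for r u
    using that assms unfolding cyclic_def by (auto simp flip: mult_smult)
qed (use assms in \<open>auto simp: cyclic_def\<close>)

lemma layer_zero:
  assumes "layer E F F' \<mu> \<pi>" "submodule F ab_algebra E"
  shows "\<pi> \<zero> = 0"
proof -
  have "\<pi> (\<zero> \<oplus> \<zero>) = \<pi> \<zero> + \<pi> \<zero>"
    using assms submoduleD(2)[OF assms(2)] by (simp only: layer_def)
  then show ?thesis by simp
qed

lemma layer_minus:
  assumes "layer E F F' \<mu> \<pi>" "submodule F ab_algebra E" "x \<in> F" "y \<in> F"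
  shows "\<pi> (x \<ominus> y) = \<pi> x - \<pi> y"
proof -
  note D = submoduleD[OF assms(2)]
  have "\<pi> (x \<ominus> y \<oplus> y) = \<pi> (x \<ominus> y) + \<pi> y"
    using assms D unfolding layer_def by (auto simp: M.minus_eq)
  moreover have "x \<ominus> y \<oplus> y = x"
    using assms(3,4) D(1) by (simp add: M.minus_eq M.a_assoc M.l_neg subset_iff)
  ultimately show ?thesis by simp
qed

lemma layer_submodule:
  assumes "layer E F F' \<mu> \<pi>" "submodule F ab_algebra E"
  shows "submodule F' ab_algebra E" "F' \<subseteq> F"
proof -
  note D = submoduleD[OF assms(2)]
  have F': "F' = {x \<in> F. \<pi> x = 0}" using assms(1) by (simp add: layer_def)
  then show "F' \<subseteq> F" by auto
  show "submodule F' ab_algebra E"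
    by (rule submodule_intro) (use assms(1) D layer_zero[OF assms] in \<open>auto simp: layer_def\<close>)
qed

text \<open>First isomorphism theorem: \<open>\<pi>\<close> is additive with kernel
  \<open>F'\<close>, hence constant on cosets, and the representative picked by \<open>SOME\<close>
  does not matter.\<close>

lemma E_coord_subquotient:
  assumes L: "layer E F F' \<mu> \<pi>" and F: "submodule F ab_algebra E"
  shows "E_coord \<mu> (subquotient E F F') (\<lambda>X. \<pi> (SOME x. x \<in> X))"
proof -
  define N where "N = E\<lparr>carrier := F\<rparr>"
  define \<rho> where "\<rho> X = \<pi> (SOME x. x \<in> X)" for X
  interpret N: left_module ab_algebra N
    unfolding N_def by (rule left_module_submodule[OF F])
  have F'N: "submodule F' ab_algebra N"
    unfolding N_def by (rule submodule_of_submodule[OF F layer_submodule[OF L F]])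
  interpret S: abelian_subgroup F' N by (rule N.abelian_subgroup_submodule[OF F'N])
  note ind = N.induced_smult_coset[OF F'N]
  have coset: "X \<in> a_rcosets\<^bsub>N\<^esub> F' \<longleftrightarrow> (\<exists>x\<in>F. X = F' +>\<^bsub>N\<^esub> x)" for X
    by (auto simp: A_RCOSETS_def RCOSETS_def a_r_coset_def N_def)
  have \<rho>: "\<rho> (F' +>\<^bsub>N\<^esub> x) = \<pi> x" if x: "x \<in> F" for x
  proof -
    have "x \<in> F' +>\<^bsub>N\<^esub> x" using x by (intro S.a_rcos_self) (simp add: N_def)
    then have "(SOME y. y \<in> F' +>\<^bsub>N\<^esub> x) \<in> F' +>\<^bsub>N\<^esub> x" by (rule someI)
    then obtain h where h: "h \<in> F'" "(SOME y. y \<in> F' +>\<^bsub>N\<^esub> x) = h \<oplus> x"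
      by (auto simp: a_r_coset_def' N_def)
    then show ?thesis using L x by (auto simp: layer_def \<rho>_def)
  qed
  have "left_module ab_algebra (quot_module N F')" by (rule N.left_module_quot[OF F'N])
  moreover have "bij_betw \<rho> (a_rcosets\<^bsub>N\<^esub> F') UNIV"
    unfolding bij_betw_def
  proof
    show "inj_on \<rho> (a_rcosets\<^bsub>N\<^esub> F')"
    proof (rule inj_onI)
      fix X Y assume "X \<in> a_rcosets\<^bsub>N\<^esub> F'" "Y \<in> a_rcosets\<^bsub>N\<^esub> F'" "\<rho> X = \<rho> Y"
      then obtain x y where xy: "x \<in> F" "X = F' +>\<^bsub>N\<^esub> x" "y \<in> F" "Y = F' +>\<^bsub>N\<^esub> y" "\<pi> x = \<pi> y"
        by (auto simp: coset \<rho>)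
      obtain z where z: "z \<in> F" "z \<oplus> y = x" "\<pi> z = 0"
      proof
        note D = submoduleD[OF F]
        show "x \<ominus> y \<in> F" using xy D by (auto simp: M.minus_eq)
        show "x \<ominus> y \<oplus> y = x"
          using xy(1,3) D(1) by (simp add: M.minus_eq M.a_assoc M.l_neg subset_iff)
        show "\<pi> (x \<ominus> y) = 0" using layer_minus[OF L F xy(1,3)] xy(5) by simp
      qed
      have "z \<in> F'" using z L by (simp add: layer_def)
      then have "x \<in> F' +>\<^bsub>N\<^esub> y" using z by (auto simp: a_r_coset_def' N_def)
      then show "X = Y" using xy S.a_repr_independence'[of x y] by (simp add: N_def)
    qed
    show "\<rho> ` (a_rcosets\<^bsub>N\<^esub> F') = UNIV"
    proof -
      have "f \<in> \<rho> ` (a_rcosets\<^bsub>N\<^esub> F')" for f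
      proof -
        obtain x where x: "x \<in> F" "\<pi> x = f" using L unfolding layer_def by (metis UNIV_I imageE)
        then have "F' +>\<^bsub>N\<^esub> x \<in> a_rcosets\<^bsub>N\<^esub> F'" by (auto simp: coset)
        then show ?thesis using \<rho>[OF x(1)] x(2) by (metis imageI)
      qed
      then show ?thesis by auto
    qed
  qed
  moreover have "\<rho> (X <+>\<^bsub>N\<^esub> Y) = \<rho> X + \<rho> Y"
    if XY: "X \<in> a_rcosets\<^bsub>N\<^esub> F'" "Y \<in> a_rcosets\<^bsub>N\<^esub> F'" for X Y
  proof -
    obtain x y where xy: "x \<in> F" "X = F' +>\<^bsub>N\<^esub> x" "y \<in> F" "Y = F' +>\<^bsub>N\<^esub> y"
      using XY unfolding coset by blast
    have "X <+>\<^bsub>N\<^esub> Y = F' +>\<^bsub>N\<^esub> (x \<oplus> y)"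
      using xy S.a_rcos_sum[of x y] by (simp add: N_def)
    moreover have "\<pi> (x \<oplus> y) = \<pi> x + \<pi> y" using xy L by (simp only: layer_def)
    ultimately show ?thesis
      using xy submoduleD(3)[OF F, of x y] by (simp add: \<rho>)
  qed
  moreover have "\<rho> (induced_map N F' (\<lambda>x. r \<odot>\<^bsub>N\<^esub> x) X) = ab_act \<mu> r (\<rho> X)"
    if X: "X \<in> a_rcosets\<^bsub>N\<^esub> F'" for X r
  proof -
    obtain x where x: "x \<in> F" "X = F' +>\<^bsub>N\<^esub> x" using X by (auto simp: coset)
    then have "induced_map N F' (\<lambda>x. r \<odot>\<^bsub>N\<^esub> x) X = F' +>\<^bsub>N\<^esub> (r \<odot> x)"
      using ind[of x r] by (simp add: N_def)
    moreover have "\<pi> (r \<odot> x) = ab_act \<mu> r (\<pi> x)" using x L by (simp only: layer_def)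
    ultimately show ?thesis
      using x submoduleD(4)[OF F, of r x] by (simp add: \<rho>)
  qed
  moreover have "carrier (quot_module N F') = a_rcosets\<^bsub>N\<^esub> F'"
    "add (quot_module N F') = set_add N"
    "module.smult (quot_module N F') = (\<lambda>r. induced_map N F' (\<lambda>x. r \<odot>\<^bsub>N\<^esub> x))"
    by (simp_all add: quot_module_def)
  ultimately have "E_coord \<mu> (quot_module N F') \<rho>"
    unfolding E_coord_def by (simp only: ball_simps simp_thms) blast
  then show ?thesis unfolding subquotient_def N_def \<rho>_def .
qed

end

section \<open>The modules \<open>E\<^sub>\<mu>\<close> as quotients of the algebra, and layers from
  isomorphisms\<close>

lemma left_module_regular: "left_module ab_algebra (regular_left_module ab_algebra)"
proof -
  interpret ring ab_algebra by (rule ring_ab_algebra)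
  have "abelian_group (regular_left_module ab_algebra)"
  proof (rule abelian_groupI)
    fix x :: ab_series
    show "\<exists>y\<in>carrier (regular_left_module ab_algebra).
        y \<oplus>\<^bsub>regular_left_module ab_algebra\<^esub> x = \<zero>\<^bsub>regular_left_module ab_algebra\<^esub>"
      by (rule bexI[of _ "- x"]) (simp_all add: regular_left_module_def)
  qed (simp_all add: regular_left_module_def add_ac)
  then show ?thesis
    by (intro left_module.intro left_module_axioms.intro ring_axioms)
       (auto simp: regular_left_module_def ab_mult_assoc ab_mult_distrib_left
         ab_mult_distrib_right ab_mult_1_left)
qed

text \<open>The map sending \<open>r\<close> to \<open>r\<close> acting on 1 is onto
  \<open>\<complex>[[X]]\<close>, and its kernel is the left ideal of \<open>a - \<mu> b\<close>. So
  it presents the algebra itself as a layer over this ideal.\<close>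

lemma E_coord_E_mod: "\<exists>\<rho>. E_coord \<mu> (E_mod \<mu>) \<rho>"
proof -
  define N where "N = regular_left_module ab_algebra"
  interpret N: ab_left_module N
    unfolding ab_left_module_def N_def by (rule left_module_regular)
  have "submodule UNIV ab_algebra N"
    by (rule N.submodule_intro) (auto simp: N_def regular_left_module_def)
  moreover have "layer N UNIV (range (\<lambda>r. ab_mult r (ab_lin \<mu>))) \<mu> (\<lambda>r. ab_act \<mu> r 1)"
  proof -
    have "f = ab_act \<mu> (ab_of_fps f) 1" for f by simp
    then have "range (\<lambda>r. ab_act \<mu> r 1) = UNIV" by blast
    then show ?thesis
      by (auto simp: layer_def N_def regular_left_module_def ab_act_add_left ab_act_mult
          ab_act_1_eq_0_iff)
  qed
  moreover have "E_mod \<mu> = subquotient N UNIV (range (\<lambda>r. ab_mult r (ab_lin \<mu>)))"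
    by (simp add: E_mod_def subquotient_def N_def regular_left_module_def ab_lin_def)
  ultimately show ?thesis using N.E_coord_subquotient by (intro exI) (simp only:)
qed

lemma E_coord_isomorphic_E_mod: "E_coord \<mu> M \<pi> \<Longrightarrow> module_isomorphic ab_algebra M (E_mod \<mu>)"
  using E_coord_E_mod E_coord_isomorphic by blast

context ab_left_module
begin

text \<open>A coordinate of the quotient is pulled back along the projection. From then on
  computations concern elements of \<open>F\<close>, not cosets.\<close>

lemma layer_of_isomorphic:
  assumes F: "submodule F ab_algebra E" and F': "submodule F' ab_algebra E" "F' \<subseteq> F"
    and iso: "module_isomorphic ab_algebra (subquotient E F F') (E_mod \<mu>)"
  shows "\<exists>\<pi>. layer E F F' \<mu> \<pi>"
proof -
  define N where "N = E\<lparr>carrier := F\<rparr>"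
  interpret N: left_module ab_algebra N
    unfolding N_def by (rule left_module_submodule[OF F])
  have F'N: "submodule F' ab_algebra N"
    unfolding N_def by (rule submodule_of_submodule[OF F F'])
  interpret S: abelian_subgroup F' N by (rule N.abelian_subgroup_submodule[OF F'N])
  have coset: "X \<in> a_rcosets\<^bsub>N\<^esub> F' \<longleftrightarrow> (\<exists>x\<in>F. X = F' +>\<^bsub>N\<^esub> x)" for X
    by (auto simp: A_RCOSETS_def RCOSETS_def a_r_coset_def N_def)
  have sq: "subquotient E F F' = quot_module N F'" by (simp add: subquotient_def N_def)
  obtain \<sigma> where \<sigma>: "E_coord \<mu> (quot_module N F') \<sigma>"
  proof -
    obtain \<rho> where "E_coord \<mu> (E_mod \<mu>) \<rho>" using E_coord_E_mod by blast
    moreover obtain h where "h \<in> module_hom ab_algebra (quot_module N F') (E_mod \<mu>)"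
      "bij_betw h (carrier (quot_module N F')) (carrier (E_mod \<mu>))"
      using iso unfolding module_isomorphic_def sq by blast
    ultimately show thesis
      using E_coord_transfer[OF N.left_module_quot[OF F'N]] that by blast
  qed
  define \<pi> where "\<pi> x = \<sigma> (F' +>\<^bsub>N\<^esub> x)" for x
  have \<sigma>bij: "bij_betw \<sigma> (a_rcosets\<^bsub>N\<^esub> F') UNIV"
    and \<sigma>add: "\<And>X Y. X \<in> a_rcosets\<^bsub>N\<^esub> F' \<Longrightarrow> Y \<in> a_rcosets\<^bsub>N\<^esub> F' \<Longrightarrow> \<sigma> (X <+>\<^bsub>N\<^esub> Y) = \<sigma> X + \<sigma> Y"
    and \<sigma>smult: "\<And>X r. X \<in> a_rcosets\<^bsub>N\<^esub> F' \<Longrightarrow>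
      \<sigma> (induced_map N F' (\<lambda>x. r \<odot>\<^bsub>N\<^esub> x) X) = ab_act \<mu> r (\<sigma> X)"
    using \<sigma> unfolding E_coord_def by (simp_all add: quot_module_def)
  have cosI: "F' +>\<^bsub>N\<^esub> x \<in> a_rcosets\<^bsub>N\<^esub> F'" if "x \<in> F" for x using that coset by auto
  have add: "\<pi> (x \<oplus> y) = \<pi> x + \<pi> y" if "x \<in> F" "y \<in> F" for x y
    using that S.a_rcos_sum[of x y] \<sigma>add[OF cosI[OF that(1)] cosI[OF that(2)]]
    by (simp add: \<pi>_def N_def)
  have smult: "\<pi> (r \<odot> x) = ab_act \<mu> r (\<pi> x)" if "x \<in> F" for x r
    using that N.induced_smult_coset[OF F'N, of x r] \<sigma>smult[OF cosI[OF that], of r]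
    by (simp add: \<pi>_def N_def)
  have surj: "\<pi> ` F = UNIV"
  proof -
    have "f \<in> \<pi> ` F" for f
    proof -
      have "f \<in> \<sigma> ` (a_rcosets\<^bsub>N\<^esub> F')" using \<sigma>bij by (simp add: bij_betw_def)
      then show ?thesis unfolding \<pi>_def using coset by auto
    qed
    then show ?thesis by auto
  qed
  have zeroF: "\<zero> \<in> F" using submoduleD(2)[OF F] .
  have \<pi>0: "\<pi> \<zero> = 0" using add[OF zeroF zeroF] by simp
  have "\<pi> x = 0 \<longleftrightarrow> x \<in> F'" if x: "x \<in> F" for x
  proof -
    have "\<pi> x = 0 \<longleftrightarrow> \<sigma> (F' +>\<^bsub>N\<^esub> x) = \<sigma> (F' +>\<^bsub>N\<^esub> \<zero>)"
      using \<pi>0 by (simp add: \<pi>_def)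
    also have "\<dots> \<longleftrightarrow> F' +>\<^bsub>N\<^esub> x = F' +>\<^bsub>N\<^esub> \<zero>"
      using \<sigma>bij cosI[OF x] cosI[OF zeroF] by (auto simp: bij_betw_def dest: inj_onD)
    also have "\<dots> \<longleftrightarrow> x \<in> F'"
    proof -
      have "F' +>\<^bsub>N\<^esub> \<zero> = F'"
        using S.a_rcos_const[of \<zero>] submoduleD(2)[OF F'(1)] by simp
      then show ?thesis
        using S.a_rcos_const[of x] S.a_rcos_self[of x] x by (auto simp: N_def)
    qed
    finally show ?thesis .
  qed
  then have "F' = {x \<in> F. \<pi> x = 0}" using F'(2) by auto
  then have "layer E F F' \<mu> \<pi>" using add smult surj unfolding layer_def by blast
  then show ?thesis by blast
qed

end

section \<open>Jordan-Hoelder sequences of cyclic modules\<close>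

context ab_left_module
begin

lemma in_cyclic [simp]: "x \<in> carrier E \<Longrightarrow> r \<odot> x \<in> cyclic x"
  by (simp add: cyclic_def)

lemma self_in_cyclic [simp]: "x \<in> carrier E \<Longrightarrow> x \<in> cyclic x"
  using in_cyclic[of x 1] by simp

lemma smult_eq_iff:
  assumes x: "x \<in> carrier E"
  shows "r \<odot> x = s \<odot> x \<longleftrightarrow> r - s \<in> ann x"
proof -
  have r: "r \<odot> x = (r - s) \<odot> x \<oplus> s \<odot> x" using x by (simp flip: add_smult)
  have "r \<odot> x = s \<odot> x \<longleftrightarrow> (r - s) \<odot> x = \<zero>"
    unfolding r using x by (intro M.add.r_cancel_one) simp_all
  then show ?thesis by (simp add: ann_def)
qed

lemma ann_smult_iff: "x \<in> carrier E \<Longrightarrow> r \<in> ann (s \<odot> x) \<longleftrightarrow> ab_mult r s \<in> ann x"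
  by (simp add: ann_def mult_smult)

text \<open>The coordinate of \<open>x\<close> has to be a unit: the multiples of a series without
  constant term have none either, and could not fill \<open>\<complex>[[X]]\<close>. The annihilator
  of this unit is generated by \<open>p = (a - \<mu> b) T\<close>, so the kernel on the cyclic
  module is generated by \<open>p x\<close>, and every scalar that kills \<open>x\<close> passes
  through \<open>p\<close>.\<close>

lemma layer_cyclic:
  assumes L: "layer E (cyclic x) F' \<mu> \<pi>" and x: "x \<in> carrier E"
  shows "\<exists>T. fps_nth T 0 \<noteq> 0 \<and>
    F' = cyclic (ab_mult (ab_lin \<mu>) (ab_of_fps T) \<odot> x) \<and>
    ann x = (\<lambda>q. ab_mult q (ab_mult (ab_lin \<mu>) (ab_of_fps T))) `
      ann (ab_mult (ab_lin \<mu>) (ab_of_fps T) \<odot> x)"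
proof -
  define U where "U = \<pi> x"
  have \<pi>: "\<pi> (r \<odot> x) = ab_act \<mu> r U" for r
    using L x by (simp add: layer_def U_def)
  have U0: "fps_nth U 0 \<noteq> 0"
  proof
    assume "fps_nth U 0 = 0"
    then have V: "U = fps_X * fps_shift 1 U"
      by (intro fps_ext) simp
    have "1 \<in> \<pi> ` cyclic x" using L by (simp add: layer_def)
    then obtain r where "1 = ab_act \<mu> r U" unfolding cyclic_def by (auto simp: \<pi>)
    moreover have "fps_nth (ab_act \<mu> r U) 0 = 0"
      by (subst V) (simp add: ab_act_X)
    ultimately have "fps_nth (1 :: complex fps) 0 = 0" by (simp only:)
    then show False by simp
  qed
  define p where "p = ab_mult (ab_lin \<mu>) (ab_of_fps (inverse U))"
  have ker: "\<pi> (r \<odot> x) = 0 \<longleftrightarrow> (\<exists>q. r = ab_mult q p)" for r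
    unfolding \<pi> p_def by (rule ab_act_unit_eq_0_iff[OF U0])
  have "F' = {u \<in> cyclic x. \<pi> u = 0}" using L by (simp add: layer_def)
  then have "F' = cyclic (p \<odot> x)"
    using ker x by (auto simp: cyclic_def simp flip: mult_smult)
  moreover have "ann x = (\<lambda>q. ab_mult q p) ` ann (p \<odot> x)"
  proof
    show "ann x \<subseteq> (\<lambda>q. ab_mult q p) ` ann (p \<odot> x)"
    proof
      fix r assume r: "r \<in> ann x"
      then have "\<pi> (r \<odot> x) = \<pi> \<zero>" by (simp add: ann_def)
      then obtain q where q: "r = ab_mult q p"
        using ker layer_zero[OF L submodule_cyclic[OF x]] by auto
      then have "q \<in> ann (p \<odot> x)" using r x by (simp add: ann_smult_iff)
      with q show "r \<in> (\<lambda>q. ab_mult q p) ` ann (p \<odot> x)" by blast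
    qed
    show "(\<lambda>q. ab_mult q p) ` ann (p \<odot> x) \<subseteq> ann x" using x by (auto simp: ann_smult_iff)
  qed
  moreover have "fps_nth (inverse U) 0 \<noteq> 0" using U0 by (simp add: fps_inverse_nth_0)
  ultimately show ?thesis unfolding p_def by blast
qed

lemma chain_ann:
  assumes "\<And>j. j \<in> {1..m} \<Longrightarrow> \<exists>\<pi>. layer E (F j) (F (j - 1)) (\<mu> j) \<pi>"
    and "F 0 = {\<zero>}" "x \<in> carrier E" "F m = cyclic x"
  shows "\<exists>S. (\<forall>j\<in>{1..m}. fps_nth (S j) 0 \<noteq> 0) \<and> ann x = left_ideal (jh_prod \<mu> S m)"
  using assms
proof (induction m arbitrary: x)
  case 0
  then have "x = \<zero>" using self_in_cyclic[of x] by simp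
  then show ?case by (simp add: ann_def)
next
  case (Suc m)
  obtain \<pi> where "layer E (F (Suc m)) (F m) (\<mu> (Suc m)) \<pi>"
    using Suc.prems(1)[of "Suc m"] by auto
  then have "layer E (cyclic x) (F m) (\<mu> (Suc m)) \<pi>" using Suc.prems(4) by simp
  from layer_cyclic[OF this Suc.prems(3)] obtain T where
    T: "fps_nth T 0 \<noteq> 0" "F m = cyclic (ab_mult (ab_lin (\<mu> (Suc m))) (ab_of_fps T) \<odot> x)"
      "ann x = (\<lambda>q. ab_mult q (ab_mult (ab_lin (\<mu> (Suc m))) (ab_of_fps T))) `
      ann (ab_mult (ab_lin (\<mu> (Suc m))) (ab_of_fps T) \<odot> x)" by blast
  define p where "p = ab_mult (ab_lin (\<mu> (Suc m))) (ab_of_fps T)"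
  have "\<exists>S. (\<forall>j\<in>{1..m}. fps_nth (S j) 0 \<noteq> 0) \<and>
      ann (p \<odot> x) = left_ideal (jh_prod \<mu> S m)"
    by (rule Suc.IH) (use Suc.prems T(2) in \<open>auto simp: p_def\<close>)
  then obtain S where S: "\<forall>j\<in>{1..m}. fps_nth (S j) 0 \<noteq> 0"
    "ann (p \<odot> x) = left_ideal (jh_prod \<mu> S m)" by blast
  define S' where "S' = S(Suc m := T)"
  have "jh_prod \<mu> S' m = jh_prod \<mu> S m"
    by (rule jh_prod_cong) (auto simp: S'_def)
  then have "jh_prod \<mu> S' (Suc m) = ab_mult (jh_prod \<mu> S m) p"
    by (simp add: p_def) (simp add: S'_def)
  then have "ann x = left_ideal (jh_prod \<mu> S' (Suc m))"
    using T(3) S(2) left_ideal_mult_iff[of _ "jh_prod \<mu> S m" p] unfolding p_def[symmetric] by auto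
  moreover have "\<forall>j\<in>{1..Suc m}. fps_nth (S' j) 0 \<noteq> 0"
    using S(1) T(1) by (auto simp: S'_def)
  ultimately show ?case by blast
qed

text \<open>The coordinate of \<open>r x\<close> is set to be \<open>r\<close> acting on
  \<open>U = inverse T\<close>. It is well defined because \<open>left_ideal p\<close> is the full
  annihilator of \<open>U\<close> and contains that of \<open>x\<close>.\<close>

lemma ann_layer:
  assumes x: "x \<in> carrier E" and T0: "fps_nth T 0 \<noteq> 0"
    and p: "p = ab_mult (ab_lin \<mu>) (ab_of_fps T)" and ann: "ann x \<subseteq> left_ideal p"
  shows "\<exists>\<pi>. layer E (cyclic x) (cyclic (p \<odot> x)) \<mu> \<pi>"
proof -
  define U where "U = inverse T"
  have U0: "fps_nth U 0 \<noteq> 0" using T0 by (simp add: U_def fps_inverse_nth_0)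
  have TU: "inverse U = T" unfolding U_def using T0 by (rule fps_inverse_idempotent)
  define \<pi> where "\<pi> u = ab_act \<mu> (SOME r. u = r \<odot> x) U" for u
  have ker: "ab_act \<mu> r U = 0 \<longleftrightarrow> (\<exists>q. r = ab_mult q p)" for r
    using ab_act_unit_eq_0_iff[OF U0, of \<mu> r] by (simp add: TU p)
  have \<pi>: "\<pi> (r \<odot> x) = ab_act \<mu> r U" for r
  proof -
    define s where "s = (SOME s. r \<odot> x = s \<odot> x)"
    have "r \<odot> x = s \<odot> x" unfolding s_def by (rule someI[of _ r]) simp
    then have "s - r \<in> ann x" using smult_eq_iff[OF x, of s r] by simp
    then have "ab_act \<mu> (s - r) U = 0"
      using ann ker[of "s - r"] by (auto simp: left_ideal_def)
    then show ?thesis by (simp add: \<pi>_def s_def ab_act_diff_left)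
  qed
  have "\<pi> ` cyclic x = UNIV"
  proof -
    have "f \<in> \<pi> ` cyclic x" for f
    proof -
      have "f = f * T * U" unfolding U_def using fps_unit_inverse[OF T0] by (simp add: mult.assoc)
      then have "f = \<pi> (ab_of_fps (f * T) \<odot> x)" unfolding \<pi> ab_act_of_fps .
      then show ?thesis using x by (metis imageI in_cyclic)
    qed
    then show ?thesis by auto
  qed
  moreover have "cyclic (p \<odot> x) = {u \<in> cyclic x. \<pi> u = 0}"
    using x ker by (auto simp: cyclic_def \<pi> simp flip: mult_smult)
  moreover have "\<pi> (u \<oplus> v) = \<pi> u + \<pi> v" if "u \<in> cyclic x" "v \<in> cyclic x" for u v
    using that x by (auto simp: cyclic_def \<pi> ab_act_add_left simp flip: add_smult)
  moreover have "\<pi> (r \<odot> u) = ab_act \<mu> r (\<pi> u)" if "u \<in> cyclic x" for r u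
    using that x by (auto simp: cyclic_def \<pi> ab_act_mult simp flip: mult_smult)
  ultimately have "layer E (cyclic x) (cyclic (p \<odot> x)) \<mu> \<pi>"
    unfolding layer_def by blast
  then show ?thesis by blast
qed

text \<open>The lower part of the chain lives in the cyclic module of \<open>p x\<close>, where
  \<open>p\<close> is the rightmost factor. Since \<open>p\<close> can be cancelled on the right,
  the annihilator of \<open>p x\<close> is the left ideal of the remaining product.\<close>

lemma ann_chain:
  assumes "\<And>j. j \<in> {1..m} \<Longrightarrow> fps_nth (S j) 0 \<noteq> 0" "x \<in> carrier E"
    and "ann x = left_ideal (jh_prod \<mu> S m)"
  shows "\<exists>F. F 0 = {\<zero>} \<and> F m = cyclic x \<and> (\<forall>j\<le>m. submodule (F j) ab_algebra E) \<and>
    (\<forall>j\<in>{1..m}. \<exists>\<pi>. layer E (F j) (F (j - 1)) (\<mu> j) \<pi>)"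
  using assms
proof (induction m arbitrary: x)
  case 0
  then have "1 \<in> ann x" by simp
  then have "x = \<zero>" using 0 by (simp add: ann_def)
  then have "cyclic x = {\<zero>}" by (auto simp: cyclic_def)
  then show ?case using submodule_cyclic[OF 0(2)] by (intro exI[of _ "\<lambda>_. cyclic x"]) simp
next
  case (Suc m)
  define T where "T = S (Suc m)"
  have T0: "fps_nth T 0 \<noteq> 0" using Suc.prems(1) by (simp add: T_def)
  define p where "p = ab_mult (ab_lin (\<mu> (Suc m))) (ab_of_fps T)"
  have annx: "ann x = left_ideal (ab_mult (jh_prod \<mu> S m) p)"
    using Suc.prems(3) by (simp add: p_def T_def)
  have cancel: "q = q'" if "ab_mult q p = ab_mult q' p" for q q'
  proof -
    have "ab_mult (ab_mult q (ab_lin (\<mu> (Suc m)))) (ab_of_fps T) =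
        ab_mult (ab_mult q' (ab_lin (\<mu> (Suc m)))) (ab_of_fps T)"
      using that by (simp add: p_def ab_mult_assoc)
    then have "ab_mult q (ab_lin (\<mu> (Suc m))) = ab_mult q' (ab_lin (\<mu> (Suc m)))"
      unfolding ab_mult_unit_eq_iff(1)[OF T0]
      by (simp add: ab_mult_assoc ab_of_fps_inverse[OF T0] ab_mult_1_right)
    then show ?thesis by (rule ab_mult_lin_cancel)
  qed
  have "q \<in> ann (p \<odot> x) \<longleftrightarrow> q \<in> left_ideal (jh_prod \<mu> S m)" for q
    using cancel by (auto simp: ann_smult_iff[OF Suc.prems(2)] annx left_ideal_mult_iff)
  then have "ann (p \<odot> x) = left_ideal (jh_prod \<mu> S m)" by blast
  with Suc obtain F where F: "F 0 = {\<zero>}" "F m = cyclic (p \<odot> x)"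
    "\<forall>j\<le>m. submodule (F j) ab_algebra E"
    "\<forall>j\<in>{1..m}. \<exists>\<pi>. layer E (F j) (F (j - 1)) (\<mu> j) \<pi>"
    by (metis atLeastAtMost_iff le_Suc_eq smult_in)
  have "ann x \<subseteq> left_ideal p" by (auto simp: annx left_ideal_mult_iff) (simp add: left_ideal_def)
  from ann_layer[OF Suc.prems(2) T0 p_def this]
  have top: "\<exists>\<pi>. layer E (cyclic x) (F m) (\<mu> (Suc m)) \<pi>" by (simp add: F(2))
  define F' where "F' = F(Suc m := cyclic x)"
  have "\<exists>\<pi>. layer E (F' j) (F' (j - 1)) (\<mu> j) \<pi>" if "j \<in> {1..Suc m}" for j
  proof (cases "j = Suc m")
    case True
    then show ?thesis using top by (simp add: F'_def)
  next
    case False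
    then have "j \<in> {1..m}" using that by auto
    then show ?thesis using F(4) by (auto simp: F'_def)
  qed
  moreover have "\<forall>j\<le>Suc m. submodule (F' j) ab_algebra E"
    using F(3) submodule_cyclic[OF Suc.prems(2)] by (simp add: F'_def)
  moreover have "F' 0 = {\<zero>}" "F' (Suc m) = cyclic x" using F(1) by (simp_all add: F'_def)
  ultimately show ?case by blast
qed

text \<open>On every layer \<open>b\<close> acts as multiplication by \<open>X\<close>, which is
  injective; descending from \<open>F m\<close> one layer at a time, \<open>u\<close> never leaves
  the chain before \<open>F j\<close>. This is what makes the steps of the chain normal.\<close>

lemma chain_torsion_free:
  fixes m :: nat
  assumes L: "\<And>j. j \<in> {1..m} \<Longrightarrow> \<exists>\<pi>. layer E (F j) (F (j - 1)) (\<mu> j) \<pi>"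
    and F: "\<And>j. j \<le> m \<Longrightarrow> submodule (F j) ab_algebra E"
    and j: "j \<le> m" and u: "u \<in> F m" "ab_b \<odot> u \<in> F j"
  shows "u \<in> F j"
  using j u(2)
proof (induction j rule: inc_induct)
  case base
  show ?case by (rule u(1))
next
  case (step n)
  obtain \<pi> where \<pi>: "layer E (F (Suc n)) (F n) (\<mu> (Suc n)) \<pi>"
    using L[of "Suc n"] step by auto
  have "F n \<subseteq> F (Suc n)" using \<pi> by (auto simp: layer_def)
  then have "u \<in> F (Suc n)" using step by blast
  moreover have "\<pi> (ab_b \<odot> u) = fps_X * \<pi> u" using \<pi> calculation by (simp add: layer_def)
  moreover have "\<pi> (ab_b \<odot> u) = 0" using \<pi> step by (simp add: layer_def)
  ultimately show ?case using \<pi> by (simp add: layer_def)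
qed

lemma chain_jordan_hoelder:
  assumes L: "\<And>j. j \<in> {1..m} \<Longrightarrow> \<exists>\<pi>. layer E (F j) (F (j - 1)) (\<mu> j) \<pi>"
    and F: "\<And>j. j \<le> m \<Longrightarrow> submodule (F j) ab_algebra E"
    and "F 0 = {\<zero>}" "F m = carrier E"
  shows "jordan_hoelder E m F"
    and "\<And>j. j \<in> {1..m} \<Longrightarrow> module_isomorphic ab_algebra (subquotient E (F j) (F (j - 1))) (E_mod (\<mu> j))"
proof -
  have coord: "\<exists>\<rho>. E_coord (\<mu> j) (subquotient E (F j) (F (j - 1))) \<rho>" "F (j - 1) \<subseteq> F j"
    if j: "j \<in> {1..m}" for j
  proof -
    obtain \<pi> where \<pi>: "layer E (F j) (F (j - 1)) (\<mu> j) \<pi>" using L[OF j] by blast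
    have "submodule (F j) ab_algebra E" using F j by simp
    from E_coord_subquotient[OF \<pi> this] layer_submodule(2)[OF \<pi> this]
    show "\<exists>\<rho>. E_coord (\<mu> j) (subquotient E (F j) (F (j - 1))) \<rho>" "F (j - 1) \<subseteq> F j" by blast+
  qed
  show "module_isomorphic ab_algebra (subquotient E (F j) (F (j - 1))) (E_mod (\<mu> j))"
    if j: "j \<in> {1..m}" for j
    using coord(1)[OF j] E_coord_isomorphic_E_mod by blast
  have normal: "normal_submodule E (F j)" if j: "j \<le> m" for j
  proof -
    note D = submoduleD[OF F[OF j]]
    have "F j \<inter> b_image E (carrier E) = b_image E (F j)"
    proof
      show "F j \<inter> b_image E (carrier E) \<subseteq> b_image E (F j)"
      proof
        fix v assume v: "v \<in> F j \<inter> b_image E (carrier E)"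
        then obtain u where u: "u \<in> carrier E" "v = ab_b \<odot> u" by (auto simp: b_image_def)
        have "u \<in> F j"
          by (rule chain_torsion_free[of m F \<mu>]) (use L F j u v assms(4) in auto)
        then show "v \<in> b_image E (F j)" using u by (auto simp: b_image_def)
      qed
      show "b_image E (F j) \<subseteq> F j \<inter> b_image E (carrier E)"
        using D(1,4) by (auto simp: b_image_def)
    qed
    then show ?thesis using F[OF j] by (simp add: normal_submodule_def)
  qed
  have rank: "ab_module_of_rank 1 (subquotient E (F j) (F (j - 1)))" if j: "j \<in> {1..m}" for j
    using coord(1)[OF j] E_coord_rank_1 by blast
  show "jordan_hoelder E m F"
    unfolding jordan_hoelder_def using assms(3,4) normal rank coord(2) by simp
qed

end

section \<open>Uniqueness of the rank\<close>

definition supp_in :: "(nat \<Rightarrow> complex fps) \<Rightarrow> nat set \<Rightarrow> bool"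
  where "supp_in c I \<longleftrightarrow> (\<forall>i. i \<notin> I \<longrightarrow> c i = 0)"

text \<open>Only the \<open>\<complex>[[b]]\<close>-structure is kept, and the maps need not be
  onto. Thus both a chain of layers and the coordinate flag of a basis are instances; each gives one
  of the two inequalities between length and rank.\<close>

definition fps_chain ::
  "(ab_series, 'e) module \<Rightarrow> nat \<Rightarrow> (nat \<Rightarrow> 'e set) \<Rightarrow> (nat \<Rightarrow> 'e \<Rightarrow> complex fps) \<Rightarrow> bool"
  where "fps_chain E m F \<pi> \<longleftrightarrow> F 0 = {\<zero>\<^bsub>E\<^esub>} \<and> (\<forall>j<m. F j = {x \<in> F (Suc j). \<pi> j x = 0} \<and>
    (\<forall>x\<in>F (Suc j). \<forall>y\<in>F (Suc j). \<pi> j (x \<oplus>\<^bsub>E\<^esub> y) = \<pi> j x + \<pi> j y) \<and>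
    (\<forall>r. \<forall>x\<in>F (Suc j). \<pi> j (ab_of_fps r \<odot>\<^bsub>E\<^esub> x) = r * \<pi> j x))"

text \<open>More unknowns than equations: \<open>\<Phi>\<close> is a linear map on vectors indexed
  by \<open>I\<close>, and each step of the chain imposes one equation over the domain
  \<open>\<complex>[[b]]\<close>. The induction eliminates one unknown together with one
  equation.\<close>

lemma fps_chain_kernel:
  assumes "fps_chain E m F \<pi>" "finite I" "m < card I"
    and "\<And>c. supp_in c I \<Longrightarrow> \<Phi> c \<in> F m"
    and "\<And>c d. supp_in c I \<Longrightarrow> supp_in d I \<Longrightarrow> \<Phi> (\<lambda>i. c i + d i) = \<Phi> c \<oplus>\<^bsub>E\<^esub> \<Phi> d"
    and "\<And>r c. supp_in c I \<Longrightarrow> \<Phi> (\<lambda>i. r * c i) = ab_of_fps r \<odot>\<^bsub>E\<^esub> \<Phi> c"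
  shows "\<exists>c. supp_in c I \<and> (\<exists>i. c i \<noteq> 0) \<and> \<Phi> c = \<zero>\<^bsub>E\<^esub>"
  using assms
proof (induction m arbitrary: I \<Phi>)
  case 0
  then obtain i where i: "i \<in> I" by (metis card.empty ex_in_conv less_irrefl)
  define c where "c l = (if l = i then 1 else 0 :: complex fps)" for l
  have c: "supp_in c I" "c i \<noteq> 0" using i by (auto simp: supp_in_def c_def)
  have "\<Phi> c = \<zero>\<^bsub>E\<^esub>" using 0(4)[OF c(1)] 0(1) by (simp add: fps_chain_def)
  then show ?case using c by blast
next
  case (Suc m)
  have chain: "fps_chain E m F \<pi>" using Suc.prems(1) by (simp add: fps_chain_def)
  have Fm: "F m = {x \<in> F (Suc m). \<pi> m x = 0}"
    and \<pi>add: "\<And>x y. x \<in> F (Suc m) \<Longrightarrow> y \<in> F (Suc m) \<Longrightarrow> \<pi> m (x \<oplus>\<^bsub>E\<^esub> y) = \<pi> m x + \<pi> m y"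
    and \<pi>smult: "\<And>r x. x \<in> F (Suc m) \<Longrightarrow> \<pi> m (ab_of_fps r \<odot>\<^bsub>E\<^esub> x) = r * \<pi> m x"
    using Suc.prems(1) unfolding fps_chain_def by blast+
  note \<Phi> = Suc.prems(4-6)
  show ?case
  proof (cases "\<forall>c. supp_in c I \<longrightarrow> \<Phi> c \<in> F m")
    case True
    show ?thesis
      by (rule Suc.IH[OF chain]) (use Suc.prems(2,3) \<Phi> True in auto)
  next
    case False
    then obtain c0 where c0: "supp_in c0 I" "\<Phi> c0 \<notin> F m" by blast
    define t where "t c = \<pi> m (\<Phi> c)" for c
    define g where "g = t c0"
    have g: "g \<noteq> 0" using c0 \<Phi>(1)[OF c0(1)] Fm by (auto simp: g_def t_def)
    have t_add: "t (\<lambda>i. c i + d i) = t c + t d" if "supp_in c I" "supp_in d I" for c d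
      using that \<Phi> \<pi>add by (simp add: t_def)
    have t_smult: "t (\<lambda>i. r * c i) = r * t c" if "supp_in c I" for r c
      using that \<Phi> \<pi>smult by (simp add: t_def)
    have "\<exists>p. c0 p \<noteq> 0"
    proof (rule ccontr)
      assume "\<nexists>p. c0 p \<noteq> 0"
      then have "c0 = (\<lambda>i. 0 * c0 i)" by auto
      then have "t c0 = 0 * t c0" using t_smult[OF c0(1), of 0] by metis
      then show False using g by (simp add: g_def)
    qed
    then obtain p where p: "c0 p \<noteq> 0" by blast
    have pI: "p \<in> I" using p c0(1) by (auto simp: supp_in_def)
    \<comment> \<open>Elimination without fractions: \<open>t c / g\<close> times the pivot
      \<open>c0\<close> is subtracted from \<open>c\<close> and the result multiplied by
      \<open>g\<close>, which need not be a unit.\<close>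
    define d where "d c = (\<lambda>i. g * c i + (- t c) * c0 i)" for c
    define I' where "I' = I - {p}"
    have sub: "supp_in c I" if "supp_in c I'" for c using that by (auto simp: supp_in_def I'_def)
    have d: "supp_in (d c) I" if "supp_in c I" for c
      using that c0(1) by (simp add: supp_in_def d_def)
    have scale: "supp_in (\<lambda>i. r * c i) I" if "supp_in c I" for r c
      using that by (simp add: supp_in_def)
    have td: "t (d c) = 0" if "supp_in c I" for c
    proof -
      have "t (d c) = t (\<lambda>i. g * c i) + t (\<lambda>i. (- t c) * c0 i)"
        unfolding d_def using that c0(1) by (intro t_add scale)
      also have "\<dots> = g * t c + (- t c) * g"
        using t_smult[OF that] t_smult[OF c0(1)] by (simp only: g_def)
      finally show ?thesis by (simp add: mult.commute)
    qed
    have "\<exists>c. supp_in c I' \<and> (\<exists>i. c i \<noteq> 0) \<and> \<Phi> (d c) = \<zero>\<^bsub>E\<^esub>"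
    proof (rule Suc.IH[OF chain])
      show "finite I'" using Suc.prems(2) by (simp add: I'_def)
      show "m < card I'" using Suc.prems(2,3) pI by (simp add: I'_def)
      show "\<Phi> (d c) \<in> F m" if "supp_in c I'" for c
        using \<Phi>(1)[OF d[OF sub[OF that]]] td[OF sub[OF that]] by (simp add: Fm t_def)
      show "\<Phi> (d (\<lambda>i. c i + c' i)) = \<Phi> (d c) \<oplus>\<^bsub>E\<^esub> \<Phi> (d c')"
        if "supp_in c I'" "supp_in c' I'" for c c'
      proof -
        have "d (\<lambda>i. c i + c' i) = (\<lambda>i. d c i + d c' i)"
          using t_add[OF sub[OF that(1)] sub[OF that(2)]] by (simp add: d_def algebra_simps)
        then show ?thesis using \<Phi>(2) d sub that by simp
      qed
      show "\<Phi> (d (\<lambda>i. r * c i)) = ab_of_fps r \<odot>\<^bsub>E\<^esub> \<Phi> (d c)" if "supp_in c I'" for r c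
      proof -
        have "d (\<lambda>i. r * c i) = (\<lambda>i. r * d c i)"
          using t_smult[OF sub[OF that]] by (simp add: d_def algebra_simps)
        then show ?thesis using \<Phi>(3) d sub that by simp
      qed
    qed
    then obtain c where c: "supp_in c I'" "\<exists>i. c i \<noteq> 0" "\<Phi> (d c) = \<zero>\<^bsub>E\<^esub>" by blast
    have "\<exists>i. d c i \<noteq> 0"
    proof (rule ccontr)
      assume "\<nexists>i. d c i \<noteq> 0"
      then have d0: "d c i = 0" for i by simp
      \<comment> \<open>At the index \<open>p\<close>, excluded from \<open>I'\<close>, only the
        multiple of \<open>c0\<close> is left. Hence \<open>t c = 0\<close>, and then
        \<open>g\<close> can be cancelled in the other entries.\<close>
      have "c p = 0" using c(1) by (simp add: supp_in_def I'_def)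
      then have "t c = 0" using d0[of p] p by (simp add: d_def)
      then have "c i = 0" for i using d0[of i] g by (simp add: d_def)
      then show False using c(2) by simp
    qed
    then show ?thesis using c d sub by blast
  qed
qed

section \<open>Coordinates in a basis, and the length of a chain\<close>

context ab_left_module
begin

primrec lincomb :: "(nat \<Rightarrow> 'e) \<Rightarrow> nat \<Rightarrow> (nat \<Rightarrow> complex fps) \<Rightarrow> 'e"
  where "lincomb e 0 c = \<zero>"
  | "lincomb e (Suc n) c = lincomb e n c \<oplus> ab_of_fps (c n) \<odot> e n"

lemma lincomb_closed: "(\<And>i. i < n \<Longrightarrow> e i \<in> carrier E) \<Longrightarrow> lincomb e n c \<in> carrier E"
  by (induction n) auto

lemma lincomb_add:
  assumes "\<And>i. i < n \<Longrightarrow> e i \<in> carrier E"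
  shows "lincomb e n (\<lambda>i. c i + d i) = lincomb e n c \<oplus> lincomb e n d"
  using assms
proof (induction n)
  case (Suc n)
  have cl: "lincomb e n c \<in> carrier E" "lincomb e n d \<in> carrier E" "e n \<in> carrier E"
    using Suc.prems by (auto intro: lincomb_closed)
  then show ?case using Suc by (simp add: ab_of_fps_add add_smult M.a_ac)
qed simp

lemma lincomb_smult:
  assumes "\<And>i. i < n \<Longrightarrow> e i \<in> carrier E"
  shows "lincomb e n (\<lambda>i. r * c i) = ab_of_fps r \<odot> lincomb e n c"
  using assms
proof (induction n)
  case (Suc n)
  have cl: "lincomb e n c \<in> carrier E" "e n \<in> carrier E"
    using Suc.prems by (auto intro: lincomb_closed)
  then show ?case using Suc by (simp add: ab_of_fps_mult mult_smult smult_add)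
qed simp

lemma lincomb_finsum:
  assumes "\<And>i. i < n \<Longrightarrow> e i \<in> carrier E"
  shows "(\<Oplus>\<^bsub>E\<^esub>i\<in>{..<n}. ab_of_fps (c i) \<odot> e i) = lincomb e n c"
  using assms
proof (induction n)
  case (Suc n)
  then have "(\<lambda>i. ab_of_fps (c i) \<odot> e i) \<in> {..<n} \<rightarrow> carrier E" by auto
  then show ?case
    using Suc lincomb_closed[of n e c] by (simp add: lessThan_Suc M.a_comm)
qed simp

lemma lincomb_cong: "(\<And>i. i < n \<Longrightarrow> c i = d i) \<Longrightarrow> lincomb e n c = lincomb e n d"
  by (induction n) auto

lemma lincomb_zero:
  assumes "\<And>i. i < n \<Longrightarrow> e i \<in> carrier E" "\<And>i. i < n \<Longrightarrow> c i = 0"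
  shows "lincomb e n c = \<zero>"
proof -
  have "lincomb e n c = lincomb e n (\<lambda>i. 0 * c i)"
    by (rule lincomb_cong) (use assms(2) in simp)
  also have "\<dots> = ab_of_fps 0 \<odot> lincomb e n c" by (rule lincomb_smult[OF assms(1)])
  also have "\<dots> = \<zero>" using lincomb_closed[OF assms(1)] by simp
  finally show ?thesis .
qed

lemma basis_coords:
  assumes "ab_basis E k e"
  obtains \<phi> where "\<And>i. i < k \<Longrightarrow> e i \<in> carrier E"
    and "\<And>x. x \<in> carrier E \<Longrightarrow> lincomb e k (\<phi> x) = x"
    and "\<And>c i. i < k \<Longrightarrow> \<phi> (lincomb e k c) i = c i"
    and "\<And>x y i. x \<in> carrier E \<Longrightarrow> y \<in> carrier E \<Longrightarrow> i < k \<Longrightarrow> \<phi> (x \<oplus> y) i = \<phi> x i + \<phi> y i"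
    and "\<And>r x i. x \<in> carrier E \<Longrightarrow> i < k \<Longrightarrow> \<phi> (ab_of_fps r \<odot> x) i = r * \<phi> x i"
proof -
  have e: "\<And>i. i < k \<Longrightarrow> e i \<in> carrier E" using assms by (auto simp: ab_basis_def)
  have ex1: "\<exists>!c. c \<in> {..<k} \<rightarrow>\<^sub>E UNIV \<and> x = lincomb e k c" if "x \<in> carrier E" for x
    using assms that unfolding ab_basis_def by (simp add: lincomb_finsum[OF e])
  define \<phi> where "\<phi> x = (THE c. c \<in> {..<k} \<rightarrow>\<^sub>E UNIV \<and> x = lincomb e k c)" for x
  have 1: "lincomb e k (\<phi> x) = x" if "x \<in> carrier E" for x
    using theI'[OF ex1[OF that]] by (simp add: \<phi>_def)
  have 2: "\<phi> (lincomb e k c) i = c i" if "i < k" for c i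
  proof -
    \<comment> \<open>Uniqueness in \<open>ab_basis\<close> concerns functions that are
      \<open>undefined\<close> from \<open>k\<close> on.\<close>
    have "lincomb e k c = lincomb e k (restrict c {..<k})" by (rule lincomb_cong) simp
    then have "\<phi> (lincomb e k c) = restrict c {..<k}"
      unfolding \<phi>_def using ex1[OF lincomb_closed[OF e]] by (intro the1_equality) auto
    then show ?thesis using that by simp
  qed
  have 3: "\<phi> (x \<oplus> y) i = \<phi> x i + \<phi> y i" if "x \<in> carrier E" "y \<in> carrier E" "i < k" for x y i
    using 2[OF that(3), of "\<lambda>i. \<phi> x i + \<phi> y i"] that by (simp add: lincomb_add e 1)
  have 4: "\<phi> (ab_of_fps r \<odot> x) i = r * \<phi> x i" if "x \<in> carrier E" "i < k" for r x i
    using 2[OF that(2), of "\<lambda>i. r * \<phi> x i"] that by (simp add: lincomb_smult e 1)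
  show thesis by (rule that[OF e 1 2 3 4])
qed

text \<open>If \<open>m < k\<close>, the basis vectors satisfy a relation forced by the chain
  \<open>F\<close>; if \<open>k < m\<close>, lifts of generators of the layers satisfy one forced by
  the flag of the basis. Neither family admits a nontrivial relation.\<close>

lemma chain_length_eq_rank:
  assumes basis: "ab_basis E k e"
    and L: "\<And>j. j \<in> {1..m} \<Longrightarrow> \<exists>\<pi>. layer E (F j) (F (j - 1)) (\<mu> j) \<pi>"
    and F: "\<And>j. j \<le> m \<Longrightarrow> submodule (F j) ab_algebra E"
    and F0: "F 0 = {\<zero>}" and Fm: "F m = carrier E"
  shows "m = k"
proof -
  obtain \<phi> where e: "\<And>i. i < k \<Longrightarrow> e i \<in> carrier E"
    and \<phi>1: "\<And>x. x \<in> carrier E \<Longrightarrow> lincomb e k (\<phi> x) = x"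
    and \<phi>2: "\<And>c i. i < k \<Longrightarrow> \<phi> (lincomb e k c) i = c i"
    and \<phi>3: "\<And>x y i. x \<in> carrier E \<Longrightarrow> y \<in> carrier E \<Longrightarrow> i < k \<Longrightarrow> \<phi> (x \<oplus> y) i = \<phi> x i + \<phi> y i"
    and \<phi>4: "\<And>r x i. x \<in> carrier E \<Longrightarrow> i < k \<Longrightarrow> \<phi> (ab_of_fps r \<odot> x) i = r * \<phi> x i"
    by (rule basis_coords[OF basis]) blast
  have "\<forall>j. \<exists>\<pi>. j < m \<longrightarrow> layer E (F (Suc j)) (F j) (\<mu> (Suc j)) \<pi>"
  proof
    fix j
    show "\<exists>\<pi>. j < m \<longrightarrow> layer E (F (Suc j)) (F j) (\<mu> (Suc j)) \<pi>"
      using L[of "Suc j"] by (cases "j < m") auto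
  qed
  then obtain \<pi> where \<pi>: "\<And>j. j < m \<Longrightarrow> layer E (F (Suc j)) (F j) (\<mu> (Suc j)) (\<pi> j)"
    by metis
  have "\<not> m < k"
  proof
    assume "m < k"
    have chain: "fps_chain E m F \<pi>"
      using \<pi> F0 by (auto simp: fps_chain_def layer_def)
    have "\<exists>c. supp_in c {..<k} \<and> (\<exists>i. c i \<noteq> 0) \<and> lincomb e k c = \<zero>"
      by (rule fps_chain_kernel[OF chain])
         (use \<open>m < k\<close> in \<open>simp_all add: Fm lincomb_closed lincomb_add lincomb_smult e\<close>)
    then obtain c i where c: "supp_in c {..<k}" "c i \<noteq> 0" "lincomb e k c = \<zero>" by blast
    then have "i < k" by (auto simp: supp_in_def)
    moreover have "lincomb e k (\<lambda>_. 0) = \<zero>" by (rule lincomb_zero) (use e in auto)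
    ultimately have "c i = 0" using \<phi>2[of i c] \<phi>2[of i "\<lambda>_. 0"] c(3) by simp
    then show False using c(2) by simp
  qed
  moreover have "\<not> k < m"
  proof
    assume "k < m"
    \<comment> \<open>The flag of elements whose coordinates from \<open>j\<close> on vanish, so
      that \<open>G k\<close> is everything.\<close>
    define G where "G j = {x \<in> carrier E. \<forall>i. j \<le> i \<and> i < k \<longrightarrow> \<phi> x i = 0}" for j
    have "G 0 = {\<zero>}"
    proof -
      have "x = \<zero>" if "x \<in> G 0" for x
        using that \<phi>1[of x] lincomb_zero[of k e "\<phi> x"] e by (simp add: G_def)
      moreover have "\<phi> \<zero> i = 0" if "i < k" for i
        using \<phi>4[of \<zero> i 0] that by simp
      ultimately show ?thesis by (auto simp: G_def)
    qed
    moreover have "G j = {x \<in> G (Suc j). \<phi> x j = 0}" if "j < k" for j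
      using that unfolding G_def Suc_le_eq by (auto dest: le_neq_implies_less)
    ultimately have chain: "fps_chain E k G (\<lambda>j x. \<phi> x j)"
      using \<phi>3 \<phi>4 by (auto simp: fps_chain_def) (auto simp: G_def)
    have "\<forall>j. \<exists>x. j < m \<longrightarrow> x \<in> F (Suc j) \<and> \<pi> j x = 1"
    proof
      fix j
      show "\<exists>x. j < m \<longrightarrow> x \<in> F (Suc j) \<and> \<pi> j x = 1"
      proof (cases "j < m")
        case True
        then have "1 \<in> \<pi> j ` F (Suc j)" using \<pi>[OF True] by (simp add: layer_def)
        then show ?thesis by (metis imageE)
      qed simp
    qed
    then obtain x where x: "\<And>j. j < m \<Longrightarrow> x j \<in> F (Suc j)" "\<And>j. j < m \<Longrightarrow> \<pi> j (x j) = 1"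
      by metis
    have xE: "x j \<in> carrier E" if "j < m" for j
      using x(1)[OF that] submoduleD(1)[OF F[of "Suc j"]] that by auto
    have Gk: "G k = carrier E" by (auto simp: G_def)
    have "\<exists>c. supp_in c {..<m} \<and> (\<exists>i. c i \<noteq> 0) \<and> lincomb x m c = \<zero>"
      by (rule fps_chain_kernel[OF chain])
         (use \<open>k < m\<close> in \<open>simp_all add: Gk lincomb_closed lincomb_add lincomb_smult xE\<close>)
    then obtain c i where c: "supp_in c {..<m}" "c i \<noteq> 0" "lincomb x m c = \<zero>" by blast
    have in_F: "lincomb x n c \<in> F n" if "n \<le> m" for n
      using that
    proof (induction n)
      case 0
      then show ?case by (simp add: F0)
    next
      case (Suc n)
      then have "lincomb x n c \<in> F (Suc n)" using \<pi>[of n] by (simp add: layer_def)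
      then show ?case
        using Suc.prems x(1)[of n] submoduleD(3,4)[OF F[OF Suc.prems]] by simp
    qed
    \<comment> \<open>The last coefficient is read off first: \<open>\<pi> n\<close> kills the
      preceding partial sum, which lies in \<open>F n\<close>, and equals 1 at
      \<open>x n\<close>.\<close>
    have "n \<le> m \<Longrightarrow> lincomb x n c = \<zero> \<Longrightarrow> \<forall>i<n. c i = 0" for n
    proof (induction n)
      case (Suc n)
      define y where "y = lincomb x n c"
      have n: "n < m" using Suc.prems by simp
      note D = submoduleD[OF F[OF Suc.prems(1)]]
      have y: "y \<in> F n" "y \<in> F (Suc n)" "\<pi> n y = 0"
        using in_F[of n] \<pi>[OF n] n by (auto simp: layer_def y_def)
      have "ab_of_fps (c n) \<odot> x n \<in> F (Suc n)" using D(4) x(1)[OF n] by simp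
      then have "\<pi> n (y \<oplus> ab_of_fps (c n) \<odot> x n) = \<pi> n y + c n * \<pi> n (x n)"
        using \<pi>[OF n] y x(1)[OF n] by (simp add: layer_def)
      moreover have "\<pi> n \<zero> = 0" by (rule layer_zero[OF \<pi>[OF n] F[OF Suc.prems(1)]])
      ultimately have "c n = 0" using Suc.prems(2) y x(2)[OF n] by (simp add: y_def)
      moreover from this have "lincomb x n c = \<zero>"
        using Suc.prems(2) xE[OF n] y(2) D(1) by (auto simp: y_def)
      ultimately show ?case using Suc.IH n by (auto simp: less_Suc_eq)
    qed simp
    then have "\<forall>i<m. c i = 0" using c(3) by blast
    then show False using c(1,2) by (auto simp: supp_in_def)
  qed
  ultimately show ?thesis by simp
qed

end

section \<open>Semi-simple modules in coordinates\<close>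

lemma module_hom_zero:
  assumes "ab_left_module M" "ab_left_module N" "h \<in> module_hom ab_algebra M N"
  shows "h \<zero>\<^bsub>M\<^esub> = \<zero>\<^bsub>N\<^esub>"
proof -
  interpret M: ab_left_module M by fact
  interpret N: ab_left_module N by fact
  have "h (0 \<odot>\<^bsub>M\<^esub> \<zero>\<^bsub>M\<^esub>) = 0 \<odot>\<^bsub>N\<^esub> h \<zero>\<^bsub>M\<^esub>"
    using assms(3) M.zero_closed unfolding module_hom_def ab_algebra_simps by blast
  moreover have "h \<zero>\<^bsub>M\<^esub> \<in> carrier N" using assms(3) by (auto simp: module_hom_def)
  ultimately show ?thesis by simp
qed

lemma left_module_direct_sum:
  fixes M :: "nat \<Rightarrow> (ab_series, 'e) module"
  assumes M: "\<And>i. i < n \<Longrightarrow> left_module ab_algebra (M i)"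
  shows "left_module ab_algebra (direct_sum_module n M)"
proof -
  have comp: "x i \<in> carrier (M i)" if "x \<in> carrier (direct_sum_module n M)" "i < n" for x i
    using that PiE_mem[of x "{..<n}" "\<lambda>i. carrier (M i)" i] by (simp add: direct_sum_module_def)
  have undef: "x i = undefined" if "x \<in> carrier (direct_sum_module n M)" "\<not> i < n" for x i
    using that PiE_arb[of x "{..<n}" "\<lambda>i. carrier (M i)" i] by (simp add: direct_sum_module_def)
  have ab: "abelian_group (M i)" if "i < n" for i
    using M[OF that] by (simp add: left_module_def)
  have am: "abelian_monoid (M i)" if "i < n" for i
    using ab[OF that] by (simp add: abelian_group_def)
  have "abelian_group (direct_sum_module n M)"
  proof (rule abelian_groupI)
    fix x y z
    assume x: "x \<in> carrier (direct_sum_module n M)" and y: "y \<in> carrier (direct_sum_module n M)"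
      and z: "z \<in> carrier (direct_sum_module n M)"
    have mem: "x i \<in> carrier (M i)" "y i \<in> carrier (M i)" "z i \<in> carrier (M i)" if "i < n" for i
      using comp that x y z by blast+
    show "x \<oplus>\<^bsub>direct_sum_module n M\<^esub> y \<in> carrier (direct_sum_module n M)"
      using mem by (auto simp: direct_sum_module_def intro: abelian_monoid.a_closed[OF am])
    show "x \<oplus>\<^bsub>direct_sum_module n M\<^esub> y \<oplus>\<^bsub>direct_sum_module n M\<^esub> z =
      x \<oplus>\<^bsub>direct_sum_module n M\<^esub> (y \<oplus>\<^bsub>direct_sum_module n M\<^esub> z)"
      by (simp add: direct_sum_module_def restrict_def fun_eq_iff mem abelian_monoid.a_assoc[OF am])
    show "x \<oplus>\<^bsub>direct_sum_module n M\<^esub> y = y \<oplus>\<^bsub>direct_sum_module n M\<^esub> x"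
    proof -
      have "x i \<oplus>\<^bsub>M i\<^esub> y i = y i \<oplus>\<^bsub>M i\<^esub> x i" if "i < n" for i
        by (rule abelian_monoid.a_comm[OF am]) (use that mem in auto)
      then show ?thesis by (simp add: direct_sum_module_def restrict_def fun_eq_iff)
    qed
    show "\<zero>\<^bsub>direct_sum_module n M\<^esub> \<oplus>\<^bsub>direct_sum_module n M\<^esub> x = x"
      using undef[OF x]
      by (simp add: direct_sum_module_def restrict_def fun_eq_iff mem abelian_monoid.l_zero[OF am])
    show "\<exists>u\<in>carrier (direct_sum_module n M).
      u \<oplus>\<^bsub>direct_sum_module n M\<^esub> x = \<zero>\<^bsub>direct_sum_module n M\<^esub>"
    proof
      show "(\<lambda>i\<in>{..<n}. \<ominus>\<^bsub>M i\<^esub> x i) \<in> carrier (direct_sum_module n M)"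
        by (simp add: direct_sum_module_def mem abelian_group.a_inv_closed[OF ab])
      show "(\<lambda>i\<in>{..<n}. \<ominus>\<^bsub>M i\<^esub> x i) \<oplus>\<^bsub>direct_sum_module n M\<^esub> x = \<zero>\<^bsub>direct_sum_module n M\<^esub>"
        by (simp add: direct_sum_module_def restrict_def fun_eq_iff mem abelian_group.l_neg[OF ab])
    qed
  qed (auto simp: direct_sum_module_def intro: abelian_monoid.zero_closed[OF am])
  moreover have "left_module_axioms ab_algebra (direct_sum_module n M)"
  proof (rule left_module_axioms.intro)
    fix r s x y
    assume x: "x \<in> carrier (direct_sum_module n M)"
    have mem: "x i \<in> carrier (M i)" if "i < n" for i
      using comp that x by blast
    have alm: "ab_left_module (M i)" if "i < n" for i
      using M[OF that] by (simp add: ab_left_module_def)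
    show "r \<odot>\<^bsub>direct_sum_module n M\<^esub> x \<in> carrier (direct_sum_module n M)"
      using mem by (auto simp: direct_sum_module_def intro: ab_left_module.smult_in[OF alm])
    show "(r \<oplus>\<^bsub>ab_algebra\<^esub> s) \<odot>\<^bsub>direct_sum_module n M\<^esub> x =
      r \<odot>\<^bsub>direct_sum_module n M\<^esub> x \<oplus>\<^bsub>direct_sum_module n M\<^esub> s \<odot>\<^bsub>direct_sum_module n M\<^esub> x"
      by (simp add: direct_sum_module_def restrict_def fun_eq_iff mem ab_left_module.add_smult[OF alm])
    show "(r \<otimes>\<^bsub>ab_algebra\<^esub> s) \<odot>\<^bsub>direct_sum_module n M\<^esub> x =
      r \<odot>\<^bsub>direct_sum_module n M\<^esub> (s \<odot>\<^bsub>direct_sum_module n M\<^esub> x)"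
      by (simp add: direct_sum_module_def restrict_def fun_eq_iff mem ab_left_module.mult_smult[OF alm])
    show "\<one>\<^bsub>ab_algebra\<^esub> \<odot>\<^bsub>direct_sum_module n M\<^esub> x = x"
      using undef[OF x]
      by (simp add: direct_sum_module_def restrict_def fun_eq_iff mem ab_left_module.one_smult[OF alm])
    assume y: "y \<in> carrier (direct_sum_module n M)"
    have mem': "y i \<in> carrier (M i)" if "i < n" for i
      using comp that y by blast
    show "r \<odot>\<^bsub>direct_sum_module n M\<^esub> (x \<oplus>\<^bsub>direct_sum_module n M\<^esub> y) =
      r \<odot>\<^bsub>direct_sum_module n M\<^esub> x \<oplus>\<^bsub>direct_sum_module n M\<^esub> r \<odot>\<^bsub>direct_sum_module n M\<^esub> y"
      by (simp add: direct_sum_module_def restrict_def fun_eq_iff mem mem'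
          ab_left_module.smult_add[OF alm])
  qed
  ultimately show ?thesis by (intro left_module.intro ring_ab_algebra)
qed

text \<open>Both sides are the algebra modulo the common annihilator of the two generators.\<close>

lemma cyclic_isomorphic:
  assumes "ab_left_module E" "ab_left_module D" and x: "x \<in> carrier E" and y: "y \<in> carrier D"
    and E: "carrier E = ab_left_module.cyclic E x"
    and ann: "ab_left_module.ann E x = ab_left_module.ann D y"
  shows "module_isomorphic ab_algebra E (D\<lparr>carrier := ab_left_module.cyclic D y\<rparr>)"
proof -
  interpret E: ab_left_module E by fact
  interpret D: ab_left_module D by fact
  define h where "h u = (SOME r. u = r \<odot>\<^bsub>E\<^esub> x) \<odot>\<^bsub>D\<^esub> y" for u
  have h: "h (r \<odot>\<^bsub>E\<^esub> x) = r \<odot>\<^bsub>D\<^esub> y" for r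
  proof -
    define s where "s = (SOME s. r \<odot>\<^bsub>E\<^esub> x = s \<odot>\<^bsub>E\<^esub> x)"
    have "r \<odot>\<^bsub>E\<^esub> x = s \<odot>\<^bsub>E\<^esub> x" unfolding s_def by (rule someI[of _ r]) simp
    then have "r \<odot>\<^bsub>D\<^esub> y = s \<odot>\<^bsub>D\<^esub> y"
      using E.smult_eq_iff[OF x] D.smult_eq_iff[OF y] ann by simp
    then show ?thesis by (simp add: h_def s_def)
  qed
  have Eo: "\<exists>r. u = r \<odot>\<^bsub>E\<^esub> x" if "u \<in> carrier E" for u
    using that unfolding E E.cyclic_def by blast
  have "bij_betw h (carrier E) (D.cyclic y)"
    unfolding bij_betw_def
  proof
    show "inj_on h (carrier E)"
    proof (rule inj_onI)
      fix u v assume "u \<in> carrier E" "v \<in> carrier E" and huv: "h u = h v"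
      then obtain r s where rs: "u = r \<odot>\<^bsub>E\<^esub> x" "v = s \<odot>\<^bsub>E\<^esub> x" using Eo by blast
      then show "u = v"
        using huv E.smult_eq_iff[OF x] D.smult_eq_iff[OF y] ann by (simp add: h)
    qed
    show "h ` carrier E = D.cyclic y"
      unfolding E E.cyclic_def D.cyclic_def image_image h ..
  qed
  moreover have "h \<in> module_hom ab_algebra E (D\<lparr>carrier := D.cyclic y\<rparr>)"
  proof -
    have "h (u \<oplus>\<^bsub>E\<^esub> v) = h u \<oplus>\<^bsub>D\<^esub> h v" if uv: "u \<in> carrier E" "v \<in> carrier E" for u v
    proof -
      obtain r s where rs: "u = r \<odot>\<^bsub>E\<^esub> x" "v = s \<odot>\<^bsub>E\<^esub> x" using Eo uv by blast
      have "h (u \<oplus>\<^bsub>E\<^esub> v) = h ((r + s) \<odot>\<^bsub>E\<^esub> x)" using x by (simp add: rs E.add_smult)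
      then show ?thesis using y by (simp add: h rs D.add_smult)
    qed
    moreover have "h (r \<odot>\<^bsub>E\<^esub> u) = r \<odot>\<^bsub>D\<^esub> h u" if u: "u \<in> carrier E" for r u
    proof -
      obtain s where s: "u = s \<odot>\<^bsub>E\<^esub> x" using Eo u by blast
      have "h (r \<odot>\<^bsub>E\<^esub> u) = h (ab_mult r s \<odot>\<^bsub>E\<^esub> x)" using x by (simp add: s E.mult_smult)
      then show ?thesis using y by (simp add: h s D.mult_smult)
    qed
    moreover have "h u \<in> D.cyclic y" if u: "u \<in> carrier E" for u
      using Eo[OF u] h y by auto
    ultimately show ?thesis by (simp add: module_hom_def)
  qed
  ultimately show ?thesis unfolding module_isomorphic_def by auto
qed

text \<open>The module \<open>E\<^sub>\<nu>\<close> on the type over which \<^const>\<open>semi_simple\<close> quantifies.\<close>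

definition E_std :: "complex \<Rightarrow> std_module"
  where "E_std \<nu> = \<lparr>carrier = {g. \<forall>i>0. g i = 0}, monoid.mult = undefined, one = undefined,
    zero = (\<lambda>_. 0), add = (\<lambda>g h i. g i + h i),
    module.smult = (\<lambda>r g i. if i = 0 then ab_act \<nu> r (g 0) else 0)\<rparr>"

lemma E_coord_E_std: "E_coord \<nu> (E_std \<nu>) (\<lambda>g. g 0)"
proof -
  have "abelian_group (E_std \<nu>)"
  proof (rule abelian_groupI)
    fix x assume "x \<in> carrier (E_std \<nu>)"
    then show "\<exists>y\<in>carrier (E_std \<nu>). y \<oplus>\<^bsub>E_std \<nu>\<^esub> x = \<zero>\<^bsub>E_std \<nu>\<^esub>"
      by (intro bexI[of _ "\<lambda>i. - x i"]) (auto simp: E_std_def)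
  qed (auto simp: E_std_def add_ac)
  then have "left_module ab_algebra (E_std \<nu>)"
    by (intro left_module.intro left_module_axioms.intro ring_ab_algebra)
       (auto simp: E_std_def ab_act_add_left ab_act_add_right ab_act_mult fun_eq_iff)
  moreover have "bij_betw (\<lambda>g. g 0) (carrier (E_std \<nu>)) UNIV"
  proof (rule bij_betw_byWitness[where f' = "\<lambda>f i. if i = 0 then f else 0"])
    show "\<forall>g\<in>carrier (E_std \<nu>). (\<lambda>i. if i = 0 then g 0 else 0) = g"
      by (auto simp: E_std_def fun_eq_iff)
  qed (auto simp: E_std_def)
  ultimately show ?thesis unfolding E_coord_def by (auto simp: E_std_def)
qed

text \<open>The operator \<open>X^2 d/dX + \<nu> X\<close> is divisible by \<open>X\<close>, so the
  module has a simple pole and embeds in itself.\<close>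

lemma regular_E_std: "regular (E_std \<nu>)"
proof -
  have ab: "ab_module (E_std \<nu>)"
    using E_coord_rank_1[OF E_coord_E_std] unfolding ab_module_def by blast
  have "simple_pole (E_std \<nu>)"
    unfolding simple_pole_def
  proof
    show "a_image (E_std \<nu>) (carrier (E_std \<nu>)) \<subseteq> b_image (E_std \<nu>) (carrier (E_std \<nu>))"
    proof
      fix h assume "h \<in> a_image (E_std \<nu>) (carrier (E_std \<nu>))"
      then obtain g where g: "g \<in> carrier (E_std \<nu>)" "h = ab_a \<odot>\<^bsub>E_std \<nu>\<^esub> g"
        by (auto simp: a_image_def)
      define g' where "g' i = (if i = 0 then fps_X * fps_deriv (g 0) + fps_const \<nu> * g 0 else 0)"
        for i :: nat
      have "g' \<in> carrier (E_std \<nu>)" by (simp add: g'_def E_std_def)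
      moreover have "h = ab_b \<odot>\<^bsub>E_std \<nu>\<^esub> g'"
        by (simp add: g(2) E_std_def g'_def fun_eq_iff power2_eq_square algebra_simps)
      ultimately show "h \<in> b_image (E_std \<nu>) (carrier (E_std \<nu>))" by (auto simp: b_image_def)
    qed
  qed (rule ab)
  moreover have "embeds_via (E_std \<nu>) (E_std \<nu>) id"
    by (auto simp: embeds_via_def module_hom_def)
  ultimately show ?thesis using ab unfolding regular_def by blast
qed

lemma semi_simple_if_ann:
  assumes "ab_left_module E" and E: "regular E" and x: "x \<in> carrier E"
    and cyc: "carrier E = ab_left_module.cyclic E x"
    and ann: "ab_left_module.ann E x = coord_ann \<nu> f {..<n}"
  shows "semi_simple E"
proof -
  define M where "M i = E_std (\<nu> i)" for i
  have M: "left_module ab_algebra (M i)" for i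
    using E_coord_E_std[of "\<nu> i"] by (simp add: M_def E_coord_def)
  define D where "D = direct_sum_module n M"
  interpret D: ab_left_module D
    unfolding ab_left_module_def D_def by (rule left_module_direct_sum[OF M])
  define y where "y = (\<lambda>i\<in>{..<n}. \<lambda>j::nat. if j = 0 then f i else 0)"
  have y: "y \<in> carrier D" by (auto simp: y_def D_def direct_sum_module_def M_def E_std_def)
  have "r \<in> D.ann y \<longleftrightarrow> r \<in> coord_ann \<nu> f {..<n}" for r
  proof -
    have "r \<odot>\<^bsub>D\<^esub> y = (\<lambda>i\<in>{..<n}. \<lambda>j::nat. if j = 0 then ab_act (\<nu> i) r (f i) else 0)"
      by (auto simp: D_def direct_sum_module_def M_def E_std_def y_def fun_eq_iff)
    moreover have "\<zero>\<^bsub>D\<^esub> = (\<lambda>i\<in>{..<n}. \<lambda>j::nat. 0)"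
      by (auto simp: D_def direct_sum_module_def M_def E_std_def)
    ultimately show ?thesis
      by (auto simp: D.ann_def coord_ann_def fun_eq_iff)
  qed
  then have "ab_left_module.ann E x = D.ann y" using ann by blast
  then have "module_isomorphic ab_algebra E (D\<lparr>carrier := D.cyclic y\<rparr>)"
    by (rule cyclic_isomorphic[OF assms(1) D.ab_left_module_axioms x y cyc])
  moreover have "submodule (D.cyclic y) ab_algebra D" by (rule D.submodule_cyclic[OF y])
  moreover have "\<forall>i<n. regular (M i) \<and> ab_module_of_rank 1 (M i)"
    using regular_E_std E_coord_rank_1[OF E_coord_E_std] by (simp add: M_def)
  ultimately show ?thesis using E unfolding semi_simple_def D_def by blast
qed

section \<open>Regular modules of rank one\<close>

lemma X2_deriv_X_power:
  "fps_X\<^sup>2 * fps_deriv (fps_X ^ n) = fps_X ^ Suc n * fps_const (of_nat n :: complex)"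
proof (rule fps_ext)
  fix k
  show "fps_nth (fps_X\<^sup>2 * fps_deriv (fps_X ^ n)) k =
    fps_nth (fps_X ^ Suc n * fps_const (of_nat n :: complex)) k"
  proof (cases k)
    case 0
    then show ?thesis by (simp add: power2_eq_square)
  next
    case (Suc l)
    show ?thesis unfolding Suc fps_nth_X2_deriv by (simp add: fps_X_power_nth)
  qed
qed

lemma smult_smult_fps:
  assumes "ab_left_module G" "t \<in> carrier G"
  shows "ab_of_fps f \<odot>\<^bsub>G\<^esub> (ab_of_fps g \<odot>\<^bsub>G\<^esub> t) = ab_of_fps (f * g) \<odot>\<^bsub>G\<^esub> t"
proof -
  interpret G: ab_left_module G by fact
  show ?thesis using assms(2) by (simp add: ab_of_fps_mult G.mult_smult)
qed

text \<open>In a simple pole module \<open>a\<close> maps \<open>b^n G\<close> into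
  \<open>b^(n+1) G\<close>. As \<open>w\<close> is a unit times \<open>a w\<close>, it lies in every
  \<open>b^n G\<close>, and the coordinates of such an element are divisible by all powers of
  \<open>X\<close>.\<close>

lemma simple_pole_unit_eigenvector:
  assumes G: "simple_pole G" and w: "w \<in> carrier G"
    and eig: "ab_a \<odot>\<^bsub>G\<^esub> w = ab_of_fps g \<odot>\<^bsub>G\<^esub> w" and g0: "fps_nth g 0 \<noteq> 0"
  shows "w = \<zero>\<^bsub>G\<^esub>"
proof -
  obtain k e where basis: "ab_basis G k e" and lm: "left_module ab_algebra G"
    using G unfolding simple_pole_def ab_module_def ab_module_of_rank_def by blast
  interpret G: ab_left_module G unfolding ab_left_module_def by (rule lm)
  note ssf = smult_smult_fps[OF G.ab_left_module_axioms]
  have div: "\<exists>t\<in>carrier G. w = ab_of_fps (fps_X ^ n) \<odot>\<^bsub>G\<^esub> t" for n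
  proof (induction n)
    case 0
    then show ?case using w by (intro bexI[of _ w]) simp_all
  next
    case (Suc n)
    then obtain t where t: "t \<in> carrier G" "w = ab_of_fps (fps_X ^ n) \<odot>\<^bsub>G\<^esub> t" by blast
    have "ab_a \<odot>\<^bsub>G\<^esub> t \<in> b_image G (carrier G)"
      using G t(1) by (auto simp: simple_pole_def a_image_def)
    then obtain s where s: "s \<in> carrier G" "ab_a \<odot>\<^bsub>G\<^esub> t = ab_of_fps fps_X \<odot>\<^bsub>G\<^esub> s"
      by (auto simp: b_image_def ab_b_eq)
    \<comment> \<open>Found from \<open>a b^n t = b^n a t + n b^(n+1) t\<close>, in which
      \<open>a t = b s\<close>.\<close>
    define u where "u = s \<oplus>\<^bsub>G\<^esub> ab_of_fps (fps_const (of_nat n)) \<odot>\<^bsub>G\<^esub> t"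
    have u: "u \<in> carrier G" using s t by (simp add: u_def)
    have "ab_a \<odot>\<^bsub>G\<^esub> w = ab_of_fps (fps_X ^ n) \<odot>\<^bsub>G\<^esub> (ab_a \<odot>\<^bsub>G\<^esub> t) \<oplus>\<^bsub>G\<^esub>
        ab_of_fps (fps_X\<^sup>2 * fps_deriv (fps_X ^ n)) \<odot>\<^bsub>G\<^esub> t"
      using t(1) unfolding t(2) by (simp only: ab_a_of_fps G.add_smult flip: G.mult_smult)
    also have "\<dots> = ab_of_fps (fps_X ^ Suc n) \<odot>\<^bsub>G\<^esub> s \<oplus>\<^bsub>G\<^esub>
        ab_of_fps (fps_X ^ Suc n) \<odot>\<^bsub>G\<^esub> (ab_of_fps (fps_const (of_nat n)) \<odot>\<^bsub>G\<^esub> t)"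
      unfolding s(2) ssf[OF s(1)] ssf[OF t(1)] X2_deriv_X_power power_Suc2 ..
    also have "\<dots> = ab_of_fps (fps_X ^ Suc n) \<odot>\<^bsub>G\<^esub> u"
      using s(1) t(1) by (simp only: u_def G.smult_add G.smult_in)
    finally have gw: "ab_of_fps g \<odot>\<^bsub>G\<^esub> w = ab_of_fps (fps_X ^ Suc n) \<odot>\<^bsub>G\<^esub> u"
      unfolding eig .
    have "w = ab_of_fps (inverse g * g) \<odot>\<^bsub>G\<^esub> w"
      unfolding fps_unit_inverse[OF g0] using w by simp
    also have "\<dots> = ab_of_fps (inverse g) \<odot>\<^bsub>G\<^esub> (ab_of_fps (fps_X ^ Suc n) \<odot>\<^bsub>G\<^esub> u)"
      unfolding ssf[OF w, symmetric] gw ..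
    also have "\<dots> = ab_of_fps (fps_X ^ Suc n) \<odot>\<^bsub>G\<^esub> (ab_of_fps (inverse g) \<odot>\<^bsub>G\<^esub> u)"
      unfolding ssf[OF u] by (simp only: mult.commute)
    finally show ?case using u by blast
  qed
  obtain \<phi> where e: "\<And>i. i < k \<Longrightarrow> e i \<in> carrier G"
    and \<phi>1: "\<And>x. x \<in> carrier G \<Longrightarrow> G.lincomb e k (\<phi> x) = x"
    and \<phi>4: "\<And>r x i. x \<in> carrier G \<Longrightarrow> i < k \<Longrightarrow> \<phi> (ab_of_fps r \<odot>\<^bsub>G\<^esub> x) i = r * \<phi> x i"
    by (rule G.basis_coords[OF basis]) blast
  have "\<phi> w i = 0" if i: "i < k" for i
  proof (rule fps_ext)
    fix n
    obtain t where "t \<in> carrier G" "w = ab_of_fps (fps_X ^ Suc n) \<odot>\<^bsub>G\<^esub> t" using div by blast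
    then have "\<phi> w i = fps_X ^ Suc n * \<phi> t i" using \<phi>4 i by simp
    then show "fps_nth (\<phi> w i) n = fps_nth 0 n"
      by (simp only: fps_X_power_mult_nth) simp
  qed
  then have "G.lincomb e k (\<phi> w) = \<zero>\<^bsub>G\<^esub>" by (intro G.lincomb_zero e)
  then show ?thesis using \<phi>1[OF w] by simp
qed

text \<open>The solution is the exponential of the primitive of \<open>w\<close> without constant
  term; its constant coefficient is 1.\<close>

lemma exists_unit_ODE:
  fixes w :: "complex fps"
  shows "\<exists>v. fps_nth v 0 \<noteq> 0 \<and> fps_deriv v = w * v"
proof -
  define u where "u = fps_integral w 0"
  define v where "v = fps_exp 1 oo u"
  have u0: "fps_nth u 0 = 0" by (simp add: u_def fps_integral_def)
  have "fps_deriv v = (fps_deriv (fps_exp 1) oo u) * fps_deriv u"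
    unfolding v_def by (rule fps_compose_deriv[OF u0])
  then have "fps_deriv v = w * v"
    by (simp add: u_def v_def fps_deriv_fps_integral mult.commute)
  moreover have "fps_nth v 0 \<noteq> 0" by (simp add: v_def)
  ultimately show ?thesis by blast
qed

text \<open>For a basis vector \<open>a e = g(b) e\<close>. Regularity forces \<open>g\<close> to
  have no constant term, since a unit \<open>g\<close> would make the image of \<open>e\<close> in a
  simple pole module vanish. Writing \<open>g = X h\<close>, a change of generator by a unit removes
  all of \<open>h\<close> but its constant coefficient \<open>\<nu>\<close>.\<close>

lemma regular_rank_1_coord:
  assumes reg: "regular M" and rank: "ab_module_of_rank 1 M"
  shows "\<exists>\<nu> \<theta>. \<forall>u\<in>carrier M. (\<theta> u = 0 \<longleftrightarrow> u = \<zero>\<^bsub>M\<^esub>) \<and>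
    (\<forall>r. \<theta> (r \<odot>\<^bsub>M\<^esub> u) = ab_act \<nu> r (\<theta> u))"
proof -
  obtain e where basis: "ab_basis M 1 e" and lm: "left_module ab_algebra M"
    using rank unfolding ab_module_of_rank_def by blast
  interpret M: ab_left_module M unfolding ab_left_module_def by (rule lm)
  note ssf = smult_smult_fps[OF M.ab_left_module_axioms]
  obtain \<phi> where e: "e 0 \<in> carrier M"
    and \<phi>1: "\<And>x. x \<in> carrier M \<Longrightarrow> M.lincomb e 1 (\<phi> x) = x"
    and \<phi>2: "\<And>c. \<phi> (M.lincomb e 1 c) 0 = c 0"
    by (rule M.basis_coords[OF basis]) (use zero_less_one in blast)
  define \<kappa> where "\<kappa> x = \<phi> x 0" for x
  have \<kappa>1: "x = ab_of_fps (\<kappa> x) \<odot>\<^bsub>M\<^esub> e 0" if "x \<in> carrier M" for x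
    using \<phi>1[OF that] e by (simp add: \<kappa>_def)
  have \<kappa>2: "\<kappa> (ab_of_fps c \<odot>\<^bsub>M\<^esub> e 0) = c" for c
    using \<phi>2[of "\<lambda>_. c"] e by (simp add: \<kappa>_def)
  define g where "g = \<kappa> (ab_a \<odot>\<^bsub>M\<^esub> e 0)"
  have a_e: "ab_a \<odot>\<^bsub>M\<^esub> e 0 = ab_of_fps g \<odot>\<^bsub>M\<^esub> e 0"
    unfolding g_def by (rule \<kappa>1) (use e in simp)
  have "fps_nth g 0 = 0"
  proof (rule ccontr)
    assume g0: "fps_nth g 0 \<noteq> 0"
    obtain G :: std_module and f where G: "simple_pole G" and f: "embeds_via M G f"
      using reg unfolding regular_def by blast
    have "left_module ab_algebra G"
      using G unfolding simple_pole_def ab_module_def ab_module_of_rank_def by blast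
    then interpret G: ab_left_module G unfolding ab_left_module_def .
    have hom: "f \<in> module_hom ab_algebra M G" and inj: "inj_on f (carrier M)"
      using f by (simp_all add: embeds_via_def)
    have fs: "f (r \<odot>\<^bsub>M\<^esub> x) = r \<odot>\<^bsub>G\<^esub> f x" "f x \<in> carrier G" if "x \<in> carrier M" for r x
      using hom that by (auto simp: module_hom_def)
    have "f (e 0) = \<zero>\<^bsub>G\<^esub>"
    proof (rule simple_pole_unit_eigenvector[OF G fs(2)[OF e] _ g0])
      show "ab_a \<odot>\<^bsub>G\<^esub> f (e 0) = ab_of_fps g \<odot>\<^bsub>G\<^esub> f (e 0)"
        using a_e fs(1)[OF e] by metis
    qed
    then have "e 0 = \<zero>\<^bsub>M\<^esub>"
      using module_hom_zero[OF M.ab_left_module_axioms G.ab_left_module_axioms hom]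
        inj_onD[OF inj _ e, of "\<zero>\<^bsub>M\<^esub>"] by simp
    then show False using \<kappa>2[of 1] \<kappa>2[of 0] by simp
  qed
  then have "g = fps_X * fps_shift 1 g" by (intro fps_ext) simp
  then obtain h where g: "g = fps_X * h" ..
  define \<nu> where "\<nu> = fps_nth h 0"
  \<comment> \<open>For \<open>e' = v e\<close> the coefficient of \<open>a e'\<close> is
    \<open>X v (h + X v'/v)\<close>. It becomes \<open>\<nu> X v\<close> exactly if the logarithmic
    derivative of \<open>v\<close> is \<open>(\<nu> - h) / X\<close>.\<close>
  define w where "w = fps_shift 1 (fps_const \<nu> - h)"
  have w: "fps_X * w = fps_const \<nu> - h"
    by (rule fps_ext) (simp add: w_def \<nu>_def)
  obtain v where v: "fps_nth v 0 \<noteq> 0" "fps_deriv v = w * v" using exists_unit_ODE by blast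
  define e' where "e' = ab_of_fps v \<odot>\<^bsub>M\<^esub> e 0"
  have e': "e' \<in> carrier M" using e by (simp add: e'_def)
  have "ab_a \<odot>\<^bsub>M\<^esub> e' = ab_of_fps v \<odot>\<^bsub>M\<^esub> (ab_a \<odot>\<^bsub>M\<^esub> e 0) \<oplus>\<^bsub>M\<^esub>
      ab_of_fps (fps_X\<^sup>2 * fps_deriv v) \<odot>\<^bsub>M\<^esub> e 0"
    using e unfolding e'_def by (simp only: ab_a_of_fps M.add_smult flip: M.mult_smult)
  also have "\<dots> = ab_of_fps (v * g + fps_X\<^sup>2 * fps_deriv v) \<odot>\<^bsub>M\<^esub> e 0"
    using e unfolding a_e ssf[OF e] by (simp only: ab_of_fps_add M.add_smult)
  also have "v * g + fps_X\<^sup>2 * fps_deriv v = fps_X * v * (h + fps_X * w)"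
    unfolding v(2) g power2_eq_square by (simp only: algebra_simps)
  also have "\<dots> = fps_const \<nu> * fps_X * v"
    unfolding w by (simp add: mult_ac)
  also have "ab_of_fps (fps_const \<nu> * fps_X * v) \<odot>\<^bsub>M\<^esub> e 0 =
      ab_of_fps (fps_const \<nu> * fps_X) \<odot>\<^bsub>M\<^esub> e'"
    unfolding e'_def ssf[OF e] ..
  finally have a_e': "ab_a \<odot>\<^bsub>M\<^esub> e' = ab_of_fps (fps_const \<nu> * fps_X) \<odot>\<^bsub>M\<^esub> e'" .
  have lin: "ab_lin \<nu> \<odot>\<^bsub>M\<^esub> e' = \<zero>\<^bsub>M\<^esub>"
    using a_e' e' M.smult_eq_iff[OF e', of ab_a] by (simp add: ab_lin_def ab_const_mult_b M.ann_def)
  define \<theta> where "\<theta> u = \<kappa> u * inverse v" for u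
  have \<theta>1: "u = ab_of_fps (\<theta> u) \<odot>\<^bsub>M\<^esub> e'" if "u \<in> carrier M" for u
    using \<kappa>1[OF that] fps_unit_inverse[OF v(1)]
    by (simp add: e'_def \<theta>_def ssf[OF e] mult.assoc)
  have \<theta>2: "\<theta> (ab_of_fps c \<odot>\<^bsub>M\<^esub> e') = c" for c
    unfolding e'_def ssf[OF e] \<theta>_def \<kappa>2 using fps_unit_inverse[OF v(1)] by (simp add: mult.assoc)
  have "\<theta> (r \<odot>\<^bsub>M\<^esub> u) = ab_act \<nu> r (\<theta> u)" if u: "u \<in> carrier M" for r u
  proof -
    obtain q where q: "ab_mult r (ab_of_fps (\<theta> u)) =
        ab_mult q (ab_lin \<nu>) + ab_of_fps (ab_act \<nu> r (\<theta> u))"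
      by (rule ab_act_decomp)
    have "r \<odot>\<^bsub>M\<^esub> u = ab_mult r (ab_of_fps (\<theta> u)) \<odot>\<^bsub>M\<^esub> e'"
      using \<theta>1[OF u] e' by (simp only: M.mult_smult)
    also have "\<dots> = ab_of_fps (ab_act \<nu> r (\<theta> u)) \<odot>\<^bsub>M\<^esub> e'"
      unfolding q using e' by (simp add: M.add_smult M.mult_smult lin)
    finally show ?thesis by (simp only: \<theta>2)
  qed
  moreover have "\<theta> u = 0 \<longleftrightarrow> u = \<zero>\<^bsub>M\<^esub>" if "u \<in> carrier M" for u
  proof
    show "u = \<zero>\<^bsub>M\<^esub>" if "\<theta> u = 0" using \<theta>1[OF \<open>u \<in> carrier M\<close>] that e' by simp
    show "\<theta> u = 0" if "u = \<zero>\<^bsub>M\<^esub>" using \<theta>2[of 0] that e' by simp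
  qed
  ultimately show ?thesis by blast
qed

text \<open>Both the embedding in the sum and the coordinates \<open>\<theta>\<close> detect zero,
  so whether a scalar kills \<open>x\<close> is decided component by component.\<close>

lemma semi_simple_imp_ann:
  assumes "ab_left_module E" "semi_simple E" and x: "x \<in> carrier E"
  shows "\<exists>n \<nu> f. ab_left_module.ann E x = coord_ann \<nu> f {..<n}"
proof -
  interpret E: ab_left_module E by fact
  obtain n and M :: "nat \<Rightarrow> std_module" and H where
    M: "\<forall>i<n. regular (M i) \<and> ab_module_of_rank 1 (M i)"
    and H: "submodule H ab_algebra (direct_sum_module n M)"
    and iso: "module_isomorphic ab_algebra E ((direct_sum_module n M)\<lparr>carrier := H\<rparr>)"
    using assms(2) unfolding semi_simple_def by blast
  have lm: "left_module ab_algebra (M i)" if "i < n" for i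
    using M that by (auto simp: ab_module_of_rank_def)
  define D where "D = direct_sum_module n M"
  interpret D: ab_left_module D
    unfolding ab_left_module_def D_def by (rule left_module_direct_sum[OF lm])
  obtain h where hom: "h \<in> module_hom ab_algebra E (D\<lparr>carrier := H\<rparr>)"
    and inj: "inj_on h (carrier E)"
    using iso unfolding module_isomorphic_def D_def bij_betw_def by blast
  have "\<forall>i. \<exists>\<nu> \<theta>. i < n \<longrightarrow> (\<forall>u\<in>carrier (M i). (\<theta> u = 0 \<longleftrightarrow> u = \<zero>\<^bsub>M i\<^esub>) \<and>
    (\<forall>r. \<theta> (r \<odot>\<^bsub>M i\<^esub> u) = ab_act \<nu> r (\<theta> u)))"
    using regular_rank_1_coord M by blast
  then obtain \<nu> \<theta> where \<theta>: "\<And>i u. i < n \<Longrightarrow> u \<in> carrier (M i) \<Longrightarrow>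
    (\<theta> i u = 0 \<longleftrightarrow> u = \<zero>\<^bsub>M i\<^esub>) \<and> (\<forall>r. \<theta> i (r \<odot>\<^bsub>M i\<^esub> u) = ab_act (\<nu> i) r (\<theta> i u))"
    by metis
  define y where "y = h x"
  have hH: "h u \<in> H" if "u \<in> carrier E" for u using hom that by (auto simp: module_hom_def)
  have HD: "H \<subseteq> carrier D" using D.submoduleD(1) H by (simp add: D_def)
  have yi: "y i \<in> carrier (M i)" if "i < n" for i
    using hH[OF x] HD that by (auto simp: y_def D_def direct_sum_module_def)
  have hs: "h (r \<odot>\<^bsub>E\<^esub> x) = r \<odot>\<^bsub>D\<^esub> y" for r
    using hom x by (auto simp: module_hom_def y_def)
  have "r \<in> E.ann x \<longleftrightarrow> r \<in> coord_ann \<nu> (\<lambda>i. \<theta> i (y i)) {..<n}" for r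
  proof -
    have "r \<odot>\<^bsub>E\<^esub> x = 0 \<odot>\<^bsub>E\<^esub> x \<longleftrightarrow> h (r \<odot>\<^bsub>E\<^esub> x) = h (0 \<odot>\<^bsub>E\<^esub> x)"
      using inj x by (auto dest: inj_onD)
    also have "\<dots> \<longleftrightarrow> r \<odot>\<^bsub>D\<^esub> y = \<zero>\<^bsub>D\<^esub>"
      unfolding hs using hH[OF x] HD by (auto simp: y_def)
    also have "\<dots> \<longleftrightarrow> (\<forall>i<n. r \<odot>\<^bsub>M i\<^esub> y i = \<zero>\<^bsub>M i\<^esub>)"
      by (auto simp: D_def direct_sum_module_def fun_eq_iff)
    also have "\<dots> \<longleftrightarrow> (\<forall>i<n. ab_act (\<nu> i) r (\<theta> i (y i)) = 0)"
    proof -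
      have "r \<odot>\<^bsub>M i\<^esub> y i = \<zero>\<^bsub>M i\<^esub> \<longleftrightarrow> ab_act (\<nu> i) r (\<theta> i (y i)) = 0" if i: "i < n" for i
      proof -
        have "r \<odot>\<^bsub>M i\<^esub> y i \<in> carrier (M i)"
          using lm[OF i] yi[OF i] by (intro left_module.smult_closed) auto
        then show ?thesis using \<theta>[OF i] yi[OF i] by metis
      qed
      then show ?thesis by simp
    qed
    finally show ?thesis using x by (simp add: E.ann_def coord_ann_def Ball_def)
  qed
  then show ?thesis by blast
qed

section \<open>The exponents of a geometric module are real\<close>

text \<open>\<open>bpow_coeff_unique\<close> read backwards: \<open>T\<close> lists the coefficients
  of \<open>r b\<close>, and the recursion itself dictates the series \<open>s\<close> with
  \<open>b s = r b\<close>. It makes \<open>b S\<close> stable under all scalars.\<close>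

lemma mult_b_swap: "\<exists>s. ab_mult r ab_b = ab_mult ab_b s"
proof -
  define T where "T N = (case N of 0 \<Rightarrow> 0 | Suc M \<Rightarrow> fps_nth r M)" for N
  define s where "s = Abs_fps (\<lambda>N. fps_nth r N + pderiv (T N))"
  have "T = bpow_coeff 1 (fps_nth s)"
    by (rule bpow_coeff_unique) (simp_all add: T_def s_def)
  moreover have "fps_nth (ab_mult ab_b s) N = bpow_coeff 1 (fps_nth s) N" for N
  proof -
    have "fps_nth (ab_mult ab_b s) N =
        (\<Sum>m\<le>Suc N. if m = 1 then bpow_coeff 1 (fps_nth s) N else 0)"
      by (subst fps_nth_ab_mult[of _ "Suc N"], simp, rule sum.cong) (auto simp: ab_b_def)
    then show ?thesis by simp
  qed
  moreover have "fps_nth (ab_mult r ab_b) N = T N" for N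
  proof -
    have "ab_mult r ab_b = r * ab_b" by (simp only: ab_b_eq ab_mult_of_fps_right)
    then show ?thesis by (cases N) (simp_all add: T_def, simp_all add: ab_b_def)
  qed
  ultimately have "ab_mult r ab_b = ab_mult ab_b s" by (intro fps_ext) simp
  then show ?thesis ..
qed

lemma ab_act_uminus_1: "ab_act \<nu> (- 1) f = - f"
  using ab_act_diff_left[of \<nu> 0 1 f] by simp

lemma a_inv_ab_algebra_one: "\<ominus>\<^bsub>ab_algebra\<^esub> 1 = - 1"
proof -
  interpret ring ab_algebra by (rule ring_ab_algebra)
  show ?thesis using minus_equality[of "- 1" 1] by simp
qed

section \<open>Extending a coordinate to the saturation\<close>

lemma fps_nth_X_deriv: "fps_nth (fps_X * fps_deriv f) n = of_nat n * fps_nth f n"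
  for f :: "complex fps"
  by (cases n) simp_all

text \<open>\<open>\<psi>\<close> is a linear map from \<open>E\<close> to
  \<open>E\<^sub>\<nu>\<close>, and \<open>f\<close> places \<open>E\<close> in a simple pole
  module. The aim is to relate \<open>\<nu>\<close> to the action of \<open>- b^(-1) a\<close> on
  the saturation.\<close>

locale pole_extension = E: ab_left_module E + G: ab_left_module G
  for E :: "(ab_series, 'e) module" and G :: "(ab_series, 'g) module" +
  fixes f :: "'e \<Rightarrow> 'g" and \<psi> :: "'e \<Rightarrow> complex fps" and \<nu> :: complex
  assumes hom: "f \<in> module_hom ab_algebra E G" and inj: "inj_on f (carrier E)"
    and \<psi>_add: "\<And>u v. u \<in> carrier E \<Longrightarrow> v \<in> carrier E \<Longrightarrow> \<psi> (u \<oplus>\<^bsub>E\<^esub> v) = \<psi> u + \<psi> v"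
    and \<psi>_smult: "\<And>r u. u \<in> carrier E \<Longrightarrow> \<psi> (r \<odot>\<^bsub>E\<^esub> u) = ab_act \<nu> r (\<psi> u)"
    and b_inj: "\<And>s t. s \<in> carrier G \<Longrightarrow> t \<in> carrier G \<Longrightarrow> ab_b \<odot>\<^bsub>G\<^esub> s = ab_b \<odot>\<^bsub>G\<^esub> t \<Longrightarrow> s = t"
    and pole: "a_image G (carrier G) \<subseteq> b_image G (carrier G)"
begin

lemma f_closed: "u \<in> carrier E \<Longrightarrow> f u \<in> carrier G"
  and f_add: "u \<in> carrier E \<Longrightarrow> v \<in> carrier E \<Longrightarrow> f (u \<oplus>\<^bsub>E\<^esub> v) = f u \<oplus>\<^bsub>G\<^esub> f v"
  and f_smult: "u \<in> carrier E \<Longrightarrow> f (r \<odot>\<^bsub>E\<^esub> u) = r \<odot>\<^bsub>G\<^esub> f u"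
  using hom by (auto simp: module_hom_def)

text \<open>The extension of \<open>\<psi>\<close> to the elements \<open>s\<close> of \<open>G\<close> with \<open>b\<^sup>N s \<in> E\<close> for some \<open>N\<close>, as long
  as the value \<open>g\<close> has no pole.\<close>

definition ext :: "'g \<Rightarrow> complex fps \<Rightarrow> bool"
  where "ext s g \<longleftrightarrow> (\<exists>N. \<exists>u\<in>carrier E.
    ab_of_fps (fps_X ^ N) \<odot>\<^bsub>G\<^esub> s = f u \<and> \<psi> u = fps_X ^ N * g)"

lemma ext_raise:
  assumes "s \<in> carrier G" "u \<in> carrier E"
    and "ab_of_fps (fps_X ^ N) \<odot>\<^bsub>G\<^esub> s = f u" "\<psi> u = fps_X ^ N * g"
  shows "ab_of_fps (fps_X ^ (M + N)) \<odot>\<^bsub>G\<^esub> s = f (ab_of_fps (fps_X ^ M) \<odot>\<^bsub>E\<^esub> u)"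
    and "\<psi> (ab_of_fps (fps_X ^ M) \<odot>\<^bsub>E\<^esub> u) = fps_X ^ (M + N) * g"
proof -
  show "ab_of_fps (fps_X ^ (M + N)) \<odot>\<^bsub>G\<^esub> s = f (ab_of_fps (fps_X ^ M) \<odot>\<^bsub>E\<^esub> u)"
    using assms(1,2) by (simp only: power_add ab_of_fps_mult G.mult_smult assms(3) f_smult)
  show "\<psi> (ab_of_fps (fps_X ^ M) \<odot>\<^bsub>E\<^esub> u) = fps_X ^ (M + N) * g"
    using assms(2) by (simp only: \<psi>_smult ab_act_of_fps assms(4) power_add mult.assoc)
qed

lemma ext_f: "u \<in> carrier E \<Longrightarrow> ext (f u) (\<psi> u)"
  unfolding ext_def by (intro exI[of _ 0] bexI[of _ u]) (simp_all add: f_closed)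

lemma ext_add:
  assumes "s \<in> carrier G" "s' \<in> carrier G" "ext s g" "ext s' g'"
  shows "ext (s \<oplus>\<^bsub>G\<^esub> s') (g + g')"
proof -
  obtain N u where u: "u \<in> carrier E" "ab_of_fps (fps_X ^ N) \<odot>\<^bsub>G\<^esub> s = f u" "\<psi> u = fps_X ^ N * g"
    using assms(3) by (auto simp: ext_def)
  obtain M v where v: "v \<in> carrier E" "ab_of_fps (fps_X ^ M) \<odot>\<^bsub>G\<^esub> s' = f v" "\<psi> v = fps_X ^ M * g'"
    using assms(4) by (auto simp: ext_def)
  define u' where "u' = ab_of_fps (fps_X ^ M) \<odot>\<^bsub>E\<^esub> u"
  define v' where "v' = ab_of_fps (fps_X ^ N) \<odot>\<^bsub>E\<^esub> v"
  have u': "u' \<in> carrier E" "ab_of_fps (fps_X ^ (M + N)) \<odot>\<^bsub>G\<^esub> s = f u'"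
      "\<psi> u' = fps_X ^ (M + N) * g"
    using ext_raise[OF assms(1) u] u(1) by (simp_all add: u'_def)
  have v': "v' \<in> carrier E" "ab_of_fps (fps_X ^ (M + N)) \<odot>\<^bsub>G\<^esub> s' = f v'"
      "\<psi> v' = fps_X ^ (M + N) * g'"
    using ext_raise[OF assms(2) v, of N] v(1) by (simp_all add: v'_def add.commute[of N])
  have "ab_of_fps (fps_X ^ (M + N)) \<odot>\<^bsub>G\<^esub> (s \<oplus>\<^bsub>G\<^esub> s') = f (u' \<oplus>\<^bsub>E\<^esub> v')"
    using assms(1,2) u'(1) v'(1) by (simp only: G.smult_add u'(2) v'(2) f_add)
  moreover have "\<psi> (u' \<oplus>\<^bsub>E\<^esub> v') = fps_X ^ (M + N) * (g + g')"
    using u'(1) v'(1) by (simp only: \<psi>_add u'(3) v'(3) distrib_left)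
  moreover have "u' \<oplus>\<^bsub>E\<^esub> v' \<in> carrier E" using u'(1) v'(1) by simp
  ultimately show ?thesis unfolding ext_def by blast
qed

lemma ext_smult:
  assumes "s \<in> carrier G" "ext s g"
  shows "ext (r \<odot>\<^bsub>G\<^esub> s) (ab_act \<nu> r g)"
proof -
  obtain N u where u: "u \<in> carrier E" "ab_of_fps (fps_X ^ N) \<odot>\<^bsub>G\<^esub> s = f u" "\<psi> u = fps_X ^ N * g"
    using assms(2) by (auto simp: ext_def)
  obtain r' where r': "ab_mult (ab_of_fps (fps_X ^ N)) r = ab_mult r' (ab_of_fps (fps_X ^ N))"
    using b_power_mult_swap by blast
  have "ab_of_fps (fps_X ^ N) \<odot>\<^bsub>G\<^esub> (r \<odot>\<^bsub>G\<^esub> s) = r' \<odot>\<^bsub>G\<^esub> (ab_of_fps (fps_X ^ N) \<odot>\<^bsub>G\<^esub> s)"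
    using assms(1) r' by (simp flip: G.mult_smult)
  also have "\<dots> = f (r' \<odot>\<^bsub>E\<^esub> u)" using u by (simp add: f_smult)
  finally have 1: "ab_of_fps (fps_X ^ N) \<odot>\<^bsub>G\<^esub> (r \<odot>\<^bsub>G\<^esub> s) = f (r' \<odot>\<^bsub>E\<^esub> u)" .
  have "\<psi> (r' \<odot>\<^bsub>E\<^esub> u) = ab_act \<nu> r' (ab_act \<nu> (ab_of_fps (fps_X ^ N)) g)"
    using u(1) by (simp only: \<psi>_smult u(3) ab_act_of_fps)
  also have "\<dots> = ab_act \<nu> (ab_of_fps (fps_X ^ N)) (ab_act \<nu> r g)"
    by (simp only: r' flip: ab_act_mult)
  finally have "\<psi> (r' \<odot>\<^bsub>E\<^esub> u) = fps_X ^ N * ab_act \<nu> r g" by (simp only: ab_act_of_fps)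
  moreover have "r' \<odot>\<^bsub>E\<^esub> u \<in> carrier E" using u(1) by simp
  ultimately show ?thesis using 1 unfolding ext_def by blast
qed

text \<open>After passing to a common denominator \<open>b^(M+N)\<close> both values come from the
  same element of \<open>E\<close>, and powers of \<open>X\<close> can be cancelled.\<close>

lemma ext_unique:
  assumes s: "s \<in> carrier G" and "ext s g" "ext s h"
  shows "g = h"
proof -
  obtain N u where u: "u \<in> carrier E" "ab_of_fps (fps_X ^ N) \<odot>\<^bsub>G\<^esub> s = f u" "\<psi> u = fps_X ^ N * g"
    using assms(2) by (auto simp: ext_def)
  obtain M v where v: "v \<in> carrier E" "ab_of_fps (fps_X ^ M) \<odot>\<^bsub>G\<^esub> s = f v" "\<psi> v = fps_X ^ M * h"
    using assms(3) by (auto simp: ext_def)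
  have "f (ab_of_fps (fps_X ^ M) \<odot>\<^bsub>E\<^esub> u) = f (ab_of_fps (fps_X ^ N) \<odot>\<^bsub>E\<^esub> v)"
    using ext_raise(1)[OF s u, of M] ext_raise(1)[OF s v, of N] by (simp only: add.commute[of N])
  then have "ab_of_fps (fps_X ^ M) \<odot>\<^bsub>E\<^esub> u = ab_of_fps (fps_X ^ N) \<odot>\<^bsub>E\<^esub> v"
    using u(1) v(1) by (intro inj_onD[OF inj]) simp_all
  then have "fps_X ^ (M + N) * g = fps_X ^ (M + N) * h"
    using ext_raise(2)[OF s u, of M] ext_raise(2)[OF s v, of N] by (simp only: add.commute[of N])
  then show ?thesis by (simp only: mult_left_cancel[OF power_not_zero[OF fps_X_neq_zero]])
qed

lemma ext_divide_b:
  assumes t: "t \<in> carrier G" and "ext (ab_b \<odot>\<^bsub>G\<^esub> t) (fps_X * g)"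
  shows "ext t g"
proof -
  obtain N u where u: "u \<in> carrier E" "ab_of_fps (fps_X ^ N) \<odot>\<^bsub>G\<^esub> (ab_b \<odot>\<^bsub>G\<^esub> t) = f u"
      "\<psi> u = fps_X ^ N * (fps_X * g)"
    using assms(2) by (auto simp: ext_def)
  have "ab_of_fps (fps_X ^ Suc N) \<odot>\<^bsub>G\<^esub> t = f u"
    using t unfolding u(2)[symmetric]
    by (simp only: power_Suc2 ab_of_fps_mult ab_b_eq G.mult_smult)
  moreover have "\<psi> u = fps_X ^ Suc N * g" unfolding u(3) by (simp only: power_Suc2 mult.assoc)
  ultimately show ?thesis using u(1) unfolding ext_def by blast
qed

text \<open>On \<open>E\<^sub>\<nu>\<close> the operator \<open>b^(-1) a\<close> is
  \<open>X d/dX + \<nu>\<close>. It preserves power series, so the extended value acquires no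
  pole.\<close>

lemma ext_binv_a:
  assumes "s \<in> carrier G" "t \<in> carrier G" "ab_b \<odot>\<^bsub>G\<^esub> t = ab_a \<odot>\<^bsub>G\<^esub> s" "ext s g"
  shows "ext t (fps_X * fps_deriv g + fps_const \<nu> * g)"
proof (rule ext_divide_b[OF assms(2)])
  have "ab_act \<nu> ab_a g = fps_X * (fps_X * fps_deriv g + fps_const \<nu> * g)"
    unfolding ab_act_a power2_eq_square by (simp only: algebra_simps)
  then show "ext (ab_b \<odot>\<^bsub>G\<^esub> t) (fps_X * (fps_X * fps_deriv g + fps_const \<nu> * g))"
    using ext_smult[OF assms(1,4), of ab_a] assms(3) by simp
qed

lemma binv_a_exists:
  assumes "a_image G S \<subseteq> b_image G S" "s \<in> S"
  obtains t where "t \<in> S" "ab_b \<odot>\<^bsub>G\<^esub> t = ab_a \<odot>\<^bsub>G\<^esub> s"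
proof -
  have "ab_a \<odot>\<^bsub>G\<^esub> s \<in> b_image G S" using assms by (auto simp: a_image_def)
  then obtain t where "t \<in> S" "ab_a \<odot>\<^bsub>G\<^esub> s = ab_b \<odot>\<^bsub>G\<^esub> t" by (auto simp: b_image_def)
  then show thesis using that by simp
qed

text \<open>The domain of \<^const>\<open>ext\<close> is itself stable by \<open>b\<^sup>-\<^sup>1 a\<close>, so it contains the saturation.\<close>

lemma saturation_submodule: "submodule (saturation G (f ` carrier E)) ab_algebra G"
  and saturation_pole: "a_image G (saturation G (f ` carrier E)) \<subseteq> b_image G (saturation G (f ` carrier E))"
  and f_in_saturation: "u \<in> carrier E \<Longrightarrow> f u \<in> saturation G (f ` carrier E)"
  and saturation_ext: "s \<in> saturation G (f ` carrier E) \<Longrightarrow> \<exists>g. ext s g"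
proof -
  define C where "C = {S. submodule S ab_algebra G \<and> f ` carrier E \<subseteq> S \<and> a_image G S \<subseteq> b_image G S}"
  have sat: "saturation G (f ` carrier E) = \<Inter>C" by (simp add: saturation_def C_def)
  have CD: "S \<subseteq> carrier G" "\<zero>\<^bsub>G\<^esub> \<in> S" "x \<in> S \<Longrightarrow> y \<in> S \<Longrightarrow> x \<oplus>\<^bsub>G\<^esub> y \<in> S"
      "x \<in> S \<Longrightarrow> r \<odot>\<^bsub>G\<^esub> x \<in> S" if "S \<in> C" for S x y r
  proof -
    have S: "submodule S ab_algebra G" using that by (simp add: C_def)
    show "S \<subseteq> carrier G" "\<zero>\<^bsub>G\<^esub> \<in> S" by (rule G.submoduleD(1,2)[OF S])+
    show "x \<oplus>\<^bsub>G\<^esub> y \<in> S" if "x \<in> S" "y \<in> S" by (rule G.submoduleD(3)[OF S that])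
    show "r \<odot>\<^bsub>G\<^esub> x \<in> S" if "x \<in> S" by (rule G.submoduleD(4)[OF S _ that]) simp
  qed
  have carC: "carrier G \<in> C"
  proof -
    have "submodule (carrier G) ab_algebra G" by (rule G.submodule_intro) auto
    moreover have "f ` carrier E \<subseteq> carrier G" using f_closed by blast
    ultimately show ?thesis using pole unfolding C_def by blast
  qed
  show "submodule (saturation G (f ` carrier E)) ab_algebra G"
    unfolding sat
  proof (rule G.submodule_intro)
    show "\<Inter>C \<subseteq> carrier G" using carC by blast
    show "\<zero>\<^bsub>G\<^esub> \<in> \<Inter>C" using CD(2) by blast
    show "x \<oplus>\<^bsub>G\<^esub> y \<in> \<Inter>C" if "x \<in> \<Inter>C" "y \<in> \<Inter>C" for x y
      using that CD(3) by blast
    show "r \<odot>\<^bsub>G\<^esub> x \<in> \<Inter>C" if "x \<in> \<Inter>C" for r x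
      using that CD(4) by blast
  qed
  show "f u \<in> saturation G (f ` carrier E)" if "u \<in> carrier E"
  proof -
    have "f u \<in> S" if "S \<in> C" for S using that \<open>u \<in> carrier E\<close> unfolding C_def by blast
    then show ?thesis unfolding sat by blast
  qed
  show "a_image G (saturation G (f ` carrier E)) \<subseteq> b_image G (saturation G (f ` carrier E))"
  proof
    fix v assume "v \<in> a_image G (saturation G (f ` carrier E))"
    then obtain s where s: "s \<in> \<Inter>C" "v = ab_a \<odot>\<^bsub>G\<^esub> s" by (auto simp: a_image_def sat)
    have sG: "s \<in> carrier G" using s(1) carC by blast
    obtain t where t: "t \<in> carrier G" "ab_b \<odot>\<^bsub>G\<^esub> t = ab_a \<odot>\<^bsub>G\<^esub> s"
      by (rule binv_a_exists[OF pole sG])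
    \<comment> \<open>Division by \<open>b\<close> is unique in \<open>G\<close>, so the members of
      \<open>C\<close> all contain the same \<open>t\<close>, and their intersection is stable as
      well.\<close>
    have "t \<in> S" if S: "S \<in> C" for S
    proof -
      have pS: "a_image G S \<subseteq> b_image G S" using S by (simp add: C_def)
      have sS: "s \<in> S" using s(1) S by blast
      obtain t' where t': "t' \<in> S" "ab_b \<odot>\<^bsub>G\<^esub> t' = ab_a \<odot>\<^bsub>G\<^esub> s" by (rule binv_a_exists[OF pS sS])
      have "t' = t"
      proof (rule b_inj)
        show "t' \<in> carrier G" using t'(1) CD(1)[OF S] by blast
        show "ab_b \<odot>\<^bsub>G\<^esub> t' = ab_b \<odot>\<^bsub>G\<^esub> t" unfolding t'(2) t(2) ..
      qed (rule t(1))
      then show ?thesis using t'(1) by simp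
    qed
    then show "v \<in> b_image G (saturation G (f ` carrier E))"
      unfolding sat b_image_def s(2) t(2)[symmetric] by blast
  qed
  define T where "T = {s \<in> carrier G. \<exists>g. ext s g}"
  have "submodule T ab_algebra G"
  proof (rule G.submodule_intro)
    show "\<zero>\<^bsub>G\<^esub> \<in> T"
    proof -
      have "ext \<zero>\<^bsub>G\<^esub> (\<psi> \<zero>\<^bsub>E\<^esub>)"
        using ext_f[OF E.M.zero_closed]
        unfolding module_hom_zero[OF E.ab_left_module_axioms G.ab_left_module_axioms hom] .
      then show ?thesis unfolding T_def by blast
    qed
    show "x \<oplus>\<^bsub>G\<^esub> y \<in> T" if "x \<in> T" "y \<in> T" for x y
      using that ext_add[of x y] unfolding T_def by blast
    show "r \<odot>\<^bsub>G\<^esub> x \<in> T" if "x \<in> T" for r x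
      using that ext_smult[of x] unfolding T_def by blast
  qed (auto simp: T_def)
  moreover have "f ` carrier E \<subseteq> T" using ext_f f_closed unfolding T_def by blast
  moreover have "a_image G T \<subseteq> b_image G T"
  proof
    fix v assume "v \<in> a_image G T"
    then obtain s where s: "s \<in> T" "v = ab_a \<odot>\<^bsub>G\<^esub> s" by (auto simp: a_image_def)
    then have sG: "s \<in> carrier G" by (simp add: T_def)
    obtain t where t: "t \<in> carrier G" "ab_b \<odot>\<^bsub>G\<^esub> t = ab_a \<odot>\<^bsub>G\<^esub> s"
      by (rule binv_a_exists[OF pole sG])
    then have "t \<in> T" using s(1) ext_binv_a[OF sG t] unfolding T_def by blast
    then show "v \<in> b_image G T" unfolding b_image_def s(2) t(2)[symmetric] by blast
  qed
  ultimately have "T \<in> C" by (simp add: C_def)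
  then show "\<exists>g. ext s g" if "s \<in> saturation G (f ` carrier E)"
  proof -
    have "s \<in> T" using that \<open>T \<in> C\<close> unfolding sat by blast
    then show ?thesis unfolding T_def by blast
  qed
qed

section \<open>The Bernstein polynomial evaluated on coordinates\<close>

definition neg_op :: "complex fps \<Rightarrow> complex fps"
  where "neg_op g = - (fps_X * fps_deriv g + fps_const \<nu> * g)"

text \<open>\<open>neg_op\<close> is \<open>- b^(-1) a\<close> on \<open>E\<^sub>\<nu>\<close>; it
  is diagonal on monomials, with eigenvalue \<open>-(n + \<nu>)\<close> at
  \<open>X^n\<close>.\<close>

lemma fps_nth_neg_op_power: "fps_nth ((neg_op ^^ i) g) n = (- (of_nat n + \<nu>)) ^ i * fps_nth g n"
proof (induction i)
  case (Suc i)
  have "fps_nth (neg_op h) n = - (of_nat n + \<nu>) * fps_nth h n" for h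
    unfolding neg_op_def fps_neg_nth fps_add_nth fps_nth_X_deriv by (simp add: algebra_simps)
  then show ?case using Suc by simp
qed simp

text \<open>Since \<open>p\<close> annihilates \<open>S / b S\<close>, applying
  \<open>p(- b^(-1) a)\<close> to \<open>s\<close> gives \<open>b k\<close> with \<open>k\<close> in
  \<open>S\<close>. The identity is the image of this equation under the extended coordinate, on
  which \<open>- b^(-1) a\<close> is diagonal.\<close>

lemma bernstein_ext:
  fixes p :: "complex poly"
  defines "S \<equiv> saturation G (f ` carrier E)"
  assumes p: "is_simple_pole_bernstein_poly (G\<lparr>carrier := S\<rparr>) p"
    and s: "s \<in> S" and g: "ext s g"
  shows "\<exists>k\<in>S. \<exists>h. ext k h \<and>
    (\<forall>n. poly p (- (of_nat n + \<nu>)) * fps_nth g n = fps_nth (fps_X * h) n)"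
proof -
  define V where "V = G\<lparr>carrier := S\<rparr>"
  define K where "K = b_image V (carrier V)"
  have Ssub: "submodule S ab_algebra G" and Spole: "a_image G S \<subseteq> b_image G S"
    unfolding S_def by (rule saturation_submodule saturation_pole)+
  note SD = G.submoduleD[OF Ssub]
  have SG: "x \<in> carrier G" if "x \<in> S" for x using SD(1) that by blast
  have Ssm: "r \<odot>\<^bsub>G\<^esub> x \<in> S" if "x \<in> S" for r x using SD(4) that by simp
  interpret V: ab_left_module V
    unfolding V_def ab_left_module_def by (rule G.left_module_submodule[OF Ssub])
  have Vsimps [simp]: "carrier V = S" "add V = add G" "module.smult V = module.smult G" "zero V = zero G"
    by (simp_all add: V_def)
  have KI: "ab_b \<odot>\<^bsub>G\<^esub> x \<in> K" if "x \<in> S" for x using that by (auto simp: K_def b_image_def)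
  have KE: "\<exists>x\<in>S. k = ab_b \<odot>\<^bsub>G\<^esub> x" if "k \<in> K" for k using that by (auto simp: K_def b_image_def)
  have Ksub: "submodule K ab_algebra V"
  proof (rule V.submodule_intro)
    show "K \<subseteq> carrier V" using Ssm by (auto simp: K_def b_image_def)
    show "\<zero>\<^bsub>V\<^esub> \<in> K" using KI[OF SD(2)] by simp
    show "x \<oplus>\<^bsub>V\<^esub> y \<in> K" if xy: "x \<in> K" "y \<in> K" for x y
    proof -
      obtain u v where "u \<in> S" "x = ab_b \<odot>\<^bsub>G\<^esub> u" "v \<in> S" "y = ab_b \<odot>\<^bsub>G\<^esub> v" using KE xy by blast
      then show ?thesis using KI[of "u \<oplus>\<^bsub>G\<^esub> v"] SD(3) SG by (simp add: G.smult_add)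
    qed
    show "r \<odot>\<^bsub>V\<^esub> x \<in> K" if x: "x \<in> K" for r x
    proof -
      obtain u where u: "u \<in> S" "x = ab_b \<odot>\<^bsub>G\<^esub> u" using KE x by blast
      obtain r' where "ab_mult r ab_b = ab_mult ab_b r'" using mult_b_swap by blast
      then have "r \<odot>\<^bsub>G\<^esub> x = ab_b \<odot>\<^bsub>G\<^esub> (r' \<odot>\<^bsub>G\<^esub> u)"
        using SG[OF u(1)] by (simp add: u(2) flip: G.mult_smult)
      then show ?thesis using KI[OF Ssm[OF u(1)]] by simp
    qed
  qed
  interpret K: abelian_subgroup K V by (rule V.abelian_subgroup_submodule[OF Ksub])
  define neg where "neg = neg_binv_a V"
  \<comment> \<open>The opposite is written as the scalar \<open>-1\<close> so that the rule
    \<open>ext_smult\<close> applies to it.\<close>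
  have neg: "neg x = (- 1) \<odot>\<^bsub>G\<^esub> t"
    if "x \<in> S" "t \<in> S" "ab_b \<odot>\<^bsub>G\<^esub> t = ab_a \<odot>\<^bsub>G\<^esub> x" for x t
  proof -
    have "(THE y. y \<in> carrier V \<and> ab_b \<odot>\<^bsub>V\<^esub> y = ab_a \<odot>\<^bsub>V\<^esub> x) = t"
    proof (rule the_equality)
      show "t \<in> carrier V \<and> ab_b \<odot>\<^bsub>V\<^esub> t = ab_a \<odot>\<^bsub>V\<^esub> x" using that by simp
      show "y = t" if "y \<in> carrier V \<and> ab_b \<odot>\<^bsub>V\<^esub> y = ab_a \<odot>\<^bsub>V\<^esub> x" for y
        by (rule b_inj) (use that SG \<open>t \<in> S\<close> \<open>ab_b \<odot>\<^bsub>G\<^esub> t = _\<close> in simp_all)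
    qed
    then have "neg x = \<ominus>\<^bsub>V\<^esub> t" by (simp add: neg_def neg_binv_a_def)
    then show ?thesis using V.smult_minus_one[of t] that(2) by (simp add: a_inv_ab_algebra_one)
  qed
  have negS: "neg x \<in> S" "ext x h \<Longrightarrow> ext (neg x) (neg_op h)" if x: "x \<in> S" for x h
  proof -
    obtain t where t: "t \<in> S" "ab_b \<odot>\<^bsub>G\<^esub> t = ab_a \<odot>\<^bsub>G\<^esub> x" by (rule binv_a_exists[OF Spole x])
    show "neg x \<in> S" unfolding neg[OF x t] by (rule Ssm[OF t(1)])
    show "ext (neg x) (neg_op h)" if "ext x h"
      unfolding neg[OF x t] neg_op_def
      using ext_smult[OF SG[OF t(1)] ext_binv_a[OF SG[OF x] SG[OF t(1)] t(2) that], of "- 1"]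
      by (simp only: ab_act_uminus_1)
  qed
  \<comment> \<open>The induced map is well defined because \<open>b^(-1) a\<close> preserves
    \<open>b S\<close>: it sends \<open>b k\<close> to \<open>a k + b k\<close>, which is
    \<open>b (j + k)\<close> with \<open>b j = a k\<close>.\<close>
  have neg_coset: "K +>\<^bsub>V\<^esub> neg y = K +>\<^bsub>V\<^esub> neg x" if x: "x \<in> S" and y: "y \<in> K +>\<^bsub>V\<^esub> x" for x y
  proof -
    obtain k0 where "k0 \<in> K" "y = k0 \<oplus>\<^bsub>G\<^esub> x" using y by (auto simp: a_r_coset_def')
    then obtain k where k: "k \<in> S" "y = ab_b \<odot>\<^bsub>G\<^esub> k \<oplus>\<^bsub>G\<^esub> x" using KE by blast
    obtain t where t: "t \<in> S" "ab_b \<odot>\<^bsub>G\<^esub> t = ab_a \<odot>\<^bsub>G\<^esub> x" by (rule binv_a_exists[OF Spole x])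
    define l where "l = ab_a \<odot>\<^bsub>G\<^esub> k \<oplus>\<^bsub>G\<^esub> ab_b \<odot>\<^bsub>G\<^esub> k"
    obtain j where j: "j \<in> S" "ab_b \<odot>\<^bsub>G\<^esub> j = ab_a \<odot>\<^bsub>G\<^esub> k" by (rule binv_a_exists[OF Spole k(1)])
    have l1: "l = ab_b \<odot>\<^bsub>G\<^esub> (j \<oplus>\<^bsub>G\<^esub> k)"
      using SG[OF j(1)] SG[OF k(1)] by (simp add: l_def G.smult_add flip: j(2))
    moreover have "l \<in> S" unfolding l1 by (rule Ssm[OF SD(3)[OF j(1) k(1)]])
    ultimately have l: "l = ab_b \<odot>\<^bsub>G\<^esub> (j \<oplus>\<^bsub>G\<^esub> k)" "l \<in> S" .
    have yS: "y \<in> S" using k x SD(3) Ssm by simp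
    have ab: "ab_mult ab_a ab_b = ab_mult ab_b (ab_a + ab_b)"
      using ab_commutation by (simp add: ab_mult_distrib_left algebra_simps)
    have "ab_a \<odot>\<^bsub>G\<^esub> y = ab_mult ab_a ab_b \<odot>\<^bsub>G\<^esub> k \<oplus>\<^bsub>G\<^esub> ab_b \<odot>\<^bsub>G\<^esub> t"
      using SG k(1) x by (simp add: k(2) G.smult_add G.mult_smult t(2))
    also have "\<dots> = ab_b \<odot>\<^bsub>G\<^esub> (l \<oplus>\<^bsub>G\<^esub> t)"
      unfolding ab using SG k(1) t(1) l(2) by (simp add: G.mult_smult G.add_smult G.smult_add l_def)
    finally have "neg y = (- 1) \<odot>\<^bsub>G\<^esub> (l \<oplus>\<^bsub>G\<^esub> t)"
      using SD(3)[OF l(2) t(1)] by (intro neg[OF yS]) simp_all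
    also have "\<dots> = (- 1) \<odot>\<^bsub>G\<^esub> l \<oplus>\<^bsub>G\<^esub> neg x"
      using SG l(2) t(1) by (simp add: G.smult_add neg[OF x t])
    finally have "neg y = (- 1) \<odot>\<^bsub>G\<^esub> l \<oplus>\<^bsub>G\<^esub> neg x" .
    moreover have "(- 1) \<odot>\<^bsub>G\<^esub> l \<in> K"
      using V.submoduleD(4)[OF Ksub, of "- 1" l] KI[OF SD(3)[OF j(1) k(1)]] by (simp add: l(1))
    ultimately have "neg y \<in> K +>\<^bsub>V\<^esub> neg x" by (auto simp: a_r_coset_def')
    then show ?thesis using negS(1)[OF x] by (intro K.a_repr_independence'[symmetric]) simp_all
  qed
  define Q where "Q = quot_module V K"
  define T where "T = induced_map V K neg"
  interpret Q: left_module ab_algebra Q unfolding Q_def by (rule V.left_module_quot[OF Ksub])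
  have Tcos: "T (K +>\<^bsub>V\<^esub> x) = K +>\<^bsub>V\<^esub> neg x" if x: "x \<in> S" for x
  proof -
    have "x \<in> K +>\<^bsub>V\<^esub> x" using x by (intro K.a_rcos_self) simp
    then show ?thesis
      unfolding T_def induced_map_def using neg_coset[OF x] by (intro SUP_eq_const) blast+
  qed
  have iter: "(T ^^ i) (K +>\<^bsub>V\<^esub> s) = K +>\<^bsub>V\<^esub> (neg ^^ i) s \<and> (neg ^^ i) s \<in> S \<and>
      ext ((neg ^^ i) s) ((neg_op ^^ i) g)" for i
  proof (induction i)
    case 0
    then show ?case using s g by simp
  next
    case (Suc i)
    then show ?case using Tcos negS by simp
  qed
  have Qcar: "K +>\<^bsub>V\<^esub> x \<in> carrier Q" if "x \<in> S" for x
    using that V.a_rcosetsI[of K x] V.submoduleD(1)[OF Ksub] by (simp add: Q_def quot_module_def)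
  define c where "c i = ab_const (coeff p i)" for i
  have Qsm: "c i \<odot>\<^bsub>Q\<^esub> (T ^^ i) (K +>\<^bsub>V\<^esub> s) = K +>\<^bsub>V\<^esub> (c i \<odot>\<^bsub>G\<^esub> (neg ^^ i) s)" for i
    using iter[of i] V.induced_smult_coset[OF Ksub, of "(neg ^^ i) s" "c i"]
    by (simp add: Q_def quot_module_def)
  have cS: "c i \<odot>\<^bsub>G\<^esub> (neg ^^ i) s \<in> S" for i using iter[of i] Ssm by blast
  have cext: "ext (c i \<odot>\<^bsub>G\<^esub> (neg ^^ i) s) (fps_const (coeff p i) * (neg_op ^^ i) g)" for i
    using iter[of i] ext_smult[of "(neg ^^ i) s" "(neg_op ^^ i) g" "c i"] SG
    by (simp add: c_def ab_const_eq)
  \<comment> \<open>The partial sums of \<open>p(T)\<close> are followed in two ways at once, as a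
    coset in the quotient and as the extended coordinate of one of its representatives.\<close>
  have "\<exists>z\<in>S. (\<Oplus>\<^bsub>Q\<^esub>i\<in>{..n}. c i \<odot>\<^bsub>Q\<^esub> (T ^^ i) (K +>\<^bsub>V\<^esub> s)) = K +>\<^bsub>V\<^esub> z \<and>
      ext z (\<Sum>i\<le>n. fps_const (coeff p i) * (neg_op ^^ i) g)" for n
  proof (induction n)
    case 0
    show ?case
      using cS[of 0] cext[of 0] Qcar[OF cS[of 0]] unfolding Qsm
      by (intro bexI[of _ "c 0 \<odot>\<^bsub>G\<^esub> (neg ^^ 0) s"]) simp_all
  next
    case (Suc n)
    then obtain z where z: "z \<in> S"
      "(\<Oplus>\<^bsub>Q\<^esub>i\<in>{..n}. c i \<odot>\<^bsub>Q\<^esub> (T ^^ i) (K +>\<^bsub>V\<^esub> s)) = K +>\<^bsub>V\<^esub> z"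
      "ext z (\<Sum>i\<le>n. fps_const (coeff p i) * (neg_op ^^ i) g)" by blast
    define y where "y = c (Suc n) \<odot>\<^bsub>G\<^esub> (neg ^^ Suc n) s"
    have y: "y \<in> S" "ext y (fps_const (coeff p (Suc n)) * (neg_op ^^ Suc n) g)"
      unfolding y_def by (rule cS cext)+
    have "(\<Oplus>\<^bsub>Q\<^esub>i\<in>{..Suc n}. c i \<odot>\<^bsub>Q\<^esub> (T ^^ i) (K +>\<^bsub>V\<^esub> s)) =
        (K +>\<^bsub>V\<^esub> y) \<oplus>\<^bsub>Q\<^esub> (\<Oplus>\<^bsub>Q\<^esub>i\<in>{..n}. c i \<odot>\<^bsub>Q\<^esub> (T ^^ i) (K +>\<^bsub>V\<^esub> s))"
      using Qcar cS unfolding Qsm y_def by (intro Q.M.finsum_Suc) blast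
    also have "\<dots> = K +>\<^bsub>V\<^esub> (y \<oplus>\<^bsub>G\<^esub> z)"
      unfolding z(2) using K.a_rcos_sum[of y z] y(1) z(1) by (simp add: Q_def quot_module_def)
    finally have 1: "(\<Oplus>\<^bsub>Q\<^esub>i\<in>{..Suc n}. c i \<odot>\<^bsub>Q\<^esub> (T ^^ i) (K +>\<^bsub>V\<^esub> s)) = K +>\<^bsub>V\<^esub> (y \<oplus>\<^bsub>G\<^esub> z)" .
    have "ext (y \<oplus>\<^bsub>G\<^esub> z) (\<Sum>i\<le>Suc n. fps_const (coeff p i) * (neg_op ^^ i) g)"
      using ext_add[OF SG[OF y(1)] SG[OF z(1)] y(2) z(3)] by (simp only: sum.atMost_Suc add.commute)
    then show ?case using 1 SD(3)[OF y(1) z(1)] by blast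
  qed
  from this[of "degree p"] obtain z where z: "z \<in> S"
    "poly_act Q T p (K +>\<^bsub>V\<^esub> s) = K +>\<^bsub>V\<^esub> z"
    "ext z (\<Sum>i\<le>degree p. fps_const (coeff p i) * (neg_op ^^ i) g)"
    unfolding poly_act_def c_def by blast
  have "annihilates Q T p"
    using p unfolding is_simple_pole_bernstein_poly_def is_min_poly_def Q_def T_def neg_def K_def V_def
    by blast
  then have "poly_act Q T p (K +>\<^bsub>V\<^esub> s) = \<zero>\<^bsub>Q\<^esub>"
    using Qcar[OF s] by (simp add: annihilates_def)
  then have "K +>\<^bsub>V\<^esub> z = K" using z(2) by (simp add: Q_def quot_module_def)
  moreover have "z \<in> K +>\<^bsub>V\<^esub> z" using z(1) by (intro K.a_rcos_self) simp
  ultimately have "z \<in> K" by simp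
  then obtain k where k: "k \<in> S" "z = ab_b \<odot>\<^bsub>G\<^esub> k" using KE by blast
  obtain h where h: "ext k h" using saturation_ext k(1) unfolding S_def by blast
  have "ext z (fps_X * h)" using ext_smult[OF SG[OF k(1)] h, of ab_b] by (simp add: k(2))
  then have "(\<Sum>i\<le>degree p. fps_const (coeff p i) * (neg_op ^^ i) g) = fps_X * h"
    using ext_unique[OF SG[OF z(1)] z(3)] by blast
  moreover have "fps_nth (\<Sum>i\<le>degree p. fps_const (coeff p i) * (neg_op ^^ i) g) n =
      poly p (- (of_nat n + \<nu>)) * fps_nth g n" for n
  proof -
    have "fps_nth (\<Sum>i\<le>degree p. fps_const (coeff p i) * (neg_op ^^ i) g) n =
        (\<Sum>i\<le>degree p. coeff p i * ((- (of_nat n + \<nu>)) ^ i * fps_nth g n))"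
      by (simp only: fps_sum_nth fps_mult_left_const_nth fps_nth_neg_op_power)
    also have "\<dots> = poly p (- (of_nat n + \<nu>)) * fps_nth g n"
      by (simp only: poly_altdef sum_distrib_right mult.assoc)
    finally show ?thesis .
  qed
  ultimately have "\<forall>n. poly p (- (of_nat n + \<nu>)) * fps_nth g n = fps_nth (fps_X * h) n"
    by (simp only:) simp
  then show ?thesis using k(1) h by blast
qed

text \<open>The functionals sending an element of the saturation to the coefficients of its image are
  eigenvectors of the transpose of \<open>- b\<^sup>-\<^sup>1 a\<close>; the first nonzero one vanishes on the image of
  \<open>b\<close>, so its eigenvalue is a root of the Bernstein polynomial.\<close>

lemma exponent_root:
  assumes p: "is_simple_pole_bernstein_poly (G\<lparr>carrier := saturation G (f ` carrier E)\<rparr>) p"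
    and u: "u \<in> carrier E" "\<psi> u \<noteq> 0"
  shows "\<exists>n. poly p (- (of_nat n + \<nu>)) = 0"
proof -
  define P where "P n \<longleftrightarrow> (\<exists>s\<in>saturation G (f ` carrier E). \<exists>g. ext s g \<and> fps_nth g n \<noteq> 0)" for n
  obtain m where "fps_nth (\<psi> u) m \<noteq> 0" using u(2) by (metis fps_ext fps_zero_nth)
  then have "P m" using ext_f[OF u(1)] f_in_saturation[OF u(1)] unfolding P_def by blast
  define n where "n = (LEAST n. P n)"
  have "P n" unfolding n_def by (rule LeastI) (rule \<open>P m\<close>)
  then obtain s g where s: "s \<in> saturation G (f ` carrier E)" "ext s g" "fps_nth g n \<noteq> 0"
    unfolding P_def by blast
  obtain k h where k: "k \<in> saturation G (f ` carrier E)" "ext k h"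
    "\<forall>n. poly p (- (of_nat n + \<nu>)) * fps_nth g n = fps_nth (fps_X * h) n"
    using bernstein_ext[OF p s(1,2)] by blast
  have "fps_nth (fps_X * h) n = 0"
  proof (cases n)
    case 0
    then show ?thesis by simp
  next
    case (Suc l)
    then have "\<not> P l" using not_less_Least[of l P] by (simp add: n_def)
    then have "fps_nth h l = 0" using k(1,2) unfolding P_def by blast
    then show ?thesis using Suc by simp
  qed
  then have "poly p (- (of_nat n + \<nu>)) * fps_nth g n = 0" using k(3) by simp
  then show ?thesis using s(3) by auto
qed

end

text \<open>The nonzero value of \<open>\<psi>\<close> is what ties \<open>\<nu>\<close> to
  \<open>E\<close>, as the zero map is linear into every \<open>E\<^sub>\<nu>\<close>. Some
  \<open>-(n + \<nu>)\<close> is then a root of the Bernstein polynomial, hence rational.\<close>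

lemma geometric_exponent_real:
  assumes "ab_left_module E" "geometric E"
    and "\<And>u v. u \<in> carrier E \<Longrightarrow> v \<in> carrier E \<Longrightarrow> \<psi> (u \<oplus>\<^bsub>E\<^esub> v) = \<psi> u + \<psi> v"
    and "\<And>r u. u \<in> carrier E \<Longrightarrow> \<psi> (r \<odot>\<^bsub>E\<^esub> u) = ab_act \<nu> r (\<psi> u)"
    and u: "u \<in> carrier E" "\<psi> u \<noteq> 0"
  shows "\<nu> \<in> \<real>"
proof -
  obtain p where "is_bernstein_poly E p"
    and roots: "\<And>z. poly p z = 0 \<Longrightarrow> \<exists>q::rat. z = of_rat q \<and> q < 0"
    using assms(2) unfolding geometric_def by blast
  then obtain G :: std_module and f where G: "simple_pole G" and f: "embeds_via E G f"
    and p: "is_simple_pole_bernstein_poly (G\<lparr>carrier := saturation G (f ` carrier E)\<rparr>) p"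
    unfolding is_bernstein_poly_def by blast
  obtain k e where basis: "ab_basis G k e" and lm: "left_module ab_algebra G"
    using G unfolding simple_pole_def ab_module_def ab_module_of_rank_def by blast
  interpret G: ab_left_module G unfolding ab_left_module_def by (rule lm)
  obtain \<phi> where \<phi>1: "\<And>x. x \<in> carrier G \<Longrightarrow> G.lincomb e k (\<phi> x) = x"
    and \<phi>4: "\<And>r x i. x \<in> carrier G \<Longrightarrow> i < k \<Longrightarrow> \<phi> (ab_of_fps r \<odot>\<^bsub>G\<^esub> x) i = r * \<phi> x i"
    by (rule G.basis_coords[OF basis]) blast
  have b_inj: "s = t" if s: "s \<in> carrier G" and t: "t \<in> carrier G"
    and eq: "ab_b \<odot>\<^bsub>G\<^esub> s = ab_b \<odot>\<^bsub>G\<^esub> t" for s t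
  proof -
    have "\<phi> s i = \<phi> t i" if "i < k" for i
    proof -
      have "fps_X * \<phi> s i = fps_X * \<phi> t i"
        using \<phi>4[OF s that, of fps_X] \<phi>4[OF t that, of fps_X] eq by (simp add: ab_b_eq)
      then show ?thesis by (simp only: mult_left_cancel[OF fps_X_neq_zero])
    qed
    then have "G.lincomb e k (\<phi> s) = G.lincomb e k (\<phi> t)" by (rule G.lincomb_cong)
    then show ?thesis using \<phi>1 s t by simp
  qed
  interpret E: ab_left_module E by fact
  interpret pole_extension E G f \<psi> \<nu>
  proof
    show "f \<in> module_hom ab_algebra E G" "inj_on f (carrier E)"
      using f by (simp_all add: embeds_via_def)
    show "a_image G (carrier G) \<subseteq> b_image G (carrier G)" using G by (simp add: simple_pole_def)
  qed (fact assms(3) assms(4) b_inj)+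
  obtain n where "poly p (- (of_nat n + \<nu>)) = 0" using exponent_root[OF p u] by blast
  then obtain q where q: "- (of_nat n + \<nu>) = of_rat q" using roots by blast
  have "\<nu> = - (- (of_nat n + \<nu>)) - of_nat n" by simp
  then have "\<nu> = - of_rat q - of_nat n" by (simp only: q)
  moreover have "(of_rat q :: complex) \<in> \<real>"
    by (cases q) (simp add: of_rat_rat)
  ultimately show ?thesis by simp
qed

theorem proposition2p3p3:
  fixes l :: real and k :: nat and E :: "(ab_series, 'e) module"
  assumes "l \<in> \<rat>" and "0 < l" and "l \<le> 1"
    and "fresco E" and "primitive l E" and "ab_module_of_rank k E"
  shows "semi_simple E \<longleftrightarrow>
    (\<exists>F (\<mu> :: nat \<Rightarrow> real). jordan_hoelder E k F \<and>
       (\<forall>j\<in>{1..k}. module_isomorphic ab_algebra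
          (subquotient E (F j) (F (j - 1))) (E_mod (complex_of_real (\<mu> j)))) \<and>
       strict_antimono_on {1..k} (\<lambda>j. \<mu> j + real j))"
proof -
  obtain e where basis: "ab_basis E k e" and lm: "left_module ab_algebra E"
    using assms(6) unfolding ab_module_of_rank_def by blast
  interpret E: ab_left_module E unfolding ab_left_module_def by (rule lm)
  have geo: "geometric E" and reg: "regular E"
    using assms(4) by (simp_all add: fresco_def geometric_def)
  obtain x where x: "x \<in> carrier E" and cyc: "carrier E = E.cyclic x"
    using assms(4) unfolding fresco_def E.cyclic_def by blast
  show ?thesis
  proof
    assume "semi_simple E"
    then obtain n \<nu> f where ann: "E.ann x = coord_ann \<nu> f {..<n}"
      using semi_simple_imp_ann[OF E.ab_left_module_axioms _ x] by blast
    \<comment> \<open>A zero component constrains neither the annihilator nor its own exponent,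
      which might fail to be real.\<close>
    define I where "I = {i. i < n \<and> f i \<noteq> 0}"
    have real: "\<nu> i = complex_of_real (Re (\<nu> i))" if i: "i \<in> I" for i
    proof -
      \<comment> \<open>The projection to component \<open>i\<close>, sending \<open>r x\<close> to
        \<open>r\<close> acting on \<open>f i\<close>; it is well defined because every scalar that
        kills \<open>x\<close> kills \<open>f i\<close>.\<close>
      define \<psi> where "\<psi> u = ab_act (\<nu> i) (SOME r. u = r \<odot>\<^bsub>E\<^esub> x) (f i)" for u
      have \<psi>: "\<psi> (r \<odot>\<^bsub>E\<^esub> x) = ab_act (\<nu> i) r (f i)" for r
      proof -
        define s where "s = (SOME s. r \<odot>\<^bsub>E\<^esub> x = s \<odot>\<^bsub>E\<^esub> x)"
        have "r \<odot>\<^bsub>E\<^esub> x = s \<odot>\<^bsub>E\<^esub> x" unfolding s_def by (rule someI[of _ r]) simp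
        then have "r - s \<in> E.ann x" using E.smult_eq_iff[OF x] by simp
        then have "ab_act (\<nu> i) (r - s) (f i) = 0" using i by (simp add: ann coord_ann_def I_def)
        then show ?thesis by (simp add: \<psi>_def s_def ab_act_diff_left)
      qed
      have rep: "\<exists>r. u = r \<odot>\<^bsub>E\<^esub> x" if "u \<in> carrier E" for u
        using that unfolding cyc E.cyclic_def by blast
      have "\<nu> i \<in> \<real>"
      proof (rule geometric_exponent_real[OF E.ab_left_module_axioms geo, of \<psi>])
        show "\<psi> (u \<oplus>\<^bsub>E\<^esub> v) = \<psi> u + \<psi> v" if u: "u \<in> carrier E" and v: "v \<in> carrier E" for u v
        proof -
          obtain r s where "u = r \<odot>\<^bsub>E\<^esub> x" "v = s \<odot>\<^bsub>E\<^esub> x" using rep[OF u] rep[OF v] by blast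
          then have "\<psi> (u \<oplus>\<^bsub>E\<^esub> v) = \<psi> ((r + s) \<odot>\<^bsub>E\<^esub> x)" using x by (simp add: E.add_smult)
          then show ?thesis unfolding \<open>u = _\<close> \<open>v = _\<close> \<psi> ab_act_add_left .
        qed
        show "\<psi> (r \<odot>\<^bsub>E\<^esub> u) = ab_act (\<nu> i) r (\<psi> u)" if u: "u \<in> carrier E" for r u
        proof -
          obtain s where "u = s \<odot>\<^bsub>E\<^esub> x" using rep[OF u] by blast
          then have "\<psi> (r \<odot>\<^bsub>E\<^esub> u) = \<psi> (ab_mult r s \<odot>\<^bsub>E\<^esub> x)" using x by (simp add: E.mult_smult)
          then show ?thesis unfolding \<open>u = _\<close> \<psi> ab_act_mult .
        qed
        show "x \<in> carrier E" by (rule x)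
        show "\<psi> x \<noteq> 0" using \<psi>[of 1] x i by (simp add: I_def)
      qed
      then show ?thesis by (rule of_real_Re[symmetric])
    qed
    have "coord_ann \<nu> f {..<n} = coord_ann (\<lambda>i. complex_of_real (Re (\<nu> i))) f I"
    proof -
      have "coord_ann \<nu> f {..<n} = coord_ann \<nu> f I" by (auto simp: coord_ann_def I_def)
      also have "\<dots> = coord_ann (\<lambda>i. complex_of_real (Re (\<nu> i))) f I"
      proof -
        have "ab_act (\<nu> i) r (f i) = ab_act (complex_of_real (Re (\<nu> i))) r (f i)" if "i \<in> I" for i r
          by (rule arg_cong[OF real[OF that], of "\<lambda>z. ab_act z r (f i)"])
        then show ?thesis
          unfolding coord_ann_def by (intro Collect_cong ball_cong refl) (simp only:)
      qed
      finally show ?thesis .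
    qed
    have finI: "finite I" by (simp add: I_def)
    \<comment> \<open>Any number strictly below all exponents starts the induction; 0 is inserted to
      cover an empty \<open>I\<close>.\<close>
    define c where "c = Min (insert 0 ((\<lambda>i. Re (\<nu> i)) ` I)) - 1"
    have bound: "c < Re (\<nu> i) + real j" if "i \<in> I" "fps_nth (f i) j \<noteq> 0" for i j
    proof -
      have "Min (insert 0 ((\<lambda>i. Re (\<nu> i)) ` I)) \<le> Re (\<nu> i)" using finI that(1) by (intro Min_le) auto
      then show ?thesis unfolding c_def by linarith
    qed
    obtain m \<mu> S where
      fac: "coord_ann (\<lambda>i. complex_of_real (Re (\<nu> i))) f I =
        left_ideal (jh_prod (\<lambda>j. complex_of_real (\<mu> j)) S m)"
      and S: "\<forall>j. fps_nth (S j) 0 \<noteq> 0" and anti: "strict_antimono_on {1..m} (\<lambda>j. \<mu> j + real j)"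
      using coord_ann_factorization[of I f c "\<lambda>i. Re (\<nu> i)", OF finI bound] by blast
    have annS: "E.ann x = left_ideal (jh_prod (\<lambda>j. complex_of_real (\<mu> j)) S m)"
      unfolding ann \<open>coord_ann \<nu> f {..<n} = _\<close> by (rule fac)
    obtain F where F: "F 0 = {\<zero>\<^bsub>E\<^esub>}" "F m = carrier E" "\<forall>j\<le>m. submodule (F j) ab_algebra E"
      "\<forall>j\<in>{1..m}. \<exists>\<pi>. layer E (F j) (F (j - 1)) (complex_of_real (\<mu> j)) \<pi>"
      using E.ann_chain[OF _ x annS] S cyc by metis
    \<comment> \<open>The factorization does not control the number of its factors; the chain built
      from it does, through the rank.\<close>
    have mk: "m = k"
      by (rule E.chain_length_eq_rank[OF basis, of m F "\<lambda>j. complex_of_real (\<mu> j)"]) (use F in auto)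
    have "jordan_hoelder E m F" "\<And>j. j \<in> {1..m} \<Longrightarrow>
        module_isomorphic ab_algebra (subquotient E (F j) (F (j - 1))) (E_mod (complex_of_real (\<mu> j)))"
      by (rule E.chain_jordan_hoelder[of m F "\<lambda>j. complex_of_real (\<mu> j)"]; use F in auto)+
    then show "\<exists>F (\<mu> :: nat \<Rightarrow> real). jordan_hoelder E k F \<and>
       (\<forall>j\<in>{1..k}. module_isomorphic ab_algebra
          (subquotient E (F j) (F (j - 1))) (E_mod (complex_of_real (\<mu> j)))) \<and>
       strict_antimono_on {1..k} (\<lambda>j. \<mu> j + real j)"
      using anti unfolding mk by blast
  next
    assume "\<exists>F (\<mu> :: nat \<Rightarrow> real). jordan_hoelder E k F \<and>
       (\<forall>j\<in>{1..k}. module_isomorphic ab_algebra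
          (subquotient E (F j) (F (j - 1))) (E_mod (complex_of_real (\<mu> j)))) \<and>
       strict_antimono_on {1..k} (\<lambda>j. \<mu> j + real j)"
    then obtain F and \<mu> :: "nat \<Rightarrow> real" where JH: "jordan_hoelder E k F"
      and iso: "\<And>j. j \<in> {1..k} \<Longrightarrow> module_isomorphic ab_algebra
          (subquotient E (F j) (F (j - 1))) (E_mod (complex_of_real (\<mu> j)))"
      and anti: "strict_antimono_on {1..k} (\<lambda>j. \<mu> j + real j)" by blast
    have F: "F 0 = {\<zero>\<^bsub>E\<^esub>}" "F k = E.cyclic x" "\<And>j. j \<le> k \<Longrightarrow> submodule (F j) ab_algebra E"
      "\<And>j. j \<in> {1..k} \<Longrightarrow> F (j - 1) \<subseteq> F j"
      using JH by (auto simp: jordan_hoelder_def normal_submodule_def cyc)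
    have "\<exists>\<pi>. layer E (F j) (F (j - 1)) (complex_of_real (\<mu> j)) \<pi>" if j: "j \<in> {1..k}" for j
      by (rule E.layer_of_isomorphic) (use F iso j in auto)
    from E.chain_ann[OF this F(1) x F(2)] obtain S where
      S: "\<forall>j\<in>{1..k}. fps_nth (S j) 0 \<noteq> 0"
        "E.ann x = left_ideal (jh_prod (\<lambda>j. complex_of_real (\<mu> j)) S k)" by blast
    obtain \<nu> f where "coord_ann (\<lambda>i. complex_of_real (\<nu> i)) f {..<k} =
        left_ideal (jh_prod (\<lambda>j. complex_of_real (\<mu> j)) S k)"
      using jh_prod_coord_ann[of k S \<mu>] S(1) anti by blast
    then show "semi_simple E"
      using semi_simple_if_ann[OF E.ab_left_module_axioms reg x cyc] S(2) by metis
  qed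
qed

end
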